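(* The pathlength distance induced by the Finsler metric $G^\infty$ provides an upper bound for the Fréchet distance: for all $F_0,F_1\in B_i(M,\mathbb R^n)$, $$\mathrm{dist}_\infty^{B_i}(F_0,F_1) \leq \mathrm{dist}_{G^\infty}^{B_i}(F_0,F_1) = \inf_f \int_0^1 \|f_t\|_{G^\infty}\, dt,$$ where the infimum is taken over all paths $f:[0,1] \to \mathrm{Imm}(M,\mathbb R^n)$ with $\pi(f(0))=F_0$, $\pi(f(1))=F_1$.
   Context: $M$ is a compact connected smooth manifold without boundary, $\dim M\le n$; $\mathbb R^n$ carries the Euclidean metric. $\mathrm{Imm}(M,\mathbb R^n)$ is the Fréchet manifold of smooth immersions, $T_f\mathrm{Imm}=C^\infty(M,\mathbb R^n)$; $B_i(M,\mathbb R^n)=\mathrm{Imm}(M,\mathbb R^n)/\mathrm{Diff}(M)$ with projection $\pi$. For $h\in T_f\mathrm{Imm}$, $h^\bot$ is its pointwise component normal to $f$. The Finsler metric is $G^\infty:T\mathrm{Imm}(M,\mathbb R^n)\to\mathbb R$, $h\mapsto\|h\|_{G^\infty}=\|h^\bot\|_{L^\infty}$. The Fréchet distance is $\mathrm{dist}^{B_i}_\infty(F_0,F_1)=\inf\{\|f_0-f_1\|_{L^\infty}:\pi(f_0)=F_0,\ \pi(f_1)=F_1\}$. *)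

theory Defs
  imports "HOL-Analysis.Analysis"
begin

section \<open>Smooth functions on relatively open subsets of a linear space\<close>

definition dir_deriv ::
  "('e::real_normed_vector \<Rightarrow> 'b::real_normed_vector) \<Rightarrow> 'e \<Rightarrow> 'e \<Rightarrow> 'b" where
  "dir_deriv f v x = vector_derivative (\<lambda>t. f (x + t *\<^sub>R v)) (at 0)"

primrec iter_deriv ::
  "('e::real_normed_vector \<Rightarrow> 'b::real_normed_vector) \<Rightarrow> 'e list \<Rightarrow> 'e \<Rightarrow> 'b" where
  "iter_deriv f [] = f"
| "iter_deriv f (v # vs) = dir_deriv (iter_deriv f vs) v"

text \<open>\<open>C\<^sup>\<infinity>\<close> on a relatively open subset \<open>W\<close> of the linear subspace \<open>V\<close>: all iterated partial
  derivatives in directions of \<open>V\<close> exist and are continuous. The values of \<open>f\<close> outside \<open>W\<close> are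
  irrelevant, since \<open>x + t *\<^sub>R v \<in> W\<close> for \<open>x \<in> W\<close>, \<open>v \<in> V\<close> and small \<open>t\<close>.\<close>

definition smooth_on ::
  "'e::real_normed_vector set \<Rightarrow> 'e set \<Rightarrow> ('e \<Rightarrow> 'b::real_normed_vector) \<Rightarrow> bool" where
  "smooth_on V W f \<longleftrightarrow>
    (\<forall>vs. set vs \<subseteq> V \<longrightarrow>
      continuous_on W (iter_deriv f vs) \<and>
      (\<forall>v\<in>V. \<forall>x\<in>W. (\<lambda>t. iter_deriv f vs (x + t *\<^sub>R v)) differentiable (at (0::real))))"


section \<open>Manifolds, smooth functions, diffeomorphisms\<close>

text \<open>Charts take values in a linear subspace \<open>model M\<close> of a Euclidean space rather than in the whole
  type, because the types of class \<^class>\<open>euclidean_space\<close> have positive dimension and manifolds of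
  dimension 0 are to be included. A chart is a pair \<open>(U, \<phi>)\<close> of its domain and its coordinate map;
  the values of \<open>\<phi>\<close> outside \<open>U\<close> play no role.\<close>

record ('m, 'e) manifold =
  top_of :: "'m topology"
  model :: "'e set"
  atlas :: "('m set \<times> ('m \<Rightarrow> 'e)) set"

abbreviation points :: "('m, 'e) manifold \<Rightarrow> 'm set" where
  "points M \<equiv> topspace (top_of M)"

definition smooth_manifold :: "('m, 'e::euclidean_space) manifold \<Rightarrow> bool" where
  "smooth_manifold M \<longleftrightarrow>
    Hausdorff_space (top_of M) \<and> second_countable (top_of M) \<and>
    subspace (model M) \<and>
    (\<Union>(U, \<phi>)\<in>atlas M. U) = points M \<and>
    (\<forall>(U, \<phi>)\<in>atlas M.
      openin (top_of M) U \<and>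
      openin (top_of_set (model M)) (\<phi> ` U) \<and>
      homeomorphic_map (subtopology (top_of M) U) (top_of_set (\<phi> ` U)) \<phi>) \<and>
    (\<forall>(U, \<phi>)\<in>atlas M. \<forall>(W, \<psi>)\<in>atlas M.
      smooth_on (model M) (\<phi> ` (U \<inter> W)) (\<psi> \<circ> inv_into U \<phi>))"

text \<open>\<open>C\<^sup>\<infinity>(M, \<real>\<^sup>n)\<close>. Functions are \<^const>\<open>undefined\<close> outside \<open>M\<close>, so that equality is equality
  on \<open>M\<close>.\<close>

definition smooth_functions ::
  "('m, 'e::euclidean_space) manifold \<Rightarrow> ('m \<Rightarrow> real ^ 'n) set" where
  "smooth_functions M =
    {f \<in> extensional (points M).
      \<forall>(U, \<phi>)\<in>atlas M. smooth_on (model M) (\<phi> ` U) (f \<circ> inv_into U \<phi>)}"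

definition smooth_self_map :: "('m, 'e::euclidean_space) manifold \<Rightarrow> ('m \<Rightarrow> 'm) \<Rightarrow> bool" where
  "smooth_self_map M g \<longleftrightarrow>
    continuous_map (top_of M) (top_of M) g \<and>
    (\<forall>(U, \<phi>)\<in>atlas M. \<forall>(W, \<psi>)\<in>atlas M.
      smooth_on (model M) (\<phi> ` (U \<inter> g -` W)) (\<psi> \<circ> g \<circ> inv_into U \<phi>))"

definition Diff :: "('m, 'e::euclidean_space) manifold \<Rightarrow> ('m \<Rightarrow> 'm) set" where
  "Diff M = {g. bij_betw g (points M) (points M) \<and> smooth_self_map M g \<and>
    smooth_self_map M (inv_into (points M) g)}"


section \<open>Immersions and the shape space\<close>

definition Imm :: "('m, 'e::euclidean_space) manifold \<Rightarrow> ('m \<Rightarrow> real ^ 'n) set" where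
  "Imm M = {f \<in> smooth_functions M.
    \<forall>(U, \<phi>)\<in>atlas M. \<forall>x\<in>U.
      inj_on (\<lambda>v. dir_deriv (f \<circ> inv_into U \<phi>) v (\<phi> x)) (model M)}"

definition shape :: "('m, 'e::euclidean_space) manifold \<Rightarrow> ('m \<Rightarrow> real ^ 'n) \<Rightarrow> ('m \<Rightarrow> real ^ 'n) set"
  where "shape M f = {compose (points M) f g | g. g \<in> Diff M}"

definition B_i :: "('m, 'e::euclidean_space) manifold \<Rightarrow> ('m \<Rightarrow> real ^ 'n) set set" where
  "B_i M = shape M ` Imm M"


section \<open>The Frechet distance\<close>

text \<open>Only used for continuous functions, for which the supremum is the essential supremum.\<close>

definition Linf_norm :: "('m, 'e::euclidean_space) manifold \<Rightarrow> ('m \<Rightarrow> real ^ 'n) \<Rightarrow> ennreal" where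
  "Linf_norm M h = (SUP x\<in>points M. ennreal (norm (h x)))"

definition dist_Frechet :: "('m, 'e::euclidean_space) manifold \<Rightarrow>
    ('m \<Rightarrow> real ^ 'n) set \<Rightarrow> ('m \<Rightarrow> real ^ 'n) set \<Rightarrow> ennreal" where
  "dist_Frechet M F0 F1 =
    Inf {Linf_norm M (\<lambda>x. f0 x - f1 x) | f0 f1.
      f0 \<in> Imm M \<and> f1 \<in> Imm M \<and> shape M f0 = F0 \<and> shape M f1 = F1}"


section \<open>The Finsler metric and its pathlength distance\<close>

text \<open>The image of \<open>T\<^sub>xM\<close> under the derivative of \<open>f\<close>; every chart around \<open>x\<close> yields the same
  subspace.\<close>

definition tangent_image ::
  "('m, 'e::euclidean_space) manifold \<Rightarrow> ('m \<Rightarrow> real ^ 'n) \<Rightarrow> 'm \<Rightarrow> (real ^ 'n) set" where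
  "tangent_image M f x =
    (\<Union>(U, \<phi>)\<in>{c \<in> atlas M. x \<in> fst c}.
      (\<lambda>v. dir_deriv (f \<circ> inv_into U \<phi>) v (\<phi> x)) ` model M)"

definition normal_part ::
  "('m, 'e::euclidean_space) manifold \<Rightarrow> ('m \<Rightarrow> real ^ 'n) \<Rightarrow> ('m \<Rightarrow> real ^ 'n) \<Rightarrow> 'm \<Rightarrow> real ^ 'n"
  where
  "normal_part M f h x =
    (THE w. w \<in> orthogonal_comp (tangent_image M f x) \<and> h x - w \<in> tangent_image M f x)"

definition G_inf ::
  "('m, 'e::euclidean_space) manifold \<Rightarrow> ('m \<Rightarrow> real ^ 'n) \<Rightarrow> ('m \<Rightarrow> real ^ 'n) \<Rightarrow> ennreal" where
  "G_inf M f h = Linf_norm M (normal_part M f h)"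

text \<open>Convergence in the Frechet space \<open>C\<^sup>\<infinity>(M, \<real>\<^sup>n)\<close>: uniform convergence of all derivatives on
  compact subsets of charts.\<close>

definition Cinf_limit :: "('m, 'e::euclidean_space) manifold \<Rightarrow>
    ('s \<Rightarrow> 'm \<Rightarrow> real ^ 'n) \<Rightarrow> ('m \<Rightarrow> real ^ 'n) \<Rightarrow> 's filter \<Rightarrow> bool" where
  "Cinf_limit M h l F \<longleftrightarrow>
    (\<forall>(U, \<phi>)\<in>atlas M. \<forall>K vs. compact K \<and> K \<subseteq> \<phi> ` U \<and> set vs \<subseteq> model M \<longrightarrow>
      uniform_limit K (\<lambda>s. iter_deriv (h s \<circ> inv_into U \<phi>) vs)
        (iter_deriv (l \<circ> inv_into U \<phi>) vs) F)"

text \<open>Smooth curves \<open>[0,1] \<rightarrow> C\<^sup>\<infinity>(M, \<real>\<^sup>n)\<close>; \<open>D k\<close> is the \<open>k\<close>-th time derivative, one-sided at the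
  end points.\<close>

definition smooth_curve ::
  "('m, 'e::euclidean_space) manifold \<Rightarrow> (real \<Rightarrow> 'm \<Rightarrow> real ^ 'n) \<Rightarrow> bool" where
  "smooth_curve M f \<longleftrightarrow>
    (\<exists>D :: nat \<Rightarrow> real \<Rightarrow> 'm \<Rightarrow> real ^ 'n. D 0 = f \<and>
      (\<forall>k. \<forall>t\<in>{0..1}. D k t \<in> smooth_functions M \<and>
        Cinf_limit M (\<lambda>s x. (D k s x - D k t x) /\<^sub>R (s - t)) (D (Suc k) t)
          (at t within {0..1})))"

text \<open>\<open>Imm(M, \<real>\<^sup>n)\<close> is an open subset of \<open>C\<^sup>\<infinity>(M, \<real>\<^sup>n)\<close>, so no further smoothness condition is
  needed.\<close>

definition Imm_path ::
  "('m, 'e::euclidean_space) manifold \<Rightarrow> (real \<Rightarrow> 'm \<Rightarrow> real ^ 'n) \<Rightarrow> bool" where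
  "Imm_path M f \<longleftrightarrow> smooth_curve M f \<and> (\<forall>t\<in>{0..1}. f t \<in> Imm M)"

definition velocity :: "(real \<Rightarrow> 'm \<Rightarrow> real ^ 'n) \<Rightarrow> real \<Rightarrow> 'm \<Rightarrow> real ^ 'n" where
  "velocity f t x = vector_derivative (\<lambda>s. f s x) (at t within {0..1})"

definition G_length ::
  "('m, 'e::euclidean_space) manifold \<Rightarrow> (real \<Rightarrow> 'm \<Rightarrow> real ^ 'n) \<Rightarrow> ennreal" where
  "G_length M f = (\<integral>\<^sup>+ t\<in>{0..1}. G_inf M (f t) (velocity f t) \<partial>lborel)"

definition dist_G_Imm :: "('m, 'e::euclidean_space) manifold \<Rightarrow>
    ('m \<Rightarrow> real ^ 'n) \<Rightarrow> ('m \<Rightarrow> real ^ 'n) \<Rightarrow> ennreal" where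
  "dist_G_Imm M f0 f1 = (INF f\<in>{f. Imm_path M f \<and> f 0 = f0 \<and> f 1 = f1}. G_length M f)"

text \<open>The induced distance on the quotient. It is \<open>\<infinity>\<close> if no path joins the two shapes.\<close>

definition dist_G :: "('m, 'e::euclidean_space) manifold \<Rightarrow>
    ('m \<Rightarrow> real ^ 'n) set \<Rightarrow> ('m \<Rightarrow> real ^ 'n) set \<Rightarrow> ennreal" where
  "dist_G M F0 F1 =
    Inf {dist_G_Imm M f0 f1 | f0 f1.
      f0 \<in> Imm M \<and> f1 \<in> Imm M \<and> shape M f0 = F0 \<and> shape M f1 = F1}"

end

theory Submission
  imports Defs
begin

text \<open>
  Only the component of the velocity normal to the immersion changes the shape; the tangential
  component is a change of parametrisation. The usual proof integrates the tangential component to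
  an isotopy \<open>\<phi>\<^sub>t\<close> of \<open>M\<close> along which \<open>f\<^sub>t \<circ> \<phi>\<^sub>t\<close> moves purely normally, and then estimates
  \<open>\<parallel>f\<^sub>1 \<circ> \<phi>\<^sub>1 - f\<^sub>0\<parallel>\<close> by the length of the path. The Frechet distance is an infimum over all
  reparametrisations, so the isotopy may be replaced by a finite chain: it is enough to find, for \<open>s\<close> near \<open>t\<close>,
  one diffeomorphism \<open>g\<close> with \<open>\<parallel>f\<^sub>s \<circ> g - f\<^sub>t\<parallel> \<le> \<bar>s - t\<bar> (G(t) + \<epsilon>)\<close>, where \<open>G(t)\<close> is the Finsler norm
  of the velocity at time \<open>t\<close>, and to add up these estimates with the triangle inequality. This
  replaces the flow of a time-dependent vector field by elementary diffeomorphisms.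

  The diffeomorphisms are composed of shears \<open>y \<mapsto> y + h a(y) v\<close> in charts, where \<open>a\<close> has compact
  support and \<open>v\<close> is constant. For small \<open>h\<close> such a shear is a diffeomorphism
  (\<open>smooth_shear_inverse\<close>, \<open>chart_lift_shear_Diff\<close>), and it moves a function \<open>F\<close> by
  \<open>h a D\<^sub>v F\<close> up to \<open>o(h)\<close>, uniformly on \<open>M\<close> (\<open>chart_lift_generates\<close>). A tangential velocity is
  approximated near each point by the derivative of \<open>f\<^sub>t\<close> in a constant direction, and these
  approximations are averaged by a smooth partition of unity (\<open>approximating_generator\<close>); because the
  estimate is convex in the vector field, averaging does not spoil it. The resulting
  infinitesimal estimate is \<open>near_along_curve\<close>.

  The function \<open>G\<close> is a supremum over the points of \<open>M\<close> of norms of normal components, each of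
  which is lower semicontinuous in time because the derivative of an immersion is injective
  (\<open>norm_normal_part_lower_semicontinuous\<close>). Hence \<open>G\<close> is measurable and \<open>(b - a) G(t)\<close> exceeds
  the integral of \<open>G\<close> over a short interval \<open>[a, b]\<close> around \<open>t\<close> by at most \<open>\<epsilon> (b - a)\<close>. A bisection
  argument sums the local estimates to the length of the whole path
  (\<open>integrate_local_bound\<close>, \<open>near_le_G_length\<close>). The formula for the pathlength distance only merges two
  infima.
\<close>

section \<open>Calculus on relatively open subsets of a subspace\<close>

abbreviation (input) has_dir_deriv ::
  "('e::real_normed_vector \<Rightarrow> 'b::real_normed_vector) \<Rightarrow> 'e \<Rightarrow> 'b \<Rightarrow> 'e \<Rightarrow> bool" where
  "has_dir_deriv f v d x \<equiv> ((\<lambda>t. f (x + t *\<^sub>R v)) has_vector_derivative d) (at 0)"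

text \<open>The finite stages of \<^const>\<open>smooth_on\<close>. They recurse by differentiating first, so that
  smoothness of products, compositions and inverses can be proved by induction on the order.\<close>

primrec Ck_on ::
  "nat \<Rightarrow> 'e::real_normed_vector set \<Rightarrow> 'e set \<Rightarrow> ('e \<Rightarrow> 'b::real_normed_vector) \<Rightarrow> bool" where
  "Ck_on 0 V W f \<longleftrightarrow> continuous_on W f"
| "Ck_on (Suc n) V W f \<longleftrightarrow> continuous_on W f \<and>
    (\<forall>v\<in>V. (\<forall>x\<in>W. has_dir_deriv f v (dir_deriv f v x) x) \<and> Ck_on n V W (dir_deriv f v))"

lemma dir_deriv_eq: "has_dir_deriv f v d x \<Longrightarrow> dir_deriv f v x = d"
  unfolding dir_deriv_def by (rule vector_derivative_at)

lemma iter_deriv_snoc: "iter_deriv f (vs @ [v]) = iter_deriv (dir_deriv f v) vs"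
  by (induction vs) auto

lemma smooth_on_imp_Ck_on: "smooth_on V W f \<Longrightarrow> Ck_on n V W f"
proof (induction n arbitrary: f)
  case 0
  then have "continuous_on W (iter_deriv f [])"
    unfolding smooth_on_def by (metis empty_subsetI empty_set)
  then show ?case by simp
next
  case (Suc n)
  have "continuous_on W (iter_deriv f [])"
    using Suc.prems unfolding smooth_on_def by (metis empty_subsetI empty_set)
  moreover have "has_dir_deriv f v (dir_deriv f v x) x" if "v \<in> V" "x \<in> W" for v x
  proof -
    have "(\<lambda>t. iter_deriv f [] (x + t *\<^sub>R v)) differentiable (at (0::real))"
      using Suc.prems that unfolding smooth_on_def by (metis empty_subsetI empty_set)
    then show ?thesis
      unfolding dir_deriv_def using vector_derivative_works by fastforce
  qed
  moreover have "Ck_on n V W (dir_deriv f v)" if "v \<in> V" for v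
  proof (rule Suc.IH)
    show "smooth_on V W (dir_deriv f v)"
      unfolding smooth_on_def
    proof (intro allI impI)
      fix vs assume "set vs \<subseteq> V"
      then have "set (vs @ [v]) \<subseteq> V" using that by auto
      then show "continuous_on W (iter_deriv (dir_deriv f v) vs) \<and>
          (\<forall>u\<in>V. \<forall>x\<in>W. (\<lambda>t. iter_deriv (dir_deriv f v) vs (x + t *\<^sub>R u)) differentiable at (0::real))"
        using Suc.prems unfolding smooth_on_def iter_deriv_snoc[symmetric] by blast
    qed
  qed
  ultimately show ?case by simp
qed

lemma Ck_on_iter_deriv:
  assumes "\<And>n. Ck_on n V W f" "set vs \<subseteq> V"
  shows "Ck_on n V W (iter_deriv f vs)"
  using assms(2)
proof (induction vs arbitrary: n)
  case Nil
  then show ?case using assms(1) by simp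
next
  case (Cons v vs)
  then have "Ck_on (Suc n) V W (iter_deriv f vs)" by auto
  then show ?case using Cons.prems by auto
qed

lemma smooth_on_iff_Ck_on: "smooth_on V W f \<longleftrightarrow> (\<forall>n. Ck_on n V W f)"
proof
  assume "\<forall>n. Ck_on n V W f"
  then have *: "Ck_on n V W (iter_deriv f vs)" if "set vs \<subseteq> V" for n vs
    using Ck_on_iter_deriv that by blast
  show "smooth_on V W f"
    unfolding smooth_on_def
  proof (intro allI impI conjI ballI)
    fix vs assume "set vs \<subseteq> V"
    from *[OF this, of 0] show "continuous_on W (iter_deriv f vs)" by simp
  next
    fix vs v x assume "set vs \<subseteq> V" "v \<in> V" "x \<in> W"
    with *[OF \<open>set vs \<subseteq> V\<close>, of "Suc 0"]
    have "has_dir_deriv (iter_deriv f vs) v (dir_deriv (iter_deriv f vs) v x) x" by simp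
    then show "(\<lambda>t. iter_deriv f vs (x + t *\<^sub>R v)) differentiable at 0"
      using differentiableI_vector by blast
  qed
qed (auto intro: smooth_on_imp_Ck_on)

lemma Ck_on_imp_continuous_on: "Ck_on n V W f \<Longrightarrow> continuous_on W f"
  by (cases n) auto

lemma Ck_on_SucD: "Ck_on (Suc n) V W f \<Longrightarrow> Ck_on n V W f"
  by (induction n arbitrary: f) auto

lemma smooth_on_imp_continuous_on: "smooth_on V W f \<Longrightarrow> continuous_on W f"
  using smooth_on_imp_Ck_on[of V W f 0] by simp

lemma smooth_on_has_dir_deriv:
  "\<lbrakk>smooth_on V W f; v \<in> V; x \<in> W\<rbrakk> \<Longrightarrow> has_dir_deriv f v (dir_deriv f v x) x"
  using smooth_on_imp_Ck_on[of V W f "Suc 0"] by simp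

lemma smooth_on_dir_deriv:
  "\<lbrakk>smooth_on V W f; v \<in> V\<rbrakk> \<Longrightarrow> smooth_on V W (dir_deriv f v)"
  unfolding smooth_on_iff_Ck_on by (metis Ck_on.simps(2))

lemma line_eventually_in:
  fixes V :: "'e::real_normed_vector set"
  assumes "subspace V" "openin (top_of_set V) W" "x \<in> W" "v \<in> V"
  obtains d :: real where "d > 0" "\<And>t. \<bar>t\<bar> < d \<Longrightarrow> x + t *\<^sub>R v \<in> W"
proof -
  obtain T where T: "open T" "W = V \<inter> T" using assms(2) by (metis openin_open)
  have "open ((\<lambda>t::real. x + t *\<^sub>R v) -` T)"
    by (intro open_vimage T) (intro continuous_intros)
  moreover have "0 \<in> (\<lambda>t::real. x + t *\<^sub>R v) -` T" using assms(3) T by simp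
  ultimately obtain d where d: "d > 0" "ball 0 d \<subseteq> (\<lambda>t::real. x + t *\<^sub>R v) -` T"
    using openE by blast
  show thesis
  proof
    show "x + t *\<^sub>R v \<in> W" if "\<bar>t\<bar> < d" for t
      using that d assms T by (auto simp: subset_iff subspace_add subspace_scale)
  qed (use d in auto)
qed

lemma has_dir_deriv_cong:
  fixes V :: "'e::real_normed_vector set"
  assumes "subspace V" "openin (top_of_set V) W" "x \<in> W" "v \<in> V"
    and "has_dir_deriv f v d x" "\<And>y. y \<in> W \<Longrightarrow> f y = g y"
  shows "has_dir_deriv g v d x"
proof -
  obtain r where r: "r > 0" "\<And>t. \<bar>t\<bar> < r \<Longrightarrow> x + t *\<^sub>R v \<in> W"
    using line_eventually_in[OF assms(1-4)] by blast
  show ?thesis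
    by (rule has_vector_derivative_transform_within_open[OF assms(5), of "ball 0 r"])
      (use r assms(6) in auto)
qed

lemma Ck_on_subset:
  "\<lbrakk>Ck_on n V W f; W' \<subseteq> W\<rbrakk> \<Longrightarrow> Ck_on n V W' f"
  by (induction n arbitrary: f) (auto intro: continuous_on_subset)

lemma smooth_on_subset: "\<lbrakk>smooth_on V W f; W' \<subseteq> W\<rbrakk> \<Longrightarrow> smooth_on V W' f"
  unfolding smooth_on_iff_Ck_on by (blast intro: Ck_on_subset)

lemma Ck_on_cong:
  assumes "subspace V" "openin (top_of_set V) W" "Ck_on n V W f" "\<And>x. x \<in> W \<Longrightarrow> f x = g x"
  shows "Ck_on n V W g"
  using assms(3,4)
proof (induction n arbitrary: f g)
  case 0
  then show ?case by (metis Ck_on.simps(1) continuous_on_cong)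
next
  case (Suc n)
  have 1: "has_dir_deriv g v (dir_deriv f v x) x" if "v \<in> V" "x \<in> W" for v x
    by (rule has_dir_deriv_cong[OF assms(1,2) that(2,1), of f]) (use Suc.prems that in auto)
  then have 2: "dir_deriv g v x = dir_deriv f v x" if "v \<in> V" "x \<in> W" for v x
    using dir_deriv_eq that by blast
  have "continuous_on W g" using Suc.prems by (metis Ck_on.simps(2) continuous_on_cong)
  moreover have "Ck_on n V W (dir_deriv g v)" if "v \<in> V" for v
    using Suc.IH[of "dir_deriv f v" "dir_deriv g v"] Suc.prems that 2 by simp
  ultimately show ?case using 1 2 by auto
qed

lemma smooth_on_cong:
  assumes "subspace V" "openin (top_of_set V) W" "smooth_on V W f" "\<And>x. x \<in> W \<Longrightarrow> f x = g x"
  shows "smooth_on V W g"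
  using assms Ck_on_cong unfolding smooth_on_iff_Ck_on by blast

text \<open>The derivatives may be supplied as any function that is correct on \<open>W\<close>, so that they can be computed by
  rules instead of from the definition of \<^const>\<open>dir_deriv\<close>.\<close>

lemma Ck_on_SucI:
  assumes "subspace V" "openin (top_of_set V) W" "continuous_on W f"
    and "\<And>v x. \<lbrakk>v \<in> V; x \<in> W\<rbrakk> \<Longrightarrow> has_dir_deriv f v (f' v x) x"
    and "\<And>v. v \<in> V \<Longrightarrow> Ck_on n V W (f' v)"
  shows "Ck_on (Suc n) V W f"
proof -
  have eq: "dir_deriv f v x = f' v x" if "v \<in> V" "x \<in> W" for v x
    using assms(4)[OF that] dir_deriv_eq by blast
  have "Ck_on n V W (dir_deriv f v)" if "v \<in> V" for v
    by (rule Ck_on_cong[OF assms(1,2) assms(5)[OF that]]) (use eq that in simp)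
  then show ?thesis using assms(3,4) eq by simp
qed

lemma smooth_on_local:
  assumes "\<And>x. x \<in> W \<Longrightarrow> \<exists>T. x \<in> T \<and> openin (top_of_set W) T \<and> smooth_on V T f"
  shows "smooth_on V W f"
proof -
  have "Ck_on n V W f" for n
    using assms unfolding smooth_on_iff_Ck_on
  proof (induction n arbitrary: f)
    case 0
    have "continuous (at x within W) f" if "x \<in> W" for x
    proof -
      from 0[OF that] obtain T
        where T: "x \<in> T" "openin (top_of_set W) T" "\<forall>n. Ck_on n V T f" by blast
      then have "continuous_on T f" using Ck_on_imp_continuous_on by blast
      then have "continuous (at x within T) f" using T(1) continuous_on_eq_continuous_within by blast
      moreover have "at x within T = at x within W"
      proof -
        obtain S where "open S" "T = W \<inter> S" using T(2) by (metis openin_open)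
        then show ?thesis using T(1) at_within_nhd[of x S T W] by blast
      qed
      ultimately show ?thesis by simp
    qed
    then show ?case by (simp add: continuous_on_eq_continuous_within)
  next
    case (Suc n)
    have "Ck_on n V W f" by (rule Suc.IH[OF Suc.prems])
    then have "continuous_on W f" by (rule Ck_on_imp_continuous_on)
    moreover have "has_dir_deriv f v (dir_deriv f v x) x" if "v \<in> V" "x \<in> W" for v x
    proof -
      from Suc.prems[OF \<open>x \<in> W\<close>] obtain T where T: "x \<in> T" "\<forall>n. Ck_on n V T f" by blast
      from T(2)[rule_format, of "Suc 0"] T(1) that show ?thesis by simp
    qed
    moreover have "Ck_on n V W (dir_deriv f v)" if "v \<in> V" for v
    proof (rule Suc.IH)
      fix x assume "x \<in> W"
      from Suc.prems[OF this] obtain T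
        where T: "x \<in> T" "openin (top_of_set W) T" "\<forall>n. Ck_on n V T f" by blast
      have "Ck_on n V T (dir_deriv f v)" for n
        using T(3)[rule_format, of "Suc n"] that by simp
      then show "\<exists>T. x \<in> T \<and> openin (top_of_set W) T \<and> (\<forall>n. Ck_on n V T (dir_deriv f v))"
        using T by blast
    qed
    ultimately show ?case by simp
  qed
  then show ?thesis by (simp add: smooth_on_iff_Ck_on)
qed

lemma Ck_on_const: "Ck_on n (V :: 'e::real_normed_vector set) W (\<lambda>x. c)"
proof (induction n arbitrary: c)
  case (Suc n)
  have "dir_deriv (\<lambda>x. c) v = (\<lambda>x. 0)" for v :: 'e
    by (auto simp: dir_deriv_def fun_eq_iff)
  then show ?case using Suc by simp
qed simp

lemma Ck_on_ident:
  assumes "subspace V" "openin (top_of_set V) W"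
  shows "Ck_on n V W (\<lambda>x. x)"
proof (cases n)
  case (Suc m)
  have "has_dir_deriv (\<lambda>x. x) v v x" for v x :: 'a
    by (auto intro!: derivative_eq_intros simp: has_vector_derivative_def)
  then show ?thesis unfolding Suc
    by (intro Ck_on_SucI[OF assms, where f' = "\<lambda>v x. v"] Ck_on_const continuous_on_id)
qed simp

lemma Ck_on_add:
  assumes "subspace V" "openin (top_of_set V) W" "Ck_on n V W f" "Ck_on n V W g"
  shows "Ck_on n V W (\<lambda>x. f x + g x)"
  using assms(3,4)
proof (induction n arbitrary: f g)
  case 0
  then show ?case by (auto intro: continuous_on_add)
next
  case (Suc n)
  show ?case
    by (rule Ck_on_SucI[OF assms(1,2), where f' = "\<lambda>v x. dir_deriv f v x + dir_deriv g v x"])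
      (use Suc in \<open>auto intro!: continuous_on_add has_vector_derivative_add\<close>)
qed

lemma Ck_on_sum:
  assumes "subspace V" "openin (top_of_set V) W" "\<And>i. i \<in> I \<Longrightarrow> Ck_on n V W (f i)"
  shows "Ck_on n V W (\<lambda>x. \<Sum>i\<in>I. f i x)"
proof (cases "finite I")
  case True
  then show ?thesis using assms(3)
    by (induction I) (auto intro!: Ck_on_const Ck_on_add[OF assms(1,2)])
qed (simp add: Ck_on_const)

lemma (in bounded_bilinear) Ck_on:
  assumes "subspace V" "openin (top_of_set V) W" "Ck_on n V W f" "Ck_on n V W g"
  shows "Ck_on n V W (\<lambda>x. prod (f x) (g x))"
  using assms(3,4)
proof (induction n arbitrary: f g)
  case 0
  then show ?case by (auto intro: continuous_on)
next
  case (Suc n)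
  show ?case
  proof (rule Ck_on_SucI[OF assms(1,2),
        where f' = "\<lambda>v x. prod (f x) (dir_deriv g v x) + prod (dir_deriv f v x) (g x)"])
    show "continuous_on W (\<lambda>x. prod (f x) (g x))"
      using Suc.prems by (auto intro: continuous_on)
    show "has_dir_deriv (\<lambda>x. prod (f x) (g x)) v
        (prod (f x) (dir_deriv g v x) + prod (dir_deriv f v x) (g x)) x"
      if "v \<in> V" "x \<in> W" for v x
      using has_vector_derivative[of "\<lambda>t. f (x + t *\<^sub>R v)" "dir_deriv f v x" 0 UNIV
          "\<lambda>t. g (x + t *\<^sub>R v)" "dir_deriv g v x"] Suc.prems that by auto
    show "Ck_on n V W (\<lambda>x. prod (f x) (dir_deriv g v x) + prod (dir_deriv f v x) (g x))"
      if "v \<in> V" for v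
      using Suc that Ck_on_SucD[OF Suc.prems(1)] Ck_on_SucD[OF Suc.prems(2)]
      by (intro Ck_on_add[OF assms(1,2)]) auto
  qed
qed

lemmas Ck_on_scaleR = bounded_bilinear.Ck_on[OF bounded_bilinear_scaleR]
  and Ck_on_mult = bounded_bilinear.Ck_on[OF bounded_bilinear_mult]
  and Ck_on_inner = bounded_bilinear.Ck_on[OF bounded_bilinear_inner]

lemma Ck_on_inverse:
  fixes f :: "'a::real_normed_vector \<Rightarrow> real"
  assumes "subspace V" "openin (top_of_set V) W" "Ck_on n V W f" "\<And>x. x \<in> W \<Longrightarrow> f x \<noteq> 0"
  shows "Ck_on n V W (\<lambda>x. inverse (f x))"
  using assms(3)
proof (induction n)
  case 0
  then show ?case using assms(4) by (auto intro!: continuous_on_inverse)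
next
  case (Suc n)
  have IH: "Ck_on n V W (\<lambda>x. inverse (f x))" using Suc Ck_on_SucD by blast
  show ?case
  proof (rule Ck_on_SucI[OF assms(1,2),
        where f' = "\<lambda>v x. (- 1) * (dir_deriv f v x * (inverse (f x) * inverse (f x)))"])
    show "continuous_on W (\<lambda>x. inverse (f x))"
      using Suc.prems assms(4) by (auto intro!: continuous_on_inverse)
    show "has_dir_deriv (\<lambda>x. inverse (f x)) v
        ((- 1) * (dir_deriv f v x * (inverse (f x) * inverse (f x)))) x"
      if "v \<in> V" "x \<in> W" for v x
    proof -
      have "((\<lambda>t. f (x + t *\<^sub>R v)) has_field_derivative dir_deriv f v x) (at 0)"
        using Suc.prems that has_real_derivative_iff_has_vector_derivative by auto
      from DERIV_inverse'[OF this] assms(4) that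
      show ?thesis by (simp add: has_real_derivative_iff_has_vector_derivative mult_ac)
    qed
    show "Ck_on n V W (\<lambda>x. (- 1) * (dir_deriv f v x * (inverse (f x) * inverse (f x))))"
      if "v \<in> V" for v
      using Suc.prems that by (intro Ck_on_mult[OF assms(1,2)] IH Ck_on_const) auto
  qed
qed

lemma has_dir_deriv_shift:
  assumes "has_dir_deriv f v d (x + a *\<^sub>R v)"
  shows "((\<lambda>t. f (x + t *\<^sub>R v)) has_vector_derivative d) (at a)"
proof -
  have "((\<lambda>t. t - a) has_vector_derivative 1) (at a)"
    by (auto intro!: derivative_eq_intros)
  moreover have "((\<lambda>t. f (x + a *\<^sub>R v + t *\<^sub>R v)) has_vector_derivative d) (at (a - a))"
    using assms by simp
  ultimately have "((\<lambda>t. f (x + a *\<^sub>R v + t *\<^sub>R v)) \<circ> (\<lambda>t. t - a) has_vector_derivative 1 *\<^sub>R d) (at a)"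
    by (rule vector_diff_chain_at)
  then show ?thesis by (simp add: o_def algebra_simps)
qed

text \<open>The mean value inequality for \<open>f - d\<close> along the segment from \<open>x\<close> to \<open>x + c v\<close>. It yields both total
  differentiability and the uniform first-order estimate for shears.\<close>

lemma segment_linearization_bound:
  assumes "\<And>\<tau>. \<lbrakk>0 \<le> \<tau>; \<tau> \<le> 1\<rbrakk> \<Longrightarrow> has_dir_deriv f v (f' \<tau>) (x + \<tau> *\<^sub>R c *\<^sub>R v)"
    and "\<And>\<tau>. \<lbrakk>0 \<le> \<tau>; \<tau> \<le> 1\<rbrakk> \<Longrightarrow> norm (f' \<tau> - d) \<le> e"
  shows "norm (f (x + c *\<^sub>R v) - f x - c *\<^sub>R d) \<le> \<bar>c\<bar> * e"
proof -
  define g where "g \<tau> = f (x + \<tau> *\<^sub>R c *\<^sub>R v) - \<tau> *\<^sub>R c *\<^sub>R d" for \<tau>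
  have "(g has_derivative (\<lambda>s. s *\<^sub>R (c *\<^sub>R (f' \<tau> - d)))) (at \<tau> within {0..1})"
    if "\<tau> \<in> {0..1}" for \<tau>
  proof -
    have "((\<lambda>t. f (x + t *\<^sub>R v)) has_vector_derivative f' \<tau>) (at (\<tau> * c))"
      by (rule has_dir_deriv_shift) (use assms(1)[of \<tau>] that in simp)
    moreover have "((\<lambda>t. t * c) has_vector_derivative c) (at \<tau>)"
      by (auto intro!: derivative_eq_intros)
    ultimately have "((\<lambda>t. f (x + t *\<^sub>R v)) \<circ> (\<lambda>t. t * c) has_vector_derivative c *\<^sub>R f' \<tau>) (at \<tau>)"
      using vector_diff_chain_at by blast
    then have "((\<lambda>t. f (x + t *\<^sub>R c *\<^sub>R v)) has_vector_derivative c *\<^sub>R f' \<tau>) (at \<tau>)"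
      by (simp add: o_def)
    then have "(g has_vector_derivative (c *\<^sub>R f' \<tau> - c *\<^sub>R d)) (at \<tau>)"
      unfolding g_def
      by (intro has_vector_derivative_diff)
        (auto intro!: derivative_eq_intros simp: has_vector_derivative_def)
    then show ?thesis
      by (auto simp: has_vector_derivative_def scaleR_diff_right intro: has_derivative_at_withinI)
  qed
  moreover have "onorm (\<lambda>s. s *\<^sub>R (c *\<^sub>R (f' \<tau> - d))) \<le> \<bar>c\<bar> * e" if "\<tau> \<in> {0..1}" for \<tau>
  proof (rule onorm_le)
    have le: "norm (f' \<tau> - d) \<le> e" using assms(2) that by simp
    show "norm (s *\<^sub>R (c *\<^sub>R (f' \<tau> - d))) \<le> \<bar>c\<bar> * e * norm s" for s
      using mult_left_mono[OF le, of "\<bar>s\<bar> * \<bar>c\<bar>"] by (simp add: mult_ac abs_mult)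
  qed
  ultimately have "norm (g 1 - g 0) \<le> \<bar>c\<bar> * e * norm (1 - 0 :: real)"
    by (intro differentiable_bound[where S = "{0..1}"]) auto
  then show ?thesis by (simp add: g_def algebra_simps)
qed

text \<open>Continuous partial derivatives imply differentiability: the increment \<open>y - x\<close> is split along an
  orthonormal basis of \<open>V\<close> and each step is compared with the partial derivative at \<open>x\<close>.\<close>

lemma C1_total_derivative:
  fixes f :: "'e::euclidean_space \<Rightarrow> 'b::real_normed_vector"
  assumes V: "subspace V" and W: "openin (top_of_set V) W" and C1: "Ck_on (Suc 0) V W f"
    and x: "x \<in> W" and B: "finite B" "B \<subseteq> V" "pairwise orthogonal B"
      "\<And>b. b \<in> B \<Longrightarrow> norm b = 1" "span B = V"
  shows "(f has_derivative (\<lambda>w. \<Sum>b\<in>B. (w \<bullet> b) *\<^sub>R dir_deriv f b x)) (at x within V)"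
  unfolding has_derivative_within_alt
proof (intro conjI allI impI)
  show "bounded_linear (\<lambda>w. \<Sum>b\<in>B. (w \<bullet> b) *\<^sub>R dir_deriv f b x)"
    by (intro bounded_linear_sum bounded_linear_scaleR_const bounded_linear_inner_left)
next
  fix e :: real assume "e > 0"
  define e' where "e' = e / (real (card B) + 1)"
  have e': "e' > 0" using \<open>e > 0\<close> by (simp add: e'_def)
  obtain r where r: "r > 0" "\<And>y. \<lbrakk>y \<in> V; dist y x < r\<rbrakk> \<Longrightarrow> y \<in> W"
  proof -
    obtain T where "open T" "W = V \<inter> T" using W by (metis openin_open)
    then show thesis using x that by (auto simp: open_dist)
  qed
  have "\<forall>b\<in>B. \<exists>d>0. \<forall>y\<in>W. dist y x < d \<longrightarrow> norm (dir_deriv f b y - dir_deriv f b x) < e'"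
  proof
    fix b assume "b \<in> B"
    then have "continuous_on W (dir_deriv f b)" using C1 B by auto
    then show "\<exists>d>0. \<forall>y\<in>W. dist y x < d \<longrightarrow> norm (dir_deriv f b y - dir_deriv f b x) < e'"
      using x e' unfolding continuous_on_iff dist_norm by blast
  qed
  then obtain d where d: "\<And>b. b \<in> B \<Longrightarrow> d b > 0"
    "\<And>b y. \<lbrakk>b \<in> B; y \<in> W; dist y x < d b\<rbrakk> \<Longrightarrow> norm (dir_deriv f b y - dir_deriv f b x) < e'"
    by metis
  define D where "D = Min (insert r (d ` B))"
  have D: "D > 0" "D \<le> r" "\<And>b. b \<in> B \<Longrightarrow> D \<le> d b"
    using B(1) d(1) r(1) by (auto simp: D_def)
  define \<delta> where "\<delta> = D / (real (card B) + 1)"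
  have \<delta>: "\<delta> > 0" using D(1) by (simp add: \<delta>_def)
  have main: "norm (f y - f x - (\<Sum>b\<in>B. ((y - x) \<bullet> b) *\<^sub>R dir_deriv f b x)) \<le> e * norm (y - x)"
    if y: "y \<in> V" "norm (y - x) < \<delta>" for y
  proof -
    define c where "c b = (y - x) \<bullet> b" for b
    have xV: "x \<in> V" using W x openin_imp_subset by blast
    have cb: "\<bar>c b\<bar> \<le> norm (y - x)" if "b \<in> B" for b
      using Cauchy_Schwarz_ineq2[of "y - x" b] B(4)[OF that] by (simp add: c_def)
    have expand: "x + (\<Sum>b\<in>B. c b *\<^sub>R b) = y"
    proof -
      have "(\<Sum>b\<in>B. c b *\<^sub>R b) = y - x"
      proof (rule vector_eq_dot_span)
        show "(\<Sum>b\<in>B. c b *\<^sub>R b) \<in> span B" by (intro span_sum span_scale span_base)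
        show "y - x \<in> span B" using y xV V B(5) by (simp add: subspace_diff)
        fix u assume u: "u \<in> B"
        have "u \<bullet> (\<Sum>b\<in>B. c b *\<^sub>R b) = (\<Sum>b\<in>B. if b = u then c u else 0)"
          unfolding inner_sum_right
        proof (rule sum.cong)
          fix b assume "b \<in> B"
          have "u \<bullet> u = 1" using B(4)[OF u] by (simp add: dot_square_norm)
          moreover have "b \<noteq> u \<Longrightarrow> u \<bullet> b = 0"
            using B(3) \<open>b \<in> B\<close> u by (auto simp: pairwise_def orthogonal_def)
          ultimately show "u \<bullet> (c b *\<^sub>R b) = (if b = u then c u else 0)" by auto
        qed simp
        also have "\<dots> = u \<bullet> (y - x)" using u B(1) by (simp add: c_def inner_commute)
        finally show "u \<bullet> (\<Sum>b\<in>B. c b *\<^sub>R b) = u \<bullet> (y - x)" .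
      qed
      then show ?thesis by simp
    qed
    \<comment> \<open>All corners and edges of the path from \<open>x\<close> to \<open>y\<close> along the basis vectors stay close to \<open>x\<close>.\<close>
    have near: "z \<in> W \<and> (\<forall>b\<in>B. norm (dir_deriv f b z - dir_deriv f b x) \<le> e')"
      if "A \<subseteq> B" "z = x + (\<Sum>b\<in>A. k b *\<^sub>R b)" "\<And>b. b \<in> A \<Longrightarrow> \<bar>k b\<bar> \<le> \<bar>c b\<bar>" for A z k
    proof -
      have "norm (\<Sum>b\<in>A. k b *\<^sub>R b) \<le> (\<Sum>b\<in>A. \<delta>)"
      proof (rule sum_norm_le)
        fix b assume "b \<in> A"
        then have "\<bar>k b\<bar> \<le> \<delta>" "norm b = 1" using that(1,3) cb y(2) B(4)
          by (meson less_imp_le order_trans subsetD)+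
        then show "norm (k b *\<^sub>R b) \<le> \<delta>" by simp
      qed
      also have "\<dots> \<le> real (card B) * \<delta>"
        using card_mono[OF B(1) that(1)] \<delta> by simp
      also have "\<dots> < D" using D(1) by (simp add: \<delta>_def field_simps)
      finally have "dist z x < D" by (simp add: that(2) dist_norm)
      moreover have "z \<in> V"
        unfolding that(2) using V xV B(2) that(1)
        by (intro subspace_add subspace_sum subspace_scale) auto
      ultimately have "z \<in> W" using r D by fastforce
      then show ?thesis using d(2) \<open>dist z x < D\<close> D(3) by (meson less_imp_le order_less_le_trans)
    qed
    have "norm (f (x + (\<Sum>b\<in>A. c b *\<^sub>R b)) - f x - (\<Sum>b\<in>A. c b *\<^sub>R dir_deriv f b x))
        \<le> (\<Sum>b\<in>A. \<bar>c b\<bar> * e')" if "A \<subseteq> B" for A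
      using finite_subset[OF that B(1)] that
    proof (induction A rule: finite_induct)
      case empty
      then show ?case by simp
    next
      case (insert a A)
      define z where "z = x + (\<Sum>b\<in>A. c b *\<^sub>R b)"
      have step: "z + \<tau> *\<^sub>R c a *\<^sub>R a \<in> W \<and>
          norm (dir_deriv f a (z + \<tau> *\<^sub>R c a *\<^sub>R a) - dir_deriv f a x) \<le> e'"
        if "0 \<le> \<tau>" "\<tau> \<le> 1" for \<tau>
      proof -
        define k where "k b = (if b = a then \<tau> * c a else c b)" for b
        have "(\<Sum>b\<in>insert a A. k b *\<^sub>R b) = \<tau> *\<^sub>R c a *\<^sub>R a + (\<Sum>b\<in>A. k b *\<^sub>R b)"
          using insert.hyps by (simp add: k_def)
        also have "(\<Sum>b\<in>A. k b *\<^sub>R b) = (\<Sum>b\<in>A. c b *\<^sub>R b)"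
          using insert.hyps(2) by (intro sum.cong) (auto simp: k_def)
        finally have "z + \<tau> *\<^sub>R c a *\<^sub>R a = x + (\<Sum>b\<in>insert a A. k b *\<^sub>R b)"
          by (simp add: z_def)
        moreover have "\<bar>k b\<bar> \<le> \<bar>c b\<bar>" for b
          using that by (auto simp: k_def abs_mult mult_left_le_one_le)
        ultimately show ?thesis using near[OF insert.prems] insert.prems by blast
      qed
      have "norm (f (z + c a *\<^sub>R a) - f z - c a *\<^sub>R dir_deriv f a x) \<le> \<bar>c a\<bar> * e'"
      proof (rule segment_linearization_bound)
        fix \<tau> :: real assume \<tau>: "0 \<le> \<tau>" "\<tau> \<le> 1"
        show "has_dir_deriv f a (dir_deriv f a (z + \<tau> *\<^sub>R c a *\<^sub>R a)) (z + \<tau> *\<^sub>R c a *\<^sub>R a)"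
          using C1 step[OF \<tau>] insert.prems B(2) by auto
        show "norm (dir_deriv f a (z + \<tau> *\<^sub>R c a *\<^sub>R a) - dir_deriv f a x) \<le> e'"
          using step[OF \<tau>] by blast
      qed
      moreover have "norm (f z - f x - (\<Sum>b\<in>A. c b *\<^sub>R dir_deriv f b x)) \<le> (\<Sum>b\<in>A. \<bar>c b\<bar> * e')"
        unfolding z_def using insert.IH insert.prems by simp
      ultimately have "norm ((f (z + c a *\<^sub>R a) - f z - c a *\<^sub>R dir_deriv f a x) +
          (f z - f x - (\<Sum>b\<in>A. c b *\<^sub>R dir_deriv f b x))) \<le> \<bar>c a\<bar> * e' + (\<Sum>b\<in>A. \<bar>c b\<bar> * e')"
        by (rule norm_triangle_mono)
      then show ?case using insert.hyps by (simp add: z_def algebra_simps)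
    qed
    from this[OF subset_refl]
    have "norm (f y - f x - (\<Sum>b\<in>B. c b *\<^sub>R dir_deriv f b x)) \<le> (\<Sum>b\<in>B. \<bar>c b\<bar> * e')"
      by (simp add: expand)
    also have "\<dots> \<le> (\<Sum>b\<in>B. norm (y - x) * e')"
      using cb e' by (intro sum_mono mult_right_mono) auto
    also have "\<dots> = norm (y - x) * (real (card B) * e')" by simp
    also have "\<dots> \<le> norm (y - x) * e"
      using \<open>e > 0\<close> by (intro mult_left_mono) (auto simp: e'_def field_simps)
    finally show ?thesis by (simp add: c_def mult.commute)
  qed
  then show "\<exists>d>0. \<forall>y\<in>V. norm (y - x) < d \<longrightarrow>
      norm (f y - f x - (\<Sum>b\<in>B. ((y - x) \<bullet> b) *\<^sub>R dir_deriv f b x)) \<le> e * norm (y - x)"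
    using \<delta> by blast
qed

lemma has_vector_derivative_iff_Lim:
  "(f has_vector_derivative d) (at a within S) \<longleftrightarrow>
    ((\<lambda>t. (f t - f a) /\<^sub>R (t - a)) \<longlongrightarrow> d) (at a within S)"
proof -
  have "norm ((f t - f a) /\<^sub>R (t - a) - d) = norm ((1 / norm (t - a)) *\<^sub>R (f t - (f a + (t - a) *\<^sub>R d)))"
    if "t \<noteq> a" for t
  proof -
    have "(f t - f a) /\<^sub>R (t - a) - d = inverse (t - a) *\<^sub>R (f t - (f a + (t - a) *\<^sub>R d))"
      using that by (simp add: scaleR_diff_right scaleR_add_right)
    then show ?thesis by (simp add: divide_inverse)
  qed
  then have "((\<lambda>t. norm ((f t - f a) /\<^sub>R (t - a) - d)) \<longlongrightarrow> 0) (at a within S) \<longleftrightarrow>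
      ((\<lambda>t. norm ((1 / norm (t - a)) *\<^sub>R (f t - (f a + (t - a) *\<^sub>R d)))) \<longlongrightarrow> 0) (at a within S)"
    by (intro tendsto_cong) (auto simp: eventually_at_filter)
  then show ?thesis
    unfolding has_vector_derivative_def has_derivative_within
    by (simp only: tendsto_norm_zero_iff LIM_zero_iff bounded_linear_scaleR_left simp_thms)
qed

text \<open>A limit of difference quotients in a closed set.\<close>

lemma dir_deriv_in_subspace:
  fixes g :: "'d::real_normed_vector \<Rightarrow> 'e::euclidean_space"
  assumes U: "subspace U" "openin (top_of_set U) X" "x \<in> X" "u \<in> U"
    and "has_dir_deriv g u d x" "g ` X \<subseteq> V" "subspace V"
  shows "d \<in> V"
proof -
  obtain r where r: "r > 0" "\<And>t. \<bar>t\<bar> < r \<Longrightarrow> x + t *\<^sub>R u \<in> X"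
    using line_eventually_in[OF U] by blast
  have "((\<lambda>t. (g (x + t *\<^sub>R u) - g x) /\<^sub>R t) \<longlongrightarrow> d) (at 0)"
    using assms(5) by (simp add: has_vector_derivative_iff_Lim)
  moreover have "eventually (\<lambda>t. (g (x + t *\<^sub>R u) - g x) /\<^sub>R t \<in> V) (at 0)"
  proof -
    have "eventually (\<lambda>t::real. dist t 0 < r) (at 0)" using r(1) eventually_at by blast
    then show ?thesis
      by eventually_elim (use r assms in \<open>auto intro!: subspace_scale subspace_diff\<close>)
  qed
  ultimately show ?thesis
    by (intro Lim_in_closed_set[OF closed_subspace[OF assms(7)]]) auto
qed

lemma orthonormal_basis_exists:
  fixes V :: "'e::euclidean_space set"
  assumes "subspace V"
  obtains B where "finite B" "B \<subseteq> V" "pairwise orthogonal B" "\<And>b. b \<in> B \<Longrightarrow> norm b = 1" "span B = V"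
  using orthonormal_basis_subspace[OF assms] by (metis independent_imp_finite)

lemma dir_deriv_curve:
  fixes f :: "'e::euclidean_space \<Rightarrow> 'b::real_normed_vector"
  assumes V: "subspace V" "openin (top_of_set V) W" and f: "Ck_on (Suc 0) V W f"
    and U: "subspace U" "openin (top_of_set U) X" "x \<in> X" "u \<in> U"
    and g: "has_dir_deriv g u w x" "g ` X \<subseteq> W"
    and B: "finite B" "B \<subseteq> V" "pairwise orthogonal B" "\<And>b. b \<in> B \<Longrightarrow> norm b = 1" "span B = V"
  shows "has_dir_deriv (\<lambda>y. f (g y)) u (\<Sum>b\<in>B. (w \<bullet> b) *\<^sub>R dir_deriv f b (g x)) x"
proof -
  obtain r where r: "r > 0" "\<And>t. \<bar>t\<bar> < r \<Longrightarrow> x + t *\<^sub>R u \<in> X"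
    using line_eventually_in[OF U] by blast
  define p where "p t = g (x + t *\<^sub>R u)" for t
  have "W \<subseteq> V" using V openin_imp_subset by blast
  have "(p has_vector_derivative w) (at 0 within ball 0 r)"
    using g(1) unfolding p_def by (rule has_vector_derivative_at_within)
  moreover have "(f has_derivative (\<lambda>w. \<Sum>b\<in>B. (w \<bullet> b) *\<^sub>R dir_deriv f b (p 0))) (at (p 0) within p ` ball 0 r)"
    by (rule has_derivative_subset[OF C1_total_derivative[OF V f _ B]])
      (use g(2) r U \<open>W \<subseteq> V\<close> in \<open>auto simp: p_def image_subset_iff subset_iff\<close>)
  ultimately have "(f \<circ> p has_vector_derivative (\<Sum>b\<in>B. (w \<bullet> b) *\<^sub>R dir_deriv f b (p 0))) (at 0 within ball 0 r)"
    by (rule vector_derivative_diff_chain_within)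
  then show ?thesis using r(1) by (simp add: o_def p_def at_within_open[of 0 "ball 0 r"])
qed

lemma dir_deriv_expansion:
  fixes f :: "'e::euclidean_space \<Rightarrow> 'b::real_normed_vector"
  assumes V: "subspace V" "openin (top_of_set V) W" and f: "smooth_on V W f"
    and B: "finite B" "B \<subseteq> V" "pairwise orthogonal B" "\<And>b. b \<in> B \<Longrightarrow> norm b = 1" "span B = V"
    and "x \<in> W" "v \<in> V"
  shows "dir_deriv f v x = (\<Sum>b\<in>B. (v \<bullet> b) *\<^sub>R dir_deriv f b x)"
proof -
  have "has_dir_deriv (\<lambda>x. x) v v x"
    by (auto intro!: derivative_eq_intros simp: has_vector_derivative_def)
  from dir_deriv_curve[OF V smooth_on_imp_Ck_on[OF f] V \<open>x \<in> W\<close> \<open>v \<in> V\<close> this _ B]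
  show ?thesis by (intro dir_deriv_eq) auto
qed

text \<open>The chain rule. That \<open>w\<close> lies in \<open>V\<close> is part of it, because \<^const>\<open>smooth_on\<close> says nothing about
  derivatives in other directions.\<close>

lemma dir_deriv_compose:
  fixes f :: "'e::euclidean_space \<Rightarrow> 'b::real_normed_vector"
  assumes V: "subspace V" "openin (top_of_set V) W" and f: "smooth_on V W f"
    and U: "subspace U" "openin (top_of_set U) X" "x \<in> X" "u \<in> U"
    and g: "has_dir_deriv g u w x" "g ` X \<subseteq> W"
  shows "w \<in> V" "has_dir_deriv (\<lambda>y. f (g y)) u (dir_deriv f w (g x)) x"
proof -
  obtain B where B: "finite B" "B \<subseteq> V" "pairwise orthogonal B" "\<And>b. b \<in> B \<Longrightarrow> norm b = 1" "span B = V"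
    using orthonormal_basis_exists[OF V(1)] by metis
  show "w \<in> V"
    by (rule dir_deriv_in_subspace[OF U g(1) _ V(1)]) (use g(2) V openin_imp_subset in blast)
  with dir_deriv_expansion[OF V f B _ this] dir_deriv_curve[OF V smooth_on_imp_Ck_on[OF f] U g B]
  show "has_dir_deriv (\<lambda>y. f (g y)) u (dir_deriv f w (g x)) x"
    using U(3) g(2) by (metis image_subset_iff)
qed

lemma Ck_on_compose:
  fixes f :: "'e::euclidean_space \<Rightarrow> 'b::real_normed_vector"
    and g :: "'d::real_normed_vector \<Rightarrow> 'e"
  assumes V: "subspace V" "openin (top_of_set V) W" and U: "subspace U" "openin (top_of_set U) X"
    and "Ck_on n V W f" "Ck_on n U X g" "g ` X \<subseteq> W"
  shows "Ck_on n U X (\<lambda>x. f (g x))"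
  using assms(5,6)
proof (induction n arbitrary: f)
  case 0
  then show ?case using assms(7) by (auto intro: continuous_on_compose2)
next
  case (Suc n)
  obtain B where B: "finite B" "B \<subseteq> V" "pairwise orthogonal B" "\<And>b. b \<in> B \<Longrightarrow> norm b = 1" "span B = V"
    using orthonormal_basis_exists[OF V(1)] by metis
  have "Ck_on (Suc 0) V W f" using Suc.prems(1) by (auto intro: Ck_on_imp_continuous_on)
  note chain = dir_deriv_curve[OF V this U]
  show ?case
  proof (rule Ck_on_SucI[OF U,
        where f' = "\<lambda>u x. \<Sum>b\<in>B. (dir_deriv g u x \<bullet> b) *\<^sub>R dir_deriv f b (g x)"])
    show "continuous_on X (\<lambda>x. f (g x))"
      using Suc.prems assms(7) by (auto intro: continuous_on_compose2)
    show "has_dir_deriv (\<lambda>x. f (g x)) u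
        (\<Sum>b\<in>B. (dir_deriv g u x \<bullet> b) *\<^sub>R dir_deriv f b (g x)) x" if "u \<in> U" "x \<in> X" for u x
      using that Suc.prems assms(7) B by (intro chain) auto
    show "Ck_on n U X (\<lambda>x. \<Sum>b\<in>B. (dir_deriv g u x \<bullet> b) *\<^sub>R dir_deriv f b (g x))" if "u \<in> U" for u
      using that Suc.prems B(2) Ck_on_SucD[OF Suc.prems(2)]
      by (intro Ck_on_sum[OF U] Ck_on_scaleR[OF U] Ck_on_inner[OF U] Ck_on_const Suc.IH) auto
  qed
qed

lemma smooth_on_compose:
  fixes f :: "'e::euclidean_space \<Rightarrow> 'b::real_normed_vector"
    and g :: "'d::real_normed_vector \<Rightarrow> 'e"
  assumes "subspace V" "openin (top_of_set V) W" "subspace U" "openin (top_of_set U) X"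
    and "smooth_on V W f" "smooth_on U X g" "g ` X \<subseteq> W"
  shows "smooth_on U X (\<lambda>x. f (g x))"
  using Ck_on_compose[OF assms(1-4) _ _ assms(7)] assms(5,6) by (auto simp: smooth_on_iff_Ck_on)

lemma smooth_on_const: "smooth_on (V :: 'e::real_normed_vector set) W (\<lambda>x. d)"
  by (simp add: smooth_on_iff_Ck_on Ck_on_const)

lemma smooth_on_add:
  assumes "subspace V" "openin (top_of_set V) W" "smooth_on V W f" "smooth_on V W g"
  shows "smooth_on V W (\<lambda>x. f x + g x)"
  using assms(3,4) by (simp add: smooth_on_iff_Ck_on Ck_on_add[OF assms(1,2)])

lemma smooth_on_scaleR:
  assumes "subspace V" "openin (top_of_set V) W" "smooth_on V W f" "smooth_on V W g"
  shows "smooth_on V W (\<lambda>x. f x *\<^sub>R g x)"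
  using assms(3,4) by (simp add: smooth_on_iff_Ck_on Ck_on_scaleR[OF assms(1,2)])

lemma smooth_on_inverse:
  fixes f :: "'a::real_normed_vector \<Rightarrow> real"
  assumes "subspace V" "openin (top_of_set V) W" "smooth_on V W f" "\<And>x. x \<in> W \<Longrightarrow> f x \<noteq> 0"
  shows "smooth_on V W (\<lambda>x. inverse (f x))"
  using assms(3) by (simp add: smooth_on_iff_Ck_on Ck_on_inverse[OF assms(1,2) _ assms(4)])

lemma dir_deriv_bounded_linear:
  fixes f :: "'e::euclidean_space \<Rightarrow> 'b::real_normed_vector"
  assumes "subspace V" "openin (top_of_set V) W" "smooth_on V W f" "x \<in> W"
  obtains L where "bounded_linear L" "\<And>v. v \<in> V \<Longrightarrow> dir_deriv f v x = L v"
proof -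
  obtain B where B: "finite B" "B \<subseteq> V" "pairwise orthogonal B" "\<And>b. b \<in> B \<Longrightarrow> norm b = 1" "span B = V"
    using orthonormal_basis_exists[OF assms(1)] by metis
  show thesis
  proof
    show "bounded_linear (\<lambda>w. \<Sum>b\<in>B. (w \<bullet> b) *\<^sub>R dir_deriv f b x)"
      by (intro bounded_linear_sum bounded_linear_scaleR_const bounded_linear_inner_left)
  qed (rule dir_deriv_expansion[OF assms(1-3) B assms(4)])
qed

section \<open>A smooth bump\<close>

text \<open>The family \<open>p(1/x) exp(-1/x)\<close>, extended by \<open>0\<close>, is closed under differentiation. This makes every member
  smooth by one induction, with no separate treatment of the derivatives at \<open>0\<close>.\<close>

definition exp_flat :: "real poly \<Rightarrow> real \<Rightarrow> real" where
  "exp_flat p x = (if x > 0 then poly p (1 / x) * exp (- (1 / x)) else 0)"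

lemma poly_times_exp_minus_tendsto_0:
  "((\<lambda>y::real. poly p y * exp (- y)) \<longlongrightarrow> 0) at_top"
proof -
  have "poly p y * exp (- y) = (\<Sum>i\<le>degree p. coeff p i * (y ^ i / exp y))" for y
    unfolding poly_altdef by (simp add: exp_minus sum_distrib_left divide_inverse mult_ac)
  moreover have "((\<lambda>y. \<Sum>i\<le>degree p. coeff p i * (y ^ i / exp y)) \<longlongrightarrow> (\<Sum>i\<le>degree p. coeff p i * 0)) at_top"
    by (intro tendsto_sum tendsto_mult tendsto_const tendsto_power_div_exp_0)
  ultimately show ?thesis by simp
qed

lemma exp_flat_tendsto_0: "((\<lambda>x. exp_flat p x) \<longlongrightarrow> 0) (at 0)"
proof -
  have "((\<lambda>x. poly p (1 / x) * exp (- (1 / x))) \<longlongrightarrow> 0) (at_right (0::real))"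
    using filterlim_compose[OF poly_times_exp_minus_tendsto_0[of p] filterlim_inverse_at_top_right]
    by (simp add: inverse_eq_divide)
  then have "(exp_flat p \<longlongrightarrow> 0) (at_right 0)"
    by (rule Lim_transform_eventually)
      (auto simp: exp_flat_def eventually_at_filter)
  moreover have "(exp_flat p \<longlongrightarrow> 0) (at_left 0)"
    by (rule Lim_transform_eventually[OF tendsto_const])
      (auto simp: exp_flat_def eventually_at_filter)
  ultimately show ?thesis by (simp add: filterlim_at_split)
qed

lemma exp_flat_has_derivative:
  "(exp_flat p has_real_derivative exp_flat ([:0, 0, 1:] * (p - pderiv p)) x) (at x)"
proof -
  consider "x > 0" | "x < 0" | "x = 0" by linarith
  then show ?thesis
  proof cases
    case 1
    have "((\<lambda>x. poly p (1 / x) * exp (- (1 / x))) has_real_derivative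
        exp_flat ([:0, 0, 1:] * (p - pderiv p)) x) (at x)"
      using 1
      by (auto intro!: derivative_eq_intros poly_DERIV[THEN DERIV_chain2]
          simp: exp_flat_def field_simps power2_eq_square)
    then show ?thesis
      by (rule has_field_derivative_transform_within_open[of _ _ _ "{0<..}"])
        (use 1 in \<open>auto simp: exp_flat_def\<close>)
  next
    case 2
    have "((\<lambda>x. 0) has_real_derivative exp_flat ([:0, 0, 1:] * (p - pderiv p)) x) (at x)"
      using 2 by (simp add: exp_flat_def)
    then show ?thesis
      by (rule has_field_derivative_transform_within_open[of _ _ _ "{..<0}"])
        (use 2 in \<open>auto simp: exp_flat_def\<close>)
  next
    case 3
    have "exp_flat p x / x = exp_flat ([:0, 1:] * p) x" for x
      by (simp add: exp_flat_def)
    then have "((\<lambda>x. exp_flat p x / x) \<longlongrightarrow> 0) (at 0)"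
      using exp_flat_tendsto_0 by simp
    then show ?thesis unfolding 3 has_field_derivative_iff by (simp add: exp_flat_def)
  qed
qed

lemma Ck_on_exp_flat: "Ck_on n UNIV UNIV (exp_flat p)"
proof (induction n arbitrary: p)
  case 0
  then show ?case
    using exp_flat_has_derivative by (auto intro: DERIV_continuous_on)
next
  case (Suc n)
  let ?q = "[:0, 0, 1:] * (p - pderiv p)"
  show ?case
  proof (rule Ck_on_SucI[where f' = "\<lambda>v x. v *\<^sub>R exp_flat ?q x"])
    show "continuous_on UNIV (exp_flat p)"
      using exp_flat_has_derivative by (auto intro: DERIV_continuous_on)
    show "has_dir_deriv (exp_flat p) v (v *\<^sub>R exp_flat ?q x) x" for v x
    proof -
      have "((\<lambda>t. x + t *\<^sub>R v) has_real_derivative v) (at 0)"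
        by (auto intro!: derivative_eq_intros)
      from DERIV_chain2[OF _ this, of "exp_flat p" "exp_flat ?q x"] exp_flat_has_derivative[of p x]
      show ?thesis by (simp add: has_real_derivative_iff_has_vector_derivative mult.commute)
    qed
    show "Ck_on n UNIV UNIV (\<lambda>x. v *\<^sub>R exp_flat ?q x)" for v
      by (intro Ck_on_scaleR Ck_on_const Suc) auto
  qed auto
qed

definition bump :: "'e::euclidean_space \<Rightarrow> real \<Rightarrow> 'e \<Rightarrow> real" where
  "bump c r x = exp_flat 1 (r\<^sup>2 - (x - c) \<bullet> (x - c))"

lemma bump_nonneg: "bump c r x \<ge> 0"
  by (simp add: bump_def exp_flat_def)

lemma bump_pos_iff: "r > 0 \<Longrightarrow> bump c r x > 0 \<longleftrightarrow> x \<in> ball c r"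
  unfolding bump_def exp_flat_def
  by (auto simp: dot_square_norm dist_norm norm_minus_commute power_strict_mono)
    (metis norm_ge_zero norm_minus_commute power2_less_imp_less less_imp_le)

lemma bump_zero: "\<lbrakk>r > 0; x \<notin> ball c r\<rbrakk> \<Longrightarrow> bump c r x = 0"
  using bump_pos_iff[of r c x] bump_nonneg[of c r x] by linarith

lemma smooth_on_bump:
  assumes "subspace V" "openin (top_of_set V) W"
  shows "smooth_on V W (bump c r)"
  unfolding smooth_on_iff_Ck_on
proof
  fix n
  have "Ck_on n V W (\<lambda>x. r\<^sup>2 + (- 1) * ((x + - c) \<bullet> (x + - c)))"
    by (intro Ck_on_add[OF assms] Ck_on_mult[OF assms] Ck_on_inner[OF assms]
        Ck_on_ident[OF assms] Ck_on_const)
  from Ck_on_compose[OF _ _ assms Ck_on_exp_flat[of n 1] this]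
  show "Ck_on n V W (bump c r)" by (simp add: bump_def[abs_def])
qed

section \<open>Smooth maps and diffeomorphisms in charts\<close>

text \<open>Smooth functions with values in any normed space, so that real-valued weights and maps into
  \<open>\<real>\<^sup>n\<close> are treated alike.\<close>

definition smooth_fun :: "('m, 'e::euclidean_space) manifold \<Rightarrow> ('m \<Rightarrow> 'b::real_normed_vector) \<Rightarrow> bool"
  where "smooth_fun M f \<longleftrightarrow> (\<forall>(U, \<phi>)\<in>atlas M. smooth_on (model M) (\<phi> ` U) (f \<circ> inv_into U \<phi>))"

lemma smooth_funD:
  "\<lbrakk>smooth_fun M f; (U, \<phi>) \<in> atlas M\<rbrakk> \<Longrightarrow> smooth_on (model M) (\<phi> ` U) (f \<circ> inv_into U \<phi>)"
  unfolding smooth_fun_def by auto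

lemma smooth_functions_eq: "smooth_functions M = {f \<in> extensional (points M). smooth_fun M f}"
  unfolding smooth_functions_def smooth_fun_def by simp

lemma Cinf_limitD:
  assumes "Cinf_limit M h l \<F>" "(U, \<phi>) \<in> atlas M" "compact K" "K \<subseteq> \<phi> ` U" "set vs \<subseteq> model M"
  shows "uniform_limit K (\<lambda>s. iter_deriv (h s \<circ> inv_into U \<phi>) vs) (iter_deriv (l \<circ> inv_into U \<phi>) vs) \<F>"
  using bspec[OF assms(1)[unfolded Cinf_limit_def] assms(2)] assms(3-) by simp

locale smooth_mfd =
  fixes M :: "('m, 'e::euclidean_space) manifold"
  assumes smooth: "smooth_manifold M"
begin

abbreviation "X \<equiv> top_of M"
abbreviation "V \<equiv> model M"

lemma V: "subspace V"
  using smooth by (simp add: smooth_manifold_def)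

lemma atlas_cover: "(\<Union>(U, \<phi>)\<in>atlas M. U) = points M"
  using smooth unfolding smooth_manifold_def by (elim conjE)

lemma atlas_charts: "\<forall>(U, \<phi>)\<in>atlas M.
      openin X U \<and> openin (top_of_set V) (\<phi> ` U) \<and>
      homeomorphic_map (subtopology X U) (top_of_set (\<phi> ` U)) \<phi>"
  using smooth unfolding smooth_manifold_def by (elim conjE)

lemma atlas_transitions: "\<forall>(U, \<phi>)\<in>atlas M. \<forall>(W, \<psi>)\<in>atlas M.
      smooth_on V (\<phi> ` (U \<inter> W)) (\<psi> \<circ> inv_into U \<phi>)"
  using smooth unfolding smooth_manifold_def by (elim conjE)

lemma Hausdorff: "Hausdorff_space X"
  using smooth unfolding smooth_manifold_def by (elim conjE)

lemma chart_at:
  assumes "x \<in> points M"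
  obtains U \<phi> where "(U, \<phi>) \<in> atlas M" "x \<in> U"
  using assms unfolding atlas_cover[symmetric] by blast

context
  fixes U :: "'m set" and \<phi> :: "'m \<Rightarrow> 'e"
  assumes chart: "(U, \<phi>) \<in> atlas M"
begin

lemma chart_open: "openin X U"
  and chart_image_open: "openin (top_of_set V) (\<phi> ` U)"
  and chart_homeo: "homeomorphic_map (subtopology X U) (top_of_set (\<phi> ` U)) \<phi>"
  using bspec[OF atlas_charts chart] by simp_all

lemma chart_subset: "U \<subseteq> points M"
  using chart_open openin_subset by blast

lemma chart_inj: "inj_on \<phi> U"
  using homeomorphic_imp_injective_map[OF chart_homeo] chart_subset
  by (simp add: Int_absorb1)

lemma chart_inv [simp]: "x \<in> U \<Longrightarrow> inv_into U \<phi> (\<phi> x) = x"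
  using chart_inj by simp

lemma chart_open_image:
  assumes "openin X T" "T \<subseteq> U"
  shows "openin (top_of_set V) (\<phi> ` T)"
proof -
  have "openin (subtopology X U) T"
    using assms chart_open by (simp add: openin_open_subtopology)
  then have "openin (top_of_set (\<phi> ` U)) (\<phi> ` T)"
    using homeomorphic_imp_open_map[OF chart_homeo] unfolding open_map_def by simp
  then show ?thesis by (rule openin_trans[OF _ chart_image_open])
qed

lemma chart_continuous: "continuous_map (subtopology X U) euclidean \<phi>"
  by (rule continuous_map_into_fulltopology[OF homeomorphic_imp_continuous_map[OF chart_homeo]])

lemma chart_open_vimage:
  assumes "openin (top_of_set V) S"
  shows "openin X {x \<in> U. \<phi> x \<in> S}"
proof -
  obtain T where T: "open T" "S = V \<inter> T" using assms by (auto simp: openin_open)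
  have "openin (subtopology X U) {x \<in> topspace (subtopology X U). \<phi> x \<in> T}"
    by (rule openin_continuous_map_preimage[OF chart_continuous]) (use T in simp)
  moreover have "{x \<in> topspace (subtopology X U). \<phi> x \<in> T} = {x \<in> U. \<phi> x \<in> S}"
    using chart_subset openin_imp_subset[OF chart_image_open] T(2) by auto
  ultimately show ?thesis
    using chart_open by (simp add: openin_open_subtopology)
qed

lemma chart_inv_continuous: "continuous_map (top_of_set (\<phi> ` U)) X (inv_into U \<phi>)"
  unfolding continuous_map
proof (intro conjI allI impI)
  show "inv_into U \<phi> ` topspace (top_of_set (\<phi> ` U)) \<subseteq> points M"
    using chart_subset by auto
  fix T assume "openin X T"
  then have "openin (top_of_set V) (\<phi> ` (U \<inter> T))"
    using chart_open by (intro chart_open_image) auto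
  then have "openin (top_of_set (\<phi> ` U)) (\<phi> ` (U \<inter> T))"
    by (rule openin_subset_trans) (use openin_imp_subset[OF chart_image_open] in auto)
  moreover have "{y \<in> topspace (top_of_set (\<phi> ` U)). inv_into U \<phi> y \<in> T} = \<phi> ` (U \<inter> T)"
    by auto
  ultimately show "openin (top_of_set (\<phi> ` U)) {y \<in> topspace (top_of_set (\<phi> ` U)). inv_into U \<phi> y \<in> T}"
    by simp
qed

lemma chart_compact: "\<lbrakk>compact K; K \<subseteq> \<phi> ` U\<rbrakk> \<Longrightarrow> compactin X (inv_into U \<phi> ` K)"
  by (rule image_compactin[OF _ chart_inv_continuous]) (simp add: compactin_subtopology)

lemma chart_compact_closed: "\<lbrakk>compact K; K \<subseteq> \<phi> ` U\<rbrakk> \<Longrightarrow> closedin X (inv_into U \<phi> ` K)"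
  by (rule compactin_imp_closedin[OF Hausdorff chart_compact])

lemma chart_range: "\<phi> ` U \<subseteq> V"
  by (rule openin_imp_subset[OF chart_image_open])

end

lemma smooth_self_map_continuous: "smooth_self_map M g \<Longrightarrow> continuous_map X X g"
  by (simp add: smooth_self_map_def)

lemma smooth_self_map_points:
  "\<lbrakk>smooth_self_map M g; x \<in> points M\<rbrakk> \<Longrightarrow> g x \<in> points M"
  using smooth_self_map_continuous by (fastforce simp: continuous_map_def)

lemma smooth_self_map_open_preimage:
  assumes "smooth_self_map M g" "(U, \<phi>) \<in> atlas M" "openin X A"
  shows "openin X (U \<inter> g -` A)"
proof -
  have "openin X {x \<in> points M. g x \<in> A}"
    by (rule openin_continuous_map_preimage[OF smooth_self_map_continuous[OF assms(1)] assms(3)])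
  then have "openin X (U \<inter> {x \<in> points M. g x \<in> A})" using chart_open[OF assms(2)] by blast
  moreover have "U \<inter> {x \<in> points M. g x \<in> A} = U \<inter> g -` A"
    using chart_subset[OF assms(2)] by auto
  ultimately show ?thesis by simp
qed

lemma smooth_self_map_in_charts:
  "\<lbrakk>smooth_self_map M g; (U, \<phi>) \<in> atlas M; (Y, \<eta>) \<in> atlas M\<rbrakk>
    \<Longrightarrow> smooth_on V (\<phi> ` (U \<inter> g -` Y)) (\<eta> \<circ> g \<circ> inv_into U \<phi>)"
  unfolding smooth_self_map_def by auto

text \<open>Smoothness and the chain rule for a composition at chart level. The function \<open>h\<close> may be
  defined on an open part \<open>A\<close> of the chart domain only, which covers functions on \<open>M\<close>, self-maps followed by a
  chart, and, with \<open>g\<close> the identity, changes of charts.\<close>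

lemma chain_in_charts:
  assumes g: "smooth_self_map M g" and c: "(U, \<phi>) \<in> atlas M" "(Y, \<eta>) \<in> atlas M"
    and A: "openin X A" "A \<subseteq> Y" and h: "smooth_on V (\<eta> ` A) (h \<circ> inv_into Y \<eta>)"
  shows "smooth_on V (\<phi> ` (U \<inter> g -` A)) (h \<circ> g \<circ> inv_into U \<phi>)"
    and "\<lbrakk>x \<in> U; g x \<in> A; v \<in> V\<rbrakk> \<Longrightarrow> dir_deriv (\<eta> \<circ> g \<circ> inv_into U \<phi>) v (\<phi> x) \<in> V \<and>
      has_dir_deriv (h \<circ> g \<circ> inv_into U \<phi>) v
        (dir_deriv (h \<circ> inv_into Y \<eta>) (dir_deriv (\<eta> \<circ> g \<circ> inv_into U \<phi>) v (\<phi> x)) (\<eta> (g x))) (\<phi> x)"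
proof -
  let ?X = "\<phi> ` (U \<inter> g -` A)"
  let ?g = "\<eta> \<circ> g \<circ> inv_into U \<phi>"
  have X: "openin (top_of_set V) ?X"
    by (rule chart_open_image[OF c(1)]) (use smooth_self_map_open_preimage[OF g c(1) A(1)] in auto)
  have W: "openin (top_of_set V) (\<eta> ` A)"
    by (rule chart_open_image[OF c(2) A])
  have gs: "smooth_on V ?X ?g"
    by (rule smooth_on_subset[OF smooth_self_map_in_charts[OF g c]]) (use A in auto)
  have im: "?g ` ?X \<subseteq> \<eta> ` A"
    using chart_inv[OF c(1)] by auto
  have eq: "(h \<circ> inv_into Y \<eta>) (?g y) = (h \<circ> g \<circ> inv_into U \<phi>) y" if "y \<in> ?X" for y
    using that chart_inv[OF c(1)] chart_inv[OF c(2)] A by auto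
  show "smooth_on V ?X (h \<circ> g \<circ> inv_into U \<phi>)"
    by (rule smooth_on_cong[OF V X smooth_on_compose[OF V W V X h gs im] eq])
  show "dir_deriv ?g v (\<phi> x) \<in> V \<and>
      has_dir_deriv (h \<circ> g \<circ> inv_into U \<phi>) v
        (dir_deriv (h \<circ> inv_into Y \<eta>) (dir_deriv ?g v (\<phi> x)) (\<eta> (g x))) (\<phi> x)"
    if "x \<in> U" "g x \<in> A" "v \<in> V"
  proof
    have x: "\<phi> x \<in> ?X" using that by blast
    have gd: "has_dir_deriv ?g v (dir_deriv ?g v (\<phi> x)) (\<phi> x)"
      by (rule smooth_on_has_dir_deriv[OF gs \<open>v \<in> V\<close> x])
    show "dir_deriv ?g v (\<phi> x) \<in> V"
      by (rule dir_deriv_compose(1)[OF V W h V X x that(3) gd im])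
    show "has_dir_deriv (h \<circ> g \<circ> inv_into U \<phi>) v
        (dir_deriv (h \<circ> inv_into Y \<eta>) (dir_deriv ?g v (\<phi> x)) (\<eta> (g x))) (\<phi> x)"
      by (rule has_dir_deriv_cong[OF V X x that(3) _ eq])
        (use dir_deriv_compose(2)[OF V W h V X x that(3) gd im] chart_inv[OF c(1) that(1)] in simp)
  qed
qed

lemma smooth_fun_compose:
  assumes f: "smooth_fun M f" and g: "smooth_self_map M g"
  shows "smooth_fun M (f \<circ> g)"
  unfolding smooth_fun_def
proof clarify
  fix U \<phi> assume c: "(U, \<phi>) \<in> atlas M"
  show "smooth_on V (\<phi> ` U) (f \<circ> g \<circ> inv_into U \<phi>)"
  proof (rule smooth_on_local)
    fix y assume "y \<in> \<phi> ` U"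
    then obtain x where x: "x \<in> U" "y = \<phi> x" by blast
    then have "g x \<in> points M"
      using chart_subset[OF c] smooth_self_map_points[OF g] by blast
    then obtain Y \<eta> where d: "(Y, \<eta>) \<in> atlas M" "g x \<in> Y" by (rule chart_at)
    let ?T = "\<phi> ` (U \<inter> g -` Y)"
    have "openin (top_of_set V) ?T"
      by (rule chart_open_image[OF c])
        (use smooth_self_map_open_preimage[OF g c chart_open[OF d(1)]] in auto)
    then have "openin (top_of_set (\<phi> ` U)) ?T"
      by (rule openin_subset_trans) (use chart_range[OF c] in auto)
    moreover have "smooth_on V ?T (f \<circ> g \<circ> inv_into U \<phi>)"
      by (rule chain_in_charts(1)[OF g c d(1) chart_open[OF d(1)] subset_refl smooth_funD[OF f d(1)]])
    ultimately show "\<exists>T. y \<in> T \<and> openin (top_of_set (\<phi> ` U)) T \<and> smooth_on V T (f \<circ> g \<circ> inv_into U \<phi>)"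
      using x d by (intro exI[of _ ?T]) simp
  qed
qed

lemma smooth_self_map_compose:
  assumes k: "smooth_self_map M k" and g: "smooth_self_map M g"
  shows "smooth_self_map M (k \<circ> g)"
  unfolding smooth_self_map_def
proof (intro conjI; clarify?)
  show "continuous_map X X (k \<circ> g)"
    by (rule continuous_map_compose[OF smooth_self_map_continuous[OF g] smooth_self_map_continuous[OF k]])
  fix U \<phi> W \<psi> assume c: "(U, \<phi>) \<in> atlas M" "(W, \<psi>) \<in> atlas M"
  show "smooth_on V (\<phi> ` (U \<inter> (k \<circ> g) -` W)) (\<psi> \<circ> (k \<circ> g) \<circ> inv_into U \<phi>)"
  proof (rule smooth_on_local)
    fix y assume "y \<in> \<phi> ` (U \<inter> (k \<circ> g) -` W)"
    then obtain x where x: "x \<in> U" "y = \<phi> x" "k (g x) \<in> W" by auto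
    then have "g x \<in> points M"
      using chart_subset[OF c(1)] smooth_self_map_points[OF g] by blast
    then obtain Y \<eta> where d: "(Y, \<eta>) \<in> atlas M" "g x \<in> Y" by (rule chart_at)
    let ?A = "Y \<inter> k -` W"
    have A: "openin X ?A"
      by (rule smooth_self_map_open_preimage[OF k d(1) chart_open[OF c(2)]])
    let ?T = "\<phi> ` (U \<inter> g -` ?A)"
    have "openin (top_of_set V) ?T"
      by (rule chart_open_image[OF c(1)])
        (use smooth_self_map_open_preimage[OF g c(1) A] in auto)
    then have "openin (top_of_set (\<phi> ` (U \<inter> (k \<circ> g) -` W))) ?T"
      by (rule openin_subset_trans) (use chart_range[OF c(1)] in auto)
    moreover have "smooth_on V ?T (\<psi> \<circ> k \<circ> g \<circ> inv_into U \<phi>)"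
      by (rule chain_in_charts(1)[OF g c(1) d(1) A Int_lower1 smooth_self_map_in_charts[OF k d(1) c(2)]])
    ultimately show "\<exists>T. y \<in> T \<and> openin (top_of_set (\<phi> ` (U \<inter> (k \<circ> g) -` W))) T \<and>
        smooth_on V T (\<psi> \<circ> (k \<circ> g) \<circ> inv_into U \<phi>)"
      using x d by (intro exI[of _ ?T]) (simp add: o_assoc)
  qed
qed

lemma smooth_self_map_cong:
  assumes g: "smooth_self_map M g" and eq: "\<And>x. x \<in> points M \<Longrightarrow> g x = g' x"
  shows "smooth_self_map M g'"
  unfolding smooth_self_map_def
proof (intro conjI; clarify?)
  show "continuous_map X X g'"
    by (rule continuous_map_eq[OF smooth_self_map_continuous[OF g] eq])
  fix U \<phi> W \<psi> assume c: "(U, \<phi>) \<in> atlas M" "(W, \<psi>) \<in> atlas M"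
  have *: "U \<inter> g' -` W = U \<inter> g -` W" using eq chart_subset[OF c(1)] by auto
  show "smooth_on V (\<phi> ` (U \<inter> g' -` W)) (\<psi> \<circ> g' \<circ> inv_into U \<phi>)"
    unfolding *
  proof (rule smooth_on_cong[OF V _ smooth_self_map_in_charts[OF g c]])
    show "openin (top_of_set V) (\<phi> ` (U \<inter> g -` W))"
      by (rule chart_open_image[OF c(1)])
        (use smooth_self_map_open_preimage[OF g c(1) chart_open[OF c(2)]] in auto)
    show "(\<psi> \<circ> g \<circ> inv_into U \<phi>) x = (\<psi> \<circ> g' \<circ> inv_into U \<phi>) x"
      if "x \<in> \<phi> ` (U \<inter> g -` W)" for x
      using that chart_inv[OF c(1)] chart_subset[OF c(1)] eq by auto
  qed
qed

lemma smooth_self_map_id: "smooth_self_map M (\<lambda>x. x)"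
  using atlas_transitions unfolding smooth_self_map_def
  by (auto simp: o_def vimage_def Int_def)

lemma DiffI:
  assumes "smooth_self_map M g" "smooth_self_map M k"
    and "\<And>x. x \<in> points M \<Longrightarrow> g x \<in> points M \<and> k x \<in> points M \<and> k (g x) = x \<and> g (k x) = x"
  shows "g \<in> Diff M"
proof -
  have bij: "bij_betw g (points M) (points M)"
    by (rule bij_betwI[where g = k]) (use assms(3) in auto)
  have "k x = inv_into (points M) g x" if "x \<in> points M" for x
    using assms(3) that bij by (metis bij_betw_inv_into_left)
  from smooth_self_map_cong[OF assms(2) this] bij assms(1) show ?thesis
    unfolding Diff_def by simp
qed

lemma Diff_inverse:
  assumes "g \<in> Diff M"
  obtains k where "k \<in> Diff M"
    "\<And>x. x \<in> points M \<Longrightarrow> g x \<in> points M \<and> k x \<in> points M \<and> k (g x) = x \<and> g (k x) = x"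
proof -
  let ?k = "inv_into (points M) g"
  have bij: "bij_betw g (points M) (points M)" and s: "smooth_self_map M g" "smooth_self_map M ?k"
    using assms by (auto simp: Diff_def)
  have *: "\<And>x. x \<in> points M \<Longrightarrow> g x \<in> points M \<and> ?k x \<in> points M \<and> ?k (g x) = x \<and> g (?k x) = x"
    using bij by (metis bij_betw_apply bij_betw_inv_into bij_betw_inv_into_left bij_betw_inv_into_right)
  show thesis by (rule that[OF DiffI[OF s(2,1)] *]) (use * in auto)
qed

lemma Diff_points: "\<lbrakk>g \<in> Diff M; x \<in> points M\<rbrakk> \<Longrightarrow> g x \<in> points M"
  unfolding Diff_def using bij_betw_apply by fastforce

lemma Diff_smooth: "g \<in> Diff M \<Longrightarrow> smooth_self_map M g"
  by (simp add: Diff_def)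

lemma Diff_id: "(\<lambda>x. x) \<in> Diff M"
  by (rule DiffI[OF smooth_self_map_id smooth_self_map_id]) auto

lemma Diff_compose:
  assumes "g \<in> Diff M" "h \<in> Diff M"
  shows "g \<circ> h \<in> Diff M"
proof -
  obtain g' where g': "g' \<in> Diff M"
    "\<And>x. x \<in> points M \<Longrightarrow> g x \<in> points M \<and> g' x \<in> points M \<and> g' (g x) = x \<and> g (g' x) = x"
    using Diff_inverse[OF assms(1)] by blast
  obtain h' where h': "h' \<in> Diff M"
    "\<And>x. x \<in> points M \<Longrightarrow> h x \<in> points M \<and> h' x \<in> points M \<and> h' (h x) = x \<and> h (h' x) = x"
    using Diff_inverse[OF assms(2)] by blast
  show ?thesis
    by (rule DiffI[OF smooth_self_map_compose[OF Diff_smooth[OF assms(1)] Diff_smooth[OF assms(2)]]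
          smooth_self_map_compose[OF Diff_smooth[OF h'(1)] Diff_smooth[OF g'(1)]]])
      (use g'(2) h'(2) in auto)
qed

text \<open>The derivative of \<open>f \<circ> g\<close> is that of \<open>f\<close> after that of \<open>g\<close>, and the latter is injective because
  the derivative of the inverse \<open>k\<close> of \<open>g\<close> is a left inverse.\<close>

lemma Imm_compose:
  fixes f :: "'m \<Rightarrow> real ^ 'n"
  assumes f: "f \<in> Imm M" and g: "g \<in> Diff M"
  shows "compose (points M) f g \<in> Imm M"
proof -
  have gs: "smooth_self_map M g" by (rule Diff_smooth[OF g])
  obtain k where k: "k \<in> Diff M"
    "\<And>x. x \<in> points M \<Longrightarrow> g x \<in> points M \<and> k x \<in> points M \<and> k (g x) = x \<and> g (k x) = x"
    using Diff_inverse[OF g] by blast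
  have fs: "smooth_fun M f" using f by (auto simp: Imm_def smooth_functions_eq)
  have eq: "(compose (points M) f g \<circ> inv_into U \<phi>) y = (f \<circ> g \<circ> inv_into U \<phi>) y"
    if "(U, \<phi>) \<in> atlas M" "y \<in> \<phi> ` U" for U \<phi> y
    using chart_subset[OF that(1)] chart_inv[OF that(1)] that(2) by (auto simp: compose_def)
  have sm: "smooth_fun M (compose (points M) f g)"
    unfolding smooth_fun_def
  proof clarify
    fix U \<phi> assume c: "(U, \<phi>) \<in> atlas M"
    have "smooth_on V (\<phi> ` U) (f \<circ> g \<circ> inv_into U \<phi>)"
      using smooth_fun_compose[OF fs gs] c unfolding smooth_fun_def by blast
    then show "smooth_on V (\<phi> ` U) (compose (points M) f g \<circ> inv_into U \<phi>)"
      by (rule smooth_on_cong[OF V chart_image_open[OF c]]) (use eq[OF c] in simp)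
  qed
  have "inj_on (\<lambda>v. dir_deriv (compose (points M) f g \<circ> inv_into U \<phi>) v (\<phi> x)) V"
    if c: "(U, \<phi>) \<in> atlas M" and x: "x \<in> U" for U \<phi> x
  proof -
    have xM: "x \<in> points M" using chart_subset[OF c] x by blast
    then have "g x \<in> points M" using k(2) by blast
    then obtain Y \<eta> where d: "(Y, \<eta>) \<in> atlas M" "g x \<in> Y" by (rule chart_at)
    define w where "w v = dir_deriv (\<eta> \<circ> g \<circ> inv_into U \<phi>) v (\<phi> x)" for v
    have fY: "smooth_on V (\<eta> ` Y) (f \<circ> inv_into Y \<eta>)" using fs d by (auto simp: smooth_fun_def)
    have D: "w v \<in> V \<and> dir_deriv (compose (points M) f g \<circ> inv_into U \<phi>) v (\<phi> x) =
        dir_deriv (f \<circ> inv_into Y \<eta>) (w v) (\<eta> (g x))" if v: "v \<in> V" for v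
    proof
      note ch = chain_in_charts(2)[OF gs c d(1) chart_open[OF d(1)] subset_refl fY x d(2) v]
      then show "w v \<in> V" by (simp add: w_def)
      show "dir_deriv (compose (points M) f g \<circ> inv_into U \<phi>) v (\<phi> x) =
          dir_deriv (f \<circ> inv_into Y \<eta>) (w v) (\<eta> (g x))"
        by (rule dir_deriv_eq, rule has_dir_deriv_cong[OF V chart_image_open[OF c] _ v])
          (use ch x eq[OF c] in \<open>auto simp: w_def\<close>)
    qed
    have A: "openin X (Y \<inter> k -` U)"
      by (rule smooth_self_map_open_preimage[OF Diff_smooth[OF k(1)] d(1) chart_open[OF c]])
    have E: "v = dir_deriv (\<phi> \<circ> k \<circ> inv_into Y \<eta>) (w v) (\<eta> (g x))" if v: "v \<in> V" for v
    proof -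
      have gx: "g x \<in> Y \<inter> k -` U" using d(2) x k(2)[OF xM] by auto
      note ch = chain_in_charts(2)[OF gs c d(1) A _
          smooth_self_map_in_charts[OF Diff_smooth[OF k(1)] d(1) c] x gx v]
      have "has_dir_deriv (\<lambda>y. y) v (dir_deriv (\<phi> \<circ> k \<circ> inv_into Y \<eta>) (w v) (\<eta> (g x))) (\<phi> x)"
      proof (rule has_dir_deriv_cong[OF V chart_image_open[OF c] _ v])
        show "has_dir_deriv (\<phi> \<circ> k \<circ> g \<circ> inv_into U \<phi>) v
            (dir_deriv (\<phi> \<circ> k \<circ> inv_into Y \<eta>) (w v) (\<eta> (g x))) (\<phi> x)"
          using ch by (simp add: w_def)
        show "(\<phi> \<circ> k \<circ> g \<circ> inv_into U \<phi>) y = y" if "y \<in> \<phi> ` U" for y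
          using that k(2) chart_subset[OF c] chart_inv[OF c] by auto
      qed (use x in blast)
      moreover have "has_dir_deriv (\<lambda>y. y) v v (\<phi> x)"
        by (auto intro!: derivative_eq_intros simp: has_vector_derivative_def)
      ultimately show ?thesis using vector_derivative_unique_at by metis
    qed
    show ?thesis
    proof (rule inj_onI)
      fix v1 v2 assume v: "v1 \<in> V" "v2 \<in> V" "dir_deriv (compose (points M) f g \<circ> inv_into U \<phi>) v1 (\<phi> x) =
          dir_deriv (compose (points M) f g \<circ> inv_into U \<phi>) v2 (\<phi> x)"
      have "inj_on (\<lambda>v. dir_deriv (f \<circ> inv_into Y \<eta>) v (\<eta> (g x))) V"
        using f d by (auto simp: Imm_def)
      then have "w v1 = w v2" using v D by (metis (no_types, lifting) inj_onD)
      then show "v1 = v2" using E v by metis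
    qed
  qed
  then show ?thesis using sm by (auto simp: Imm_def smooth_functions_eq)
qed

lemma shape_compose:
  assumes g: "g \<in> Diff M"
  shows "shape M (compose (points M) f g) = shape M f"
proof -
  obtain k where k: "k \<in> Diff M"
    "\<And>x. x \<in> points M \<Longrightarrow> g x \<in> points M \<and> k x \<in> points M \<and> k (g x) = x \<and> g (k x) = x"
    using Diff_inverse[OF g] by blast
  note pts = Diff_points
  show ?thesis
  proof
    show "shape M (compose (points M) f g) \<subseteq> shape M f"
    proof
      fix u assume "u \<in> shape M (compose (points M) f g)"
      then obtain h where h: "h \<in> Diff M" "u = compose (points M) (compose (points M) f g) h"
        by (auto simp: shape_def)
      have "u = compose (points M) f (g \<circ> h)"
        unfolding h(2) using pts[OF h(1)] by (auto simp: compose_def restrict_def)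
      then show "u \<in> shape M f" using Diff_compose[OF g h(1)] by (auto simp: shape_def)
    qed
    show "shape M f \<subseteq> shape M (compose (points M) f g)"
    proof
      fix u assume "u \<in> shape M f"
      then obtain h where h: "h \<in> Diff M" "u = compose (points M) f h"
        by (auto simp: shape_def)
      have "u = compose (points M) (compose (points M) f g) (k \<circ> h)"
        unfolding h(2) using pts[OF h(1)] k(2) by (auto simp: compose_def restrict_def fun_eq_iff)
      then show "u \<in> shape M (compose (points M) f g)"
        using Diff_compose[OF k(1) h(1)] by (auto simp: shape_def)
    qed
  qed
qed

section \<open>Closeness up to reparametrisation\<close>

text \<open>Working with this relation instead of the infimum over \<open>g\<close> keeps the triangle inequality free of
  approximations.\<close>

definition near :: "('m \<Rightarrow> real ^ 'n) \<Rightarrow> ('m \<Rightarrow> real ^ 'n) \<Rightarrow> ennreal \<Rightarrow> bool" where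
  "near f0 f1 c \<longleftrightarrow> (\<exists>g\<in>Diff M. \<forall>x\<in>points M. ennreal (norm (f0 (g x) - f1 x)) \<le> c)"

lemma near_refl: "near f f 0"
  unfolding near_def by (rule bexI[OF _ Diff_id]) simp

lemma near_sym: "near f0 f1 c \<Longrightarrow> near f1 f0 c"
proof -
  assume "near f0 f1 c"
  then obtain g where g: "g \<in> Diff M" "\<forall>x\<in>points M. ennreal (norm (f0 (g x) - f1 x)) \<le> c"
    using near_def by blast
  obtain k where k: "k \<in> Diff M"
    "\<And>x. x \<in> points M \<Longrightarrow> g x \<in> points M \<and> k x \<in> points M \<and> k (g x) = x \<and> g (k x) = x"
    using Diff_inverse[OF g(1)] by blast
  have "ennreal (norm (f1 (k x) - f0 x)) \<le> c" if "x \<in> points M" for x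
    using g(2)[rule_format, of "k x"] k(2)[OF that] by (simp add: norm_minus_commute)
  then show "near f1 f0 c" using k(1) near_def by blast
qed

lemma near_mono: "\<lbrakk>near f0 f1 c; c \<le> c'\<rbrakk> \<Longrightarrow> near f0 f1 c'"
  unfolding near_def by (meson order_trans)

text \<open>Precomposition with a bijection of \<open>M\<close> does not change a uniform bound, so that the two reparametrisations may be composed.\<close>

lemma near_trans:
  assumes "near f0 f1 c" "near f1 f2 c'"
  shows "near f0 f2 (c + c')"
proof -
  obtain g where g: "g \<in> Diff M" "\<forall>x\<in>points M. ennreal (norm (f0 (g x) - f1 x)) \<le> c"
    using assms(1) near_def by blast
  obtain h where h: "h \<in> Diff M" "\<forall>x\<in>points M. ennreal (norm (f1 (h x) - f2 x)) \<le> c'"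
    using assms(2) near_def by blast
  have "ennreal (norm (f0 ((g \<circ> h) x) - f2 x)) \<le> c + c'" if x: "x \<in> points M" for x
  proof -
    have hx: "h x \<in> points M" by (rule Diff_points[OF h(1) x])
    have "norm (f0 (g (h x)) - f2 x) \<le> norm (f0 (g (h x)) - f1 (h x)) + norm (f1 (h x) - f2 x)"
      using norm_triangle_ineq[of "f0 (g (h x)) - f1 (h x)" "f1 (h x) - f2 x"] by simp
    then have "ennreal (norm (f0 (g (h x)) - f2 x)) \<le>
        ennreal (norm (f0 (g (h x)) - f1 (h x))) + ennreal (norm (f1 (h x) - f2 x))"
      by (metis ennreal_leI ennreal_plus norm_ge_zero)
    also have "\<dots> \<le> c + c'" using g(2) h(2) hx x by (intro add_mono) auto
    finally show ?thesis by simp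
  qed
  then show ?thesis unfolding near_def using Diff_compose[OF g(1) h(1)] by blast
qed

lemma near_imp_dist_Frechet_le:
  assumes "near f1 f0 c" "f0 \<in> Imm M" "f1 \<in> Imm M"
  shows "dist_Frechet M (shape M f0) (shape M f1) \<le> c"
proof -
  obtain g where g: "g \<in> Diff M" "\<forall>x\<in>points M. ennreal (norm (f1 (g x) - f0 x)) \<le> c"
    using assms(1) near_def by blast
  let ?f = "compose (points M) f1 g"
  have "dist_Frechet M (shape M f0) (shape M f1) \<le> Linf_norm M (\<lambda>x. f0 x - ?f x)"
    unfolding dist_Frechet_def
    using Imm_compose[OF assms(3) g(1)] shape_compose[OF g(1), of f1] assms(2)
    by (intro Inf_lower) blast
  also have "\<dots> \<le> c"
    unfolding Linf_norm_def using g(2)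
    by (intro SUP_least) (auto simp: compose_def norm_minus_commute)
  finally show ?thesis .
qed

end

section \<open>Shears\<close>

text \<open>On each line in direction \<open>v\<close> the shear acts as \<open>\<tau> \<mapsto> \<tau> + a(y + \<tau> v)\<close>, whose derivative is at least
  one half; so the inverse has the form \<open>Q y = y + b(y) v\<close>, and everything reduces to one real
  variable. Implicit differentiation gives \<open>D\<^sub>w b = r\<^sub>w \<circ> Q\<close> with \<open>r\<^sub>w\<close> smooth, which raises the order of
  differentiability of \<open>Q\<close> step by step.\<close>

lemma smooth_shear_inverse:
  fixes a :: "'e::euclidean_space \<Rightarrow> real"
  assumes V: "subspace V" and v: "v \<in> V" and a: "smooth_on V V a"
    and half: "\<And>y. y \<in> V \<Longrightarrow> \<bar>dir_deriv a v y\<bar> \<le> 1 / 2"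
    and bdd: "\<And>y. y \<in> V \<Longrightarrow> \<bar>a y\<bar> \<le> A"
  obtains Q where "smooth_on V V Q"
    "\<And>y. y \<in> V \<Longrightarrow> Q y \<in> V \<and> Q (y + a y *\<^sub>R v) = y \<and> Q y + a (Q y) *\<^sub>R v = y"
proof -
  have VV: "openin (top_of_set V) V" by simp
  have inV: "y + \<tau> *\<^sub>R w \<in> V" if "y \<in> V" "w \<in> V" for y w \<tau>
    using that V by (simp add: subspace_add subspace_scale)
  define \<theta> where "\<theta> y \<tau> = \<tau> + a (y + \<tau> *\<^sub>R v)" for y \<tau>
  have \<theta>_deriv: "(\<theta> y has_real_derivative 1 + dir_deriv a v (y + \<tau> *\<^sub>R v)) (at \<tau>)" if "y \<in> V" for y \<tau>
  proof -
    have "((\<lambda>\<tau>. a (y + \<tau> *\<^sub>R v)) has_vector_derivative dir_deriv a v (y + \<tau> *\<^sub>R v)) (at \<tau>)"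
      by (rule has_dir_deriv_shift, rule smooth_on_has_dir_deriv[OF a v inV[OF that v]])
    then have "((\<lambda>\<tau>. a (y + \<tau> *\<^sub>R v)) has_real_derivative dir_deriv a v (y + \<tau> *\<^sub>R v)) (at \<tau>)"
      by (simp add: has_real_derivative_iff_has_vector_derivative)
    then show ?thesis unfolding \<theta>_def[abs_def] by (auto intro!: derivative_eq_intros)
  qed
  have mvt: "\<exists>\<xi>. \<bar>\<xi> - \<tau>\<bar> \<le> \<bar>\<tau>' - \<tau>\<bar> \<and> \<theta> y \<tau>' - \<theta> y \<tau> = (\<tau>' - \<tau>) * (1 + dir_deriv a v (y + \<xi> *\<^sub>R v))"
    if y: "y \<in> V" for y \<tau> \<tau>'
  proof -
    consider "\<tau> = \<tau>'" | "\<tau> < \<tau>'" | "\<tau>' < \<tau>" by linarith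
    then show ?thesis
    proof cases
      case 1
      then show ?thesis by auto
    next
      case 2
      obtain z where "\<tau> < z" "z < \<tau>'"
        "\<theta> y \<tau>' - \<theta> y \<tau> = (\<tau>' - \<tau>) * (1 + dir_deriv a v (y + z *\<^sub>R v))"
        using MVT2[OF 2, of "\<theta> y" "\<lambda>z. 1 + dir_deriv a v (y + z *\<^sub>R v)"] \<theta>_deriv[OF y] by blast
      then show ?thesis by (intro exI[of _ z]) auto
    next
      case 3
      obtain z where "\<tau>' < z" "z < \<tau>"
        "\<theta> y \<tau> - \<theta> y \<tau>' = (\<tau> - \<tau>') * (1 + dir_deriv a v (y + z *\<^sub>R v))"
        using MVT2[OF 3, of "\<theta> y" "\<lambda>z. 1 + dir_deriv a v (y + z *\<^sub>R v)"] \<theta>_deriv[OF y] by blast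
      then show ?thesis by (intro exI[of _ z]) (auto simp: algebra_simps)
    qed
  qed
  have expand: "\<bar>\<tau>' - \<tau>\<bar> \<le> 2 * \<bar>\<theta> y \<tau>' - \<theta> y \<tau>\<bar>" if y: "y \<in> V" for y \<tau> \<tau>'
  proof -
    obtain \<xi> where \<xi>: "\<theta> y \<tau>' - \<theta> y \<tau> = (\<tau>' - \<tau>) * (1 + dir_deriv a v (y + \<xi> *\<^sub>R v))"
      using mvt[OF y] by blast
    have "1 / 2 \<le> \<bar>1 + dir_deriv a v (y + \<xi> *\<^sub>R v)\<bar>" using half[OF inV[OF y v], of \<xi>] by linarith
    from mult_left_mono[OF this, of "\<bar>\<tau>' - \<tau>\<bar>"] show ?thesis by (simp add: \<xi> abs_mult)
  qed
  have ex: "\<exists>\<tau>. \<theta> y \<tau> = 0" if y: "y \<in> V" for y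
  proof -
    have A: "A \<ge> 0" using bdd[OF y] by linarith
    have "\<exists>\<tau>\<ge>-A. \<tau> \<le> A \<and> \<theta> y \<tau> = 0"
    proof (rule IVT')
      show "\<theta> y (-A) \<le> 0" "0 \<le> \<theta> y A"
        using bdd[OF inV[OF y v], of A] bdd[OF inV[OF y v], of "-A"] by (auto simp: \<theta>_def)
      show "continuous_on {-A..A} (\<theta> y)"
        using \<theta>_deriv[OF y] by (meson DERIV_continuous_on has_field_derivative_at_within)
    qed (use A in simp)
    then show ?thesis by blast
  qed
  define b where "b y = (SOME \<tau>. \<theta> y \<tau> = 0)" for y
  have b: "\<theta> y (b y) = 0" if "y \<in> V" for y
    unfolding b_def by (rule someI_ex[OF ex[OF that]])
  have b_unique: "b y = \<tau>" if "y \<in> V" "\<theta> y \<tau> = 0" for y \<tau>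
    using expand[OF that(1), of "b y" \<tau>] that b by simp
  define Q where "Q y = y + b y *\<^sub>R v" for y
  have Q: "Q y \<in> V" "a (Q y) = - b y" if "y \<in> V" for y
    using inV[OF that v] b[OF that] by (auto simp: Q_def \<theta>_def)
  have inverse: "Q y \<in> V \<and> Q (y + a y *\<^sub>R v) = y \<and> Q y + a (Q y) *\<^sub>R v = y" if y: "y \<in> V" for y
  proof -
    have "b (y + a y *\<^sub>R v) = - a y"
      by (rule b_unique[OF inV[OF y v]]) (simp add: \<theta>_def)
    moreover have "Q y + a (Q y) *\<^sub>R v = y" unfolding Q(2)[OF y] by (simp add: Q_def)
    ultimately show ?thesis using Q[OF y] by (simp add: Q_def)
  qed
  have a_cont: "continuous_on V a" by (rule smooth_on_imp_continuous_on[OF a])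
  have b_cont: "continuous_on V b"
    unfolding continuous_on_def
  proof
    fix y0 assume y0: "y0 \<in> V"
    let ?d = "\<lambda>y. a (y + b y0 *\<^sub>R v) - a (y0 + b y0 *\<^sub>R v)"
    have "continuous_on V (\<lambda>y. a (y + b y0 *\<^sub>R v))"
      by (rule continuous_on_compose2[OF a_cont]) (auto intro!: continuous_intros inV v)
    then have "((\<lambda>y. 2 * \<bar>?d y\<bar>) \<longlongrightarrow> 2 * \<bar>0\<bar>) (at y0 within V)"
      using y0 unfolding continuous_on_def
      by (intro tendsto_mult tendsto_rabs tendsto_const) (auto intro!: LIM_zero)
    then have lim: "((\<lambda>y. 2 * \<bar>?d y\<bar>) \<longlongrightarrow> 0) (at y0 within V)" by simp
    have "((\<lambda>y. b y - b y0) \<longlongrightarrow> 0) (at y0 within V)"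
    proof (rule Lim_null_comparison[OF _ lim])
      show "\<forall>\<^sub>F y in at y0 within V. norm (b y - b y0) \<le> 2 * \<bar>?d y\<bar>"
        unfolding eventually_at_filter
      proof (intro always_eventually allI impI)
        fix y assume y: "y \<in> V"
        show "norm (b y - b y0) \<le> 2 * \<bar>?d y\<bar>"
        proof -
          have "\<theta> y (b y) - \<theta> y (b y0) = - ?d y"
            using b[OF y] b[OF y0] by (simp add: \<theta>_def)
          then show ?thesis using expand[OF y, of "b y" "b y0"] by (simp only: abs_minus_cancel real_norm_def)
        qed
      qed
    qed
    then show "(b \<longlongrightarrow> b y0) (at y0 within V)" by (rule LIM_zero_cancel)
  qed
  define r where "r w z = (- 1) * (dir_deriv a w z * inverse (1 + dir_deriv a v z))" for w z
  have pos: "1 + dir_deriv a v z \<noteq> 0" if "z \<in> V" for z using half[OF that] by linarith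
  have b_deriv: "has_dir_deriv b w (r w (Q y)) y" if y: "y \<in> V" and w: "w \<in> V" for y w
  proof -
    define \<beta> where "\<beta> s = b (y + s *\<^sub>R w)" for s :: real
    \<comment> \<open>The mean value theorem in the direction \<open>v\<close> turns the difference quotient of \<open>b\<close> into an exact quotient.\<close>
    have "\<exists>\<xi>. \<bar>\<xi> - \<beta> 0\<bar> \<le> \<bar>\<beta> s - \<beta> 0\<bar> \<and>
        \<theta> (y + s *\<^sub>R w) (\<beta> s) - \<theta> (y + s *\<^sub>R w) (\<beta> 0) =
          (\<beta> s - \<beta> 0) * (1 + dir_deriv a v (y + s *\<^sub>R w + \<xi> *\<^sub>R v))" for s
      using mvt[OF inV[OF y w]] by blast
    then obtain \<xi> where \<xi>: "\<And>s. \<bar>\<xi> s - \<beta> 0\<bar> \<le> \<bar>\<beta> s - \<beta> 0\<bar>"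
      "\<And>s. \<theta> (y + s *\<^sub>R w) (\<beta> s) - \<theta> (y + s *\<^sub>R w) (\<beta> 0) =
        (\<beta> s - \<beta> 0) * (1 + dir_deriv a v (y + s *\<^sub>R w + \<xi> s *\<^sub>R v))" by metis
    have quot: "(\<beta> s - \<beta> 0) /\<^sub>R (s - 0) = (- 1) * (((a (Q y + s *\<^sub>R w) - a (Q y)) /\<^sub>R (s - 0)) *
        inverse (1 + dir_deriv a v (y + s *\<^sub>R w + \<xi> s *\<^sub>R v)))" for s
    proof -
      have "\<theta> (y + s *\<^sub>R w) (\<beta> s) = 0" using b[OF inV[OF y w]] by (simp add: \<beta>_def)
      moreover have "\<theta> (y + s *\<^sub>R w) (\<beta> 0) = a (Q y + s *\<^sub>R w) - a (Q y)"
        using Q(2)[OF y] by (simp add: \<theta>_def \<beta>_def Q_def algebra_simps)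
      ultimately have "(\<beta> s - \<beta> 0) * (1 + dir_deriv a v (y + s *\<^sub>R w + \<xi> s *\<^sub>R v)) =
          - (a (Q y + s *\<^sub>R w) - a (Q y))"
        using \<xi>(2)[of s] by simp
      then have e: "\<beta> s - \<beta> 0 = - (a (Q y + s *\<^sub>R w) - a (Q y)) *
          inverse (1 + dir_deriv a v (y + s *\<^sub>R w + \<xi> s *\<^sub>R v))"
        using pos[OF inV[OF inV[OF y w] v]] by (simp add: field_simps)
      show ?thesis unfolding e by (simp add: algebra_simps)
    qed
    have "continuous_on UNIV \<beta>"
      unfolding \<beta>_def
      by (rule continuous_on_compose2[OF b_cont]) (auto intro!: continuous_intros inV y w)
    then have "(\<beta> \<longlongrightarrow> \<beta> 0) (at 0)"
      by (metis UNIV_I continuous_on_def)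
    then have lim: "((\<lambda>s. \<bar>\<beta> s - \<beta> 0\<bar>) \<longlongrightarrow> 0) (at 0)"
      using LIM_zero tendsto_rabs_zero by blast
    have "((\<lambda>s. \<xi> s - \<beta> 0) \<longlongrightarrow> 0) (at 0)"
      by (rule Lim_null_comparison[OF _ lim]) (use \<xi>(1) in simp)
    then have "(\<xi> \<longlongrightarrow> \<beta> 0) (at 0)" by (rule LIM_zero_cancel)
    then have "((\<lambda>s. y + s *\<^sub>R w + \<xi> s *\<^sub>R v) \<longlongrightarrow> y + 0 *\<^sub>R w + \<beta> 0 *\<^sub>R v) (at 0)"
      by (intro tendsto_intros)
    then have zlim: "((\<lambda>s. y + s *\<^sub>R w + \<xi> s *\<^sub>R v) \<longlongrightarrow> Q y) (at 0)"
      by (simp add: \<beta>_def Q_def)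
    have "continuous_on V (dir_deriv a v)"
      by (rule smooth_on_imp_continuous_on[OF smooth_on_dir_deriv[OF a v]])
    from continuous_on_tendsto_compose[OF this zlim Q(1)[OF y]]
    have "((\<lambda>s. dir_deriv a v (y + s *\<^sub>R w + \<xi> s *\<^sub>R v)) \<longlongrightarrow> dir_deriv a v (Q y)) (at 0)"
      using inV y v w by simp
    moreover have "((\<lambda>s. (a (Q y + s *\<^sub>R w) - a (Q y)) /\<^sub>R (s - 0)) \<longlongrightarrow> dir_deriv a w (Q y)) (at 0)"
      using smooth_on_has_dir_deriv[OF a w Q(1)[OF y]] unfolding has_vector_derivative_iff_Lim by simp
    ultimately have "((\<lambda>s. (\<beta> s - \<beta> 0) /\<^sub>R (s - 0)) \<longlongrightarrow> r w (Q y)) (at 0)"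
      unfolding quot r_def
      by (intro tendsto_mult tendsto_const tendsto_inverse tendsto_add) (use pos Q(1)[OF y] in auto)
    then show ?thesis unfolding has_vector_derivative_iff_Lim by (simp add: \<beta>_def)
  qed
  have "Ck_on n V V Q" for n
  proof (induction n)
    case 0
    show ?case unfolding Q_def[abs_def] using b_cont by (auto intro!: continuous_intros)
  next
    case (Suc n)
    show ?case
    proof (rule Ck_on_SucI[OF V VV, where f' = "\<lambda>w y. w + r w (Q y) *\<^sub>R v"])
      show "continuous_on V Q" by (rule Ck_on_imp_continuous_on[OF Suc])
      show "has_dir_deriv Q w (w + r w (Q y) *\<^sub>R v) y" if "w \<in> V" "y \<in> V" for w y
      proof -
        have "((\<lambda>t. y + t *\<^sub>R w) has_vector_derivative w) (at 0)"
          by (auto intro!: derivative_eq_intros simp: has_vector_derivative_def)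
        moreover have "((\<lambda>t. b (y + t *\<^sub>R w) *\<^sub>R v) has_vector_derivative r w (Q y) *\<^sub>R v) (at 0)"
          by (rule bounded_linear.has_vector_derivative[OF bounded_linear_scaleR_left b_deriv[OF that(2,1)]])
        ultimately show ?thesis unfolding Q_def by (rule has_vector_derivative_add)
      qed
      show "Ck_on n V V (\<lambda>y. w + r w (Q y) *\<^sub>R v)" if w: "w \<in> V" for w
      proof -
        have "Ck_on n V V (r w)"
          unfolding r_def using pos
          by (intro Ck_on_mult[OF V VV] Ck_on_inverse[OF V VV] Ck_on_add[OF V VV] Ck_on_const
              smooth_on_imp_Ck_on smooth_on_dir_deriv a v w) auto
        then have "Ck_on n V V (\<lambda>y. r w (Q y))"
          by (rule Ck_on_compose[OF V VV V VV _ Suc]) (use Q in auto)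
        then show ?thesis
          by (intro Ck_on_add[OF V VV] Ck_on_scaleR[OF V VV] Ck_on_const)
      qed
    qed
  qed
  then have "smooth_on V V Q" by (simp add: smooth_on_iff_Ck_on)
  then show thesis using that inverse by blast
qed

context smooth_mfd
begin

text \<open>A function supported in a compact part of a chart domain extends by zero. Compact sets are closed
  in the Hausdorff space \<open>M\<close>, so that the chart domain and the complement of the support cover \<open>M\<close>
  by open sets.\<close>

lemma chart_supported_smooth_fun:
  fixes a :: "'e \<Rightarrow> 'b::real_normed_vector"
  assumes c: "(U, \<phi>) \<in> atlas M" and K: "compact K" "K \<subseteq> \<phi> ` U"
    and a: "smooth_on V (\<phi> ` U) a" "\<And>y. y \<in> \<phi> ` U - K \<Longrightarrow> a y = 0"
  shows "smooth_fun M (\<lambda>x. if x \<in> U then a (\<phi> x) else 0)" (is "smooth_fun M ?f")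
  unfolding smooth_fun_def
proof clarify
  fix U1 \<phi>1 assume c1: "(U1, \<phi>1) \<in> atlas M"
  let ?C = "inv_into U \<phi> ` K"
  have C: "closedin X ?C" by (rule chart_compact_closed[OF c K])
  have zero: "?f x = 0" if "x \<notin> ?C" for x
  proof (cases "x \<in> U")
    case True
    then have "\<phi> x \<notin> K" using that chart_inv[OF c True] by (metis image_eqI)
    then show ?thesis using a(2) True by auto
  qed simp
  have fU: "smooth_on V (\<phi> ` U) (?f \<circ> inv_into U \<phi>)"
    by (rule smooth_on_cong[OF V chart_image_open[OF c] a(1)]) (use chart_inv[OF c] in auto)
  show "smooth_on V (\<phi>1 ` U1) (?f \<circ> inv_into U1 \<phi>1)"
  proof (rule smooth_on_local)
    fix y assume "y \<in> \<phi>1 ` U1"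
    then obtain x where x: "x \<in> U1" "y = \<phi>1 x" by blast
    have "\<exists>A. openin X A \<and> A \<subseteq> U1 \<and> x \<in> A \<and> smooth_on V (\<phi>1 ` A) (?f \<circ> inv_into U1 \<phi>1)"
    proof (cases "x \<in> U")
      case True
      have "smooth_on V (\<phi>1 ` (U1 \<inter> (\<lambda>x. x) -` U)) (?f \<circ> (\<lambda>x. x) \<circ> inv_into U1 \<phi>1)"
        by (rule chain_in_charts(1)[OF smooth_self_map_id c1 c chart_open[OF c] subset_refl fU])
      then show ?thesis
        using True x(1) openin_Int[OF chart_open[OF c1] chart_open[OF c]]
        by (intro exI[of _ "U1 \<inter> U"]) (simp add: o_def vimage_def)
    next
      case False
      then have "x \<notin> ?C" using K(2) by (auto intro!: inv_into_into)
      have A: "openin X (U1 - ?C)" by (rule openin_diff[OF chart_open[OF c1] C])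
      have "smooth_on V (\<phi>1 ` (U1 - ?C)) (\<lambda>y. 0 :: 'b)"
        unfolding smooth_on_iff_Ck_on using Ck_on_const by blast
      then have "smooth_on V (\<phi>1 ` (U1 - ?C)) (?f \<circ> inv_into U1 \<phi>1)"
      proof (rule smooth_on_cong[OF V chart_open_image[OF c1 A Diff_subset]])
        show "0 = (?f \<circ> inv_into U1 \<phi>1) y" if "y \<in> \<phi>1 ` (U1 - ?C)" for y
        proof -
          obtain z where z: "z \<in> U1" "z \<notin> ?C" "y = \<phi>1 z" using \<open>y \<in> \<phi>1 ` (U1 - ?C)\<close> by blast
          then have "inv_into U1 \<phi>1 y = z" using chart_inv[OF c1] by simp
          then show ?thesis using zero[OF z(2)] by (simp only: o_apply)
        qed
      qed
      then show ?thesis using A \<open>x \<notin> ?C\<close> x(1) by (intro exI[of _ "U1 - ?C"]) simp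
    qed
    then obtain A where A: "openin X A" "A \<subseteq> U1" "x \<in> A" "smooth_on V (\<phi>1 ` A) (?f \<circ> inv_into U1 \<phi>1)"
      by blast
    have "openin (top_of_set (\<phi>1 ` U1)) (\<phi>1 ` A)"
      by (rule openin_subset_trans[OF chart_open_image[OF c1 A(1,2)]])
        (use A(2) chart_range[OF c1] in auto)
    then show "\<exists>T. y \<in> T \<and> openin (top_of_set (\<phi>1 ` U1)) T \<and> smooth_on V T (?f \<circ> inv_into U1 \<phi>1)"
      using A x by (intro exI[of _ "\<phi>1 ` A"]) simp
  qed
qed

definition chart_lift :: "'m set \<Rightarrow> ('m \<Rightarrow> 'e) \<Rightarrow> ('e \<Rightarrow> 'e) \<Rightarrow> 'm \<Rightarrow> 'm" where
  "chart_lift U \<phi> P x = (if x \<in> U then inv_into U \<phi> (P (\<phi> x)) else x)"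

text \<open>As for functions, the chart domain and the complement of the compact set outside which \<open>P\<close> is
  the identity form an open cover.\<close>

lemma chart_lift_smooth:
  assumes c: "(U, \<phi>) \<in> atlas M" and K: "compact K" "K \<subseteq> \<phi> ` U"
    and P: "smooth_on V V P" "P ` V \<subseteq> V" "P ` K \<subseteq> K" "\<And>y. y \<in> V - K \<Longrightarrow> P y = y"
  shows "smooth_self_map M (chart_lift U \<phi> P)" (is "smooth_self_map M ?g")
    and "P ` (\<phi> ` U) \<subseteq> \<phi> ` U"
proof -
  let ?C = "inv_into U \<phi> ` K"
  have C: "closedin X ?C" by (rule chart_compact_closed[OF c K])
  have PU: "P y \<in> \<phi> ` U" if "y \<in> \<phi> ` U" for y
    using that P(3,4) K(2) chart_range[OF c] by (cases "y \<in> K") auto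
  then show "P ` (\<phi> ` U) \<subseteq> \<phi> ` U" by blast
  have fixed: "?g x = x" if "x \<notin> ?C" for x
  proof (cases "x \<in> U")
    case True
    then have "\<phi> x \<notin> K" using that chart_inv[OF c True] by (metis image_eqI)
    then have "P (\<phi> x) = \<phi> x" using P(4) True chart_range[OF c] by blast
    then show ?thesis using True chart_inv[OF c] by (simp add: chart_lift_def)
  qed (simp add: chart_lift_def)
  have CU: "?C \<subseteq> U" using K(2) by (auto intro!: inv_into_into)
  define S where "S T = V \<inter> P -` (\<phi> ` (U \<inter> T))" for T
  define A where "A T = {x \<in> U. \<phi> x \<in> S T}" for T
  have SV: "openin (top_of_set V) (S T)" if "openin X T" for T
    unfolding S_def
  proof (rule continuous_openin_preimage[OF smooth_on_imp_continuous_on[OF P(1)]])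
    show "P \<in> V \<rightarrow> V" using P(2) by auto
    show "openin (top_of_set V) (\<phi> ` (U \<inter> T))"
      by (rule chart_open_image[OF c openin_Int[OF chart_open[OF c] that]]) simp
  qed
  have A: "openin X (A T)" if "openin X T" for T
    unfolding A_def by (rule chart_open_vimage[OF c SV[OF that]])
  have A_iff: "x \<in> A T \<longleftrightarrow> ?g x \<in> T" if x: "x \<in> U" for x T
  proof -
    obtain z where z: "z \<in> U" "P (\<phi> x) = \<phi> z" using PU[of "\<phi> x"] x by blast
    have gz: "?g x = z" unfolding chart_lift_def z(2) using x chart_inv[OF c z(1)] by simp
    have "\<phi> z \<in> \<phi> ` (U \<inter> T) \<longleftrightarrow> z \<in> T"
      using inj_on_image_mem_iff[OF chart_inj[OF c] z(1), of "U \<inter> T"] z(1) by simp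
    moreover have "\<phi> x \<in> V" using x chart_range[OF c] by blast
    ultimately show ?thesis unfolding A_def S_def gz using x z(2) by simp
  qed
  have A_sub: "A T \<subseteq> U" for T by (auto simp: A_def)
  show "smooth_self_map M ?g"
    unfolding smooth_self_map_def
  proof (intro conjI; clarify?)
    show "continuous_map X X ?g"
      unfolding continuous_map
    proof (intro conjI allI impI)
      show "?g ` points M \<subseteq> points M"
      proof (rule image_subsetI)
        fix x assume x: "x \<in> points M"
        show "?g x \<in> points M"
        proof (cases "x \<in> U")
          case True
          then have "?g x \<in> U" using inv_into_into[OF PU] by (simp add: chart_lift_def)
          then show ?thesis using chart_subset[OF c] by blast
        qed (use x in \<open>simp add: chart_lift_def\<close>)
      qed
      fix T assume T: "openin X T"
      have "{x \<in> points M. ?g x \<in> T} = A T \<union> (T - ?C)"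
      proof (intro set_eqI iffI)
        fix x assume x: "x \<in> {x \<in> points M. ?g x \<in> T}"
        show "x \<in> A T \<union> (T - ?C)"
        proof (cases "x \<in> U")
          case True
          then show ?thesis using x A_iff by simp
        next
          case False
          then have "x \<notin> ?C" using CU by blast
          then show ?thesis using x fixed by simp
        qed
      next
        fix x assume "x \<in> A T \<union> (T - ?C)"
        then show "x \<in> {x \<in> points M. ?g x \<in> T}"
          using A_iff[of x T] fixed[of x] A_sub[of T] chart_subset[OF c] openin_subset[OF T] by auto
      qed
      then show "openin X {x \<in> points M. ?g x \<in> T}"
        using openin_Un[OF A[OF T] openin_diff[OF T C]] by simp
    qed
  next
    fix U1 \<phi>1 W \<psi> assume c1: "(U1, \<phi>1) \<in> atlas M" and d: "(W, \<psi>) \<in> atlas M"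
    show "smooth_on V (\<phi>1 ` (U1 \<inter> ?g -` W)) (\<psi> \<circ> ?g \<circ> inv_into U1 \<phi>1)"
    proof (rule smooth_on_local)
      fix y assume "y \<in> \<phi>1 ` (U1 \<inter> ?g -` W)"
      then obtain x where x: "x \<in> U1" "y = \<phi>1 x" "?g x \<in> W" by auto
      have "\<exists>B. openin X B \<and> B \<subseteq> U1 \<inter> ?g -` W \<and> x \<in> B \<and>
          smooth_on V (\<phi>1 ` B) (\<psi> \<circ> ?g \<circ> inv_into U1 \<phi>1)"
      proof (cases "x \<in> U")
        case True
        have UW: "openin (top_of_set V) (\<phi> ` (U \<inter> W))"
          by (rule chart_open_image[OF c openin_Int[OF chart_open[OF c] chart_open[OF d]]]) simp
        have AW: "openin (top_of_set V) (\<phi> ` A W)"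
          by (rule chart_open_image[OF c A[OF chart_open[OF d]] A_sub])
        have t: "smooth_on V (\<phi> ` (U \<inter> W)) (\<psi> \<circ> inv_into U \<phi>)"
          using atlas_transitions c d by auto
        have "smooth_on V (\<phi> ` A W) (\<lambda>y. (\<psi> \<circ> inv_into U \<phi>) (P y))"
          by (rule smooth_on_compose[OF V UW V AW t smooth_on_subset[OF P(1)]])
            (use chart_range[OF c] in \<open>auto simp: A_def S_def\<close>)
        then have "smooth_on V (\<phi> ` A W) ((\<psi> \<circ> ?g) \<circ> inv_into U \<phi>)"
          by (rule smooth_on_cong[OF V AW])
            (use A_sub[of W] chart_inv[OF c] in \<open>auto simp: chart_lift_def\<close>)
        then have "smooth_on V (\<phi>1 ` (U1 \<inter> (\<lambda>x. x) -` A W)) ((\<psi> \<circ> ?g) \<circ> (\<lambda>x. x) \<circ> inv_into U1 \<phi>1)"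
          by (rule chain_in_charts(1)[OF smooth_self_map_id c1 c A[OF chart_open[OF d]] A_sub])
        then have "smooth_on V (\<phi>1 ` (U1 \<inter> A W)) (\<psi> \<circ> ?g \<circ> inv_into U1 \<phi>1)"
          by (simp add: o_def vimage_def)
        moreover have "openin X (U1 \<inter> A W)"
          by (rule openin_Int[OF chart_open[OF c1] A[OF chart_open[OF d]]])
        moreover have "U1 \<inter> A W \<subseteq> U1 \<inter> ?g -` W" using A_iff A_sub by blast
        moreover have "x \<in> U1 \<inter> A W" using A_iff[OF True] x by simp
        ultimately show ?thesis by (intro exI[of _ "U1 \<inter> A W"] conjI)
      next
        case False
        then have xC: "x \<notin> ?C" using CU by blast
        let ?B = "(U1 \<inter> W) - ?C"
        have B: "openin X ?B"
          by (rule openin_diff[OF openin_Int[OF chart_open[OF c1] chart_open[OF d]] C])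
        have t: "smooth_on V (\<phi>1 ` (U1 \<inter> W)) (\<psi> \<circ> inv_into U1 \<phi>1)"
          using atlas_transitions c1 d by auto
        have "smooth_on V (\<phi>1 ` ?B) (\<psi> \<circ> ?g \<circ> inv_into U1 \<phi>1)"
        proof (rule smooth_on_cong[OF V chart_open_image[OF c1 B] smooth_on_subset[OF t]])
          show "(\<psi> \<circ> inv_into U1 \<phi>1) z = (\<psi> \<circ> ?g \<circ> inv_into U1 \<phi>1) z" if "z \<in> \<phi>1 ` ?B" for z
            using that fixed chart_inv[OF c1] by auto
        qed auto
        moreover have "?B \<subseteq> U1 \<inter> ?g -` W" using fixed by auto
        moreover have "x \<in> ?B" using x xC fixed[OF xC] by simp
        ultimately show ?thesis using B by (intro exI[of _ ?B] conjI)
      qed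
      then obtain B where B: "openin X B" "B \<subseteq> U1 \<inter> ?g -` W" "x \<in> B"
        "smooth_on V (\<phi>1 ` B) (\<psi> \<circ> ?g \<circ> inv_into U1 \<phi>1)" by blast
      have "openin (top_of_set (\<phi>1 ` (U1 \<inter> ?g -` W))) (\<phi>1 ` B)"
        by (rule openin_subset_trans[OF chart_open_image[OF c1 B(1)]])
          (use B(2) chart_range[OF c1] in auto)
      then show "\<exists>T. y \<in> T \<and> openin (top_of_set (\<phi>1 ` (U1 \<inter> ?g -` W))) T \<and>
          smooth_on V T (\<psi> \<circ> ?g \<circ> inv_into U1 \<phi>1)"
        using B x by (intro exI[of _ "\<phi>1 ` B"]) simp
    qed
  qed
qed

text \<open>A bijection of \<open>V\<close> that is the identity outside \<open>K\<close> maps \<open>K\<close> into itself, and so does its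
  inverse; hence both descend to \<open>M\<close>.\<close>

lemma chart_lift_shear_Diff:
  fixes a :: "'e \<Rightarrow> real"
  assumes c: "(U, \<phi>) \<in> atlas M" and K: "compact K" "K \<subseteq> \<phi> ` U"
    and a: "smooth_on V V a" "\<And>y. y \<in> V - K \<Longrightarrow> a y = 0" and v: "v \<in> V"
    and half: "\<And>y. y \<in> V \<Longrightarrow> \<bar>dir_deriv a v y\<bar> \<le> 1 / 2"
    and bdd: "\<And>y. y \<in> V \<Longrightarrow> \<bar>a y\<bar> \<le> A"
  shows "chart_lift U \<phi> (\<lambda>y. y + a y *\<^sub>R v) \<in> Diff M" (is "?g \<in> _")
    and "(\<lambda>y. y + a y *\<^sub>R v) ` (\<phi> ` U) \<subseteq> \<phi> ` U"
proof -
  let ?P = "\<lambda>y. y + a y *\<^sub>R v"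
  obtain Q where Q: "smooth_on V V Q"
    "\<And>y. y \<in> V \<Longrightarrow> Q y \<in> V \<and> Q (?P y) = y \<and> ?P (Q y) = y"
    using smooth_shear_inverse[OF V v a(1) half bdd] by blast
  have P: "smooth_on V V ?P"
    using a(1) unfolding smooth_on_iff_Ck_on
    by (intro allI Ck_on_add[OF V] Ck_on_scaleR[OF V] Ck_on_ident[OF V] Ck_on_const) auto
  have PV: "?P ` V \<subseteq> V" using V v by (auto intro: subspace_add subspace_scale)
  have QV: "Q ` V \<subseteq> V" using Q by auto
  have KV: "K \<subseteq> V" using K(2) chart_range[OF c] by blast
  have P_off: "?P y = y" if "y \<in> V - K" for y using a(2)[OF that] by simp
  have Q_off: "Q y = y" if "y \<in> V - K" for y using Q(2)[of y] P_off[OF that] that by simp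
  have PK: "?P ` K \<subseteq> K"
  proof (rule image_subsetI, rule ccontr)
    fix y assume y: "y \<in> K" "?P y \<notin> K"
    then have "?P y \<in> V - K" using PV KV by blast
    then have "Q (?P y) = ?P y" by (rule Q_off)
    moreover have "Q (?P y) = y" using Q(2) y KV by blast
    ultimately show False using y by metis
  qed
  have QK: "Q ` K \<subseteq> K"
  proof (rule image_subsetI, rule ccontr)
    fix y assume y: "y \<in> K" "Q y \<notin> K"
    then have "Q y \<in> V - K" using QV KV by blast
    then have "?P (Q y) = Q y" by (rule P_off)
    moreover have "?P (Q y) = y" using Q(2) y KV by blast
    ultimately show False using y by metis
  qed
  note lP = chart_lift_smooth[OF c K P PV PK P_off]
  note lQ = chart_lift_smooth[OF c K Q(1) QV QK Q_off]
  show "?P ` (\<phi> ` U) \<subseteq> \<phi> ` U" by (rule lP(2))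
  have inv: "chart_lift U \<phi> R x \<in> U \<and> \<phi> (chart_lift U \<phi> R x) = R (\<phi> x)"
    if "R ` (\<phi> ` U) \<subseteq> \<phi> ` U" "x \<in> U" for R x
    using that by (auto simp: chart_lift_def intro!: inv_into_into f_inv_into_f)
  have UV: "\<phi> x \<in> V" if "x \<in> U" for x using that chart_range[OF c] by blast
  show "?g \<in> Diff M"
  proof (rule DiffI[OF lP(1) lQ(1)])
    fix x assume x: "x \<in> points M"
    show "?g x \<in> points M \<and> chart_lift U \<phi> Q x \<in> points M \<and>
        chart_lift U \<phi> Q (?g x) = x \<and> ?g (chart_lift U \<phi> Q x) = x"
    proof (cases "x \<in> U")
      case True
      have "chart_lift U \<phi> Q (?g x) = x"
        using inv[OF lP(2) True] Q(2)[OF UV[OF True]] chart_inv[OF c True] by (simp add: chart_lift_def[of _ _ Q])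
      moreover have "?g (chart_lift U \<phi> Q x) = x"
        using inv[OF lQ(2) True] Q(2)[OF UV[OF True]] chart_inv[OF c True]
        by (simp add: chart_lift_def[of _ _ "?P"])
      ultimately show ?thesis
        using inv[OF lP(2) True] inv[OF lQ(2) True] chart_subset[OF c] by blast
    qed (use x in \<open>simp add: chart_lift_def\<close>)
  qed
qed

end

section \<open>Families of diffeomorphisms with a given initial velocity\<close>

context smooth_mfd
begin

lemma smooth_fun_continuous:
  fixes f :: "'m \<Rightarrow> 'b::real_normed_vector"
  assumes "smooth_fun M f"
  shows "continuous_map X euclidean f"
  unfolding continuous_map
proof (intro conjI allI impI)
  fix T :: "'b set" assume "openin euclidean T"
  then have T: "open T" by simp
  show "openin X {x \<in> points M. f x \<in> T}"
    unfolding openin_subopen[of X "{x \<in> points M. f x \<in> T}"]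
  proof
    fix x assume x: "x \<in> {x \<in> points M. f x \<in> T}"
    then obtain U \<phi> where c: "(U, \<phi>) \<in> atlas M" "x \<in> U" using chart_at[of x] by blast
    have cont: "continuous_on (\<phi> ` U) (f \<circ> inv_into U \<phi>)"
      by (rule smooth_on_imp_continuous_on[OF smooth_funD[OF assms c(1)]])
    have "openin (top_of_set (\<phi> ` U)) (\<phi> ` U \<inter> (f \<circ> inv_into U \<phi>) -` T)"
      by (rule continuous_openin_preimage_gen[OF cont T])
    then have "openin (top_of_set V) (\<phi> ` U \<inter> (f \<circ> inv_into U \<phi>) -` T)"
      by (rule openin_trans[OF _ chart_image_open[OF c(1)]])
    from chart_open_vimage[OF c(1) this]
    have "openin X {x \<in> U. \<phi> x \<in> \<phi> ` U \<inter> (f \<circ> inv_into U \<phi>) -` T}" .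
    moreover have "{x \<in> U. \<phi> x \<in> \<phi> ` U \<inter> (f \<circ> inv_into U \<phi>) -` T} = {x \<in> U. f x \<in> T}"
      using chart_inv[OF c(1)] by (auto simp: image_iff) metis
    ultimately have "openin X {x \<in> U. f x \<in> T}" by simp
    moreover have "{x \<in> U. f x \<in> T} \<subseteq> {x \<in> points M. f x \<in> T}"
      using chart_subset[OF c(1)] by blast
    ultimately show "\<exists>B. openin X B \<and> x \<in> B \<and> B \<subseteq> {x \<in> points M. f x \<in> T}"
      using x c(2) by (intro exI[of _ "{x \<in> U. f x \<in> T}"]) simp
  qed
qed simp

lemma smooth_fun_add:
  assumes "smooth_fun M f" "smooth_fun M g"
  shows "smooth_fun M (\<lambda>x. f x + g x)"
  unfolding smooth_fun_def
proof clarify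
  fix U \<phi> assume c: "(U, \<phi>) \<in> atlas M"
  show "smooth_on V (\<phi> ` U) ((\<lambda>x. f x + g x) \<circ> inv_into U \<phi>)"
    using smooth_on_add[OF V chart_image_open[OF c] smooth_funD[OF assms(1) c] smooth_funD[OF assms(2) c]]
    by (simp add: o_def)
qed

lemma smooth_fun_const: "smooth_fun M (\<lambda>x. d)"
  unfolding smooth_fun_def o_def by (auto intro: smooth_on_const)

lemma smooth_fun_sum:
  "(\<And>i. i \<in> I \<Longrightarrow> smooth_fun M (f i)) \<Longrightarrow> smooth_fun M (\<lambda>x. \<Sum>i\<in>I. f i x)"
  by (induction I rule: infinite_finite_induct) (auto intro: smooth_fun_const smooth_fun_add)

lemma chart_cball:
  assumes c: "(U, \<phi>) \<in> atlas M" and S: "openin (top_of_set V) S" "S \<subseteq> \<phi> ` U" and y: "y \<in> S"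
  obtains r where "r > 0" "cball y r \<inter> V \<subseteq> S" "compact (cball y r \<inter> V)"
proof -
  obtain T where T: "open T" "S = V \<inter> T" using S(1) by (auto simp: openin_open)
  then obtain r where "r > 0" "cball y r \<subseteq> T" using y open_contains_cball by blast
  then show thesis
    using that[of r] T compact_Int_closed[OF compact_cball closed_subspace[OF V]] by blast
qed

text \<open>Uniform continuity between a compact set and its neighbours in \<open>W\<close>. The segments along which a shear
  moves the points of its support may leave the support, so that uniform continuity on \<open>K\<close>
  alone would not do.\<close>

lemma uniformly_near_compact:
  fixes G :: "'e \<Rightarrow> 'b::real_normed_vector"
  assumes W: "openin (top_of_set V) W" and G: "continuous_on W G" and K: "compact K" "K \<subseteq> W"
    and e: "e > 0"
  obtains d where "d > 0"
    "\<And>y z. \<lbrakk>y \<in> K; z \<in> V; dist z y < d\<rbrakk> \<Longrightarrow> z \<in> W \<and> norm (G z - G y) \<le> e"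
proof -
  obtain T where T: "open T" "W = V \<inter> T" using W by (auto simp: openin_open)
  have "\<exists>d>0. \<forall>z\<in>V. dist z y < d \<longrightarrow> z \<in> W \<and> dist (G z) (G y) < e / 2" if y: "y \<in> K" for y
  proof -
    obtain d1 where d1: "d1 > 0" "ball y d1 \<subseteq> T" using T y K(2) open_contains_ball by blast
    obtain d2 where d2: "d2 > 0" "\<And>z. \<lbrakk>z \<in> W; dist z y < d2\<rbrakk> \<Longrightarrow> dist (G z) (G y) < e / 2"
      using G[unfolded continuous_on_iff, rule_format, of y "e / 2"] y K(2) e by auto
    have "z \<in> W \<and> dist (G z) (G y) < e / 2" if "z \<in> V" "dist z y < min d1 d2" for z
    proof -
      have "z \<in> T" using d1(2) that by (auto simp: dist_commute)
      then show ?thesis using T that d2 by auto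
    qed
    then show ?thesis using d1(1) d2(1) by (intro exI[of _ "min d1 d2"]) auto
  qed
  then obtain \<delta> where \<delta>: "\<And>y. y \<in> K \<Longrightarrow> \<delta> y > 0"
    "\<And>y z. \<lbrakk>y \<in> K; z \<in> V; dist z y < \<delta> y\<rbrakk> \<Longrightarrow> z \<in> W \<and> dist (G z) (G y) < e / 2"
    by metis
  have "K \<subseteq> \<Union> ((\<lambda>y. ball y (\<delta> y)) ` K)" using \<delta>(1) by auto
  then obtain d where d: "d > 0" "\<And>x. x \<in> K \<Longrightarrow> \<exists>B\<in>(\<lambda>y. ball y (\<delta> y)) ` K. ball x d \<subseteq> B"
    by (rule Heine_Borel_lemma[OF K(1)]) auto
  show thesis
  proof (rule that[OF d(1)])
    fix y z assume yz: "y \<in> K" "z \<in> V" "dist z y < d"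
    then obtain p where p: "p \<in> K" "ball y d \<subseteq> ball p (\<delta> p)" using d(2) by blast
    have "z \<in> ball p (\<delta> p)" using p(2) yz by (auto simp: dist_commute)
    then have z: "z \<in> W \<and> dist (G z) (G p) < e / 2"
      using \<delta>(2)[OF p(1) yz(2)] by (simp add: dist_commute)
    have "y \<in> ball p (\<delta> p)" using p(2) d(1) by (meson centre_in_ball subsetD)
    moreover have "y \<in> V" using yz(1) K(2) T(2) by blast
    ultimately have "dist (G y) (G p) < e / 2" using \<delta>(2)[OF p(1), of y] by (simp add: dist_commute)
    then show "z \<in> W \<and> norm (G z - G y) \<le> e"
      using z dist_triangle_half_l[of "G z" "G p" e "G y"] by (simp add: dist_norm)
  qed
qed

definition chart_deriv :: "'m set \<Rightarrow> ('m \<Rightarrow> 'e) \<Rightarrow> ('m \<Rightarrow> 'b::real_normed_vector) \<Rightarrow> 'e \<Rightarrow> 'm \<Rightarrow> 'b" where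
  "chart_deriv U \<phi> F v x = dir_deriv (F \<circ> inv_into U \<phi>) v (\<phi> x)"

text \<open>The diffeomorphisms \<open>g h\<close> have the vector field \<open>\<Lambda>\<close> as velocity at \<open>h = 0\<close>. Vector fields appear as
  differential operators on functions, which avoids the tangent bundle. The requirement that
  \<open>\<Lambda>\<close> preserves smoothness lets the estimate be applied to \<open>\<Lambda> F\<close> when families are composed.\<close>

definition generates ::
  "(real \<Rightarrow> 'm \<Rightarrow> 'm) \<Rightarrow> (('m \<Rightarrow> 'b::real_normed_vector) \<Rightarrow> 'm \<Rightarrow> 'b) \<Rightarrow> bool" where
  "generates g \<Lambda> \<longleftrightarrow> (\<forall>\<^sub>F h in nhds 0. g h \<in> Diff M) \<and>
    (\<forall>F. smooth_fun M F \<longrightarrow> smooth_fun M (\<Lambda> F) \<and>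
      (\<forall>e>0. \<forall>\<^sub>F h in nhds 0. \<forall>x\<in>points M. norm (F (g h x) - F x - h *\<^sub>R \<Lambda> F x) \<le> \<bar>h\<bar> * e))"

lemma eventually_abs_less: "d > 0 \<Longrightarrow> \<forall>\<^sub>F h::real in nhds 0. \<bar>h\<bar> < d"
  unfolding eventually_nhds_metric by (auto simp: dist_real_def)

text \<open>The shear moves \<open>y\<close> by \<open>h a(y) v\<close>, and the mean value inequality along this short segment is uniform in \<open>y\<close>
  because \<open>a\<close> vanishes outside a compact set.\<close>

lemma chart_lift_generates:
  fixes a :: "'e \<Rightarrow> real"
  assumes c: "(U, \<phi>) \<in> atlas M" and K: "compact K" "K \<subseteq> \<phi> ` U"
    and a: "smooth_on V V a" "\<And>y. y \<in> V - K \<Longrightarrow> a y = 0" and v: "v \<in> V"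
  shows "generates (\<lambda>h. chart_lift U \<phi> (\<lambda>y. y + (h * a y) *\<^sub>R v))
    (\<lambda>F x. if x \<in> U then a (\<phi> x) *\<^sub>R (chart_deriv U \<phi> F v x :: 'b::real_normed_vector) else 0)"
    (is "generates ?g ?\<Lambda>")
proof -
  have VV: "openin (top_of_set V) V" by simp
  have KV: "K \<subseteq> V" using K(2) chart_range[OF c] by blast
  have bounded: "\<exists>B>0. \<forall>y\<in>V. \<bar>u y\<bar> \<le> B"
    if u: "continuous_on V u" "\<And>y. y \<in> V - K \<Longrightarrow> u y = (0::real)" for u
  proof -
    have "compact (u ` K)"
      by (rule compact_continuous_image[OF continuous_on_subset[OF u(1) KV] K(1)])
    then obtain B where B: "B > 0" "\<And>y. y \<in> K \<Longrightarrow> \<bar>u y\<bar> \<le> B"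
      using compact_imp_bounded bounded_pos by (metis imageI real_norm_def)
    have "\<bar>u y\<bar> \<le> B" if "y \<in> V" for y using B u(2) that by (cases "y \<in> K") auto
    then show ?thesis using B(1) by blast
  qed
  obtain A where A: "A > 0" "\<And>y. y \<in> V \<Longrightarrow> \<bar>a y\<bar> \<le> A"
    using bounded[OF smooth_on_imp_continuous_on[OF a(1)] a(2)] by blast
  have "dir_deriv a v y = 0" if y: "y \<in> V - K" for y
  proof (rule dir_deriv_eq)
    have "openin (top_of_set V) (V - K)"
      using compact_imp_closed[OF K(1)] by (auto simp: openin_open Diff_eq intro: exI[of _ "- K"])
    then show "has_dir_deriv a v 0 y"
      by (rule has_dir_deriv_cong[OF V _ y v, where f = "\<lambda>y. 0"]) (use a(2) in auto)
  qed
  from bounded[OF smooth_on_imp_continuous_on[OF smooth_on_dir_deriv[OF a(1) v]] this]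
  obtain B where B: "B > 0" "\<And>y. y \<in> V \<Longrightarrow> \<bar>dir_deriv a v y\<bar> \<le> B" by blast
  have Diff: "?g h \<in> Diff M \<and> (\<lambda>y. y + (h * a y) *\<^sub>R v) ` (\<phi> ` U) \<subseteq> \<phi> ` U"
    if h: "\<bar>h\<bar> < 1 / (2 * B)" for h
  proof -
    have sm: "smooth_on V V (\<lambda>y. h * a y)"
      using smooth_on_scaleR[OF V VV smooth_on_const a(1)] by simp
    have dd: "dir_deriv (\<lambda>y. h * a y) v y = h * dir_deriv a v y" if "y \<in> V" for y
      by (rule dir_deriv_eq)
        (use smooth_on_has_dir_deriv[OF a(1) v that] in \<open>auto intro!: derivative_eq_intros\<close>)
    have "\<bar>dir_deriv (\<lambda>y. h * a y) v y\<bar> \<le> 1 / 2" if y: "y \<in> V" for y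
    proof -
      have "\<bar>h\<bar> * \<bar>dir_deriv a v y\<bar> \<le> 1 / (2 * B) * B"
        using h B(2)[OF y] by (intro mult_mono) auto
      then show ?thesis using dd[OF y] B(1) by (simp add: abs_mult)
    qed
    moreover have "\<bar>h * a y\<bar> \<le> \<bar>h\<bar> * A" if "y \<in> V" for y
      using A(2)[OF that] by (simp add: abs_mult mult_left_mono)
    ultimately show ?thesis
      using chart_lift_shear_Diff[OF c K sm _ v, of "\<bar>h\<bar> * A"] a(2) by simp
  qed
  have evB: "\<forall>\<^sub>F h in nhds 0. \<bar>h\<bar> < 1 / (2 * B)" using B(1) by (intro eventually_abs_less) simp
  show ?thesis
    unfolding generates_def
  proof (intro conjI allI impI)
    show "\<forall>\<^sub>F h in nhds 0. ?g h \<in> Diff M"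
      using evB by eventually_elim (use Diff in blast)
  next
    fix F :: "'m \<Rightarrow> 'b" assume F: "smooth_fun M F"
    let ?F = "F \<circ> inv_into U \<phi>"
    have Fs: "smooth_on V (\<phi> ` U) ?F" by (rule smooth_funD[OF F c])
    have "smooth_on V (\<phi> ` U) (\<lambda>y. a y *\<^sub>R dir_deriv ?F v y)"
      by (rule smooth_on_scaleR[OF V chart_image_open[OF c]
            smooth_on_subset[OF a(1) chart_range[OF c]] smooth_on_dir_deriv[OF Fs v]])
    from chart_supported_smooth_fun[OF c K this] a(2) chart_range[OF c]
    show "smooth_fun M (?\<Lambda> F)"
      unfolding chart_deriv_def by (simp add: subset_iff)
  next
    fix F :: "'m \<Rightarrow> 'b" and e :: real assume F: "smooth_fun M F" and e: "e > 0"
    let ?F = "F \<circ> inv_into U \<phi>"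
    have Fs: "smooth_on V (\<phi> ` U) ?F" by (rule smooth_funD[OF F c])
    have cont: "continuous_on (\<phi> ` U) (dir_deriv ?F v)"
      by (rule smooth_on_imp_continuous_on[OF smooth_on_dir_deriv[OF Fs v]])
    have "e / A > 0" using e A by simp
    then obtain d where d: "d > 0" "\<And>y z. \<lbrakk>y \<in> K; z \<in> V; dist z y < d\<rbrakk> \<Longrightarrow>
        z \<in> \<phi> ` U \<and> norm (dir_deriv ?F v z - dir_deriv ?F v y) \<le> e / A"
      using uniformly_near_compact[OF chart_image_open[OF c] cont K] by blast
    define r where "r = d / (A * (norm v + 1))"
    have r: "r > 0" using d A by (simp add: r_def add_nonneg_pos)
    have bound: "norm (F (?g h x) - F x - h *\<^sub>R ?\<Lambda> F x) \<le> \<bar>h\<bar> * e"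
      if h: "\<bar>h\<bar> < 1 / (2 * B)" "\<bar>h\<bar> < r" and x: "x \<in> points M" for h x
    proof (cases "x \<in> U \<and> \<phi> x \<in> K")
      case True
      define y where "y = \<phi> x"
      define k where "k = h * a y"
      have y: "y \<in> K" "y \<in> V" "y \<in> \<phi> ` U" using True KV by (auto simp: y_def)
      have k: "\<bar>k\<bar> \<le> \<bar>h\<bar> * A" using A(2)[OF y(2)] by (simp add: k_def abs_mult mult_left_mono)
      have near: "y + \<tau> *\<^sub>R k *\<^sub>R v \<in> \<phi> ` U \<and>
          norm (dir_deriv ?F v (y + \<tau> *\<^sub>R k *\<^sub>R v) - dir_deriv ?F v y) \<le> e / A"
        if \<tau>: "0 \<le> \<tau>" "\<tau> \<le> 1" for \<tau>
      proof (rule d(2)[OF y(1)])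
        show "y + \<tau> *\<^sub>R k *\<^sub>R v \<in> V" using V y(2) v by (simp add: subspace_add subspace_scale)
        have "dist (y + \<tau> *\<^sub>R k *\<^sub>R v) y = \<tau> * (\<bar>k\<bar> * norm v)"
          using \<tau> by (simp add: dist_norm abs_mult)
        also have "\<dots> \<le> 1 * (\<bar>k\<bar> * norm v)" using \<tau> by (intro mult_right_mono) auto
        also have "\<dots> \<le> (\<bar>h\<bar> * A) * (norm v + 1)" using k by (simp add: mult_mono)
        also have "\<dots> = \<bar>h\<bar> * (A * (norm v + 1))" by simp
        also have "\<dots> < r * (A * (norm v + 1))"
          using h(2) A by (intro mult_strict_right_mono) (auto intro!: mult_pos_pos add_nonneg_pos)
        also have "\<dots> = d"
        proof -
          have "A * (norm v + 1) > 0" using A(1) by (intro mult_pos_pos add_nonneg_pos) auto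
          then have "A * (norm v + 1) \<noteq> 0" by linarith
          then show ?thesis unfolding r_def
            by (simp only: times_divide_eq_left nonzero_mult_div_cancel_right not_False_eq_True)
        qed
        finally show "dist (y + \<tau> *\<^sub>R k *\<^sub>R v) y < d" .
      qed
      have "norm (?F (y + k *\<^sub>R v) - ?F y - k *\<^sub>R dir_deriv ?F v y) \<le> \<bar>k\<bar> * (e / A)"
      proof (rule segment_linearization_bound)
        fix \<tau> :: real assume \<tau>: "0 \<le> \<tau>" "\<tau> \<le> 1"
        show "has_dir_deriv ?F v (dir_deriv ?F v (y + \<tau> *\<^sub>R k *\<^sub>R v)) (y + \<tau> *\<^sub>R k *\<^sub>R v)"
          using near[OF \<tau>] by (intro smooth_on_has_dir_deriv[OF Fs v]) blast
      qed (use near in blast)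
      also have "\<dots> \<le> (\<bar>h\<bar> * A) * (e / A)" using k e A by (intro mult_right_mono) auto
      also have "\<dots> = \<bar>h\<bar> * e" using A by simp
      finally have bound: "norm (?F (y + k *\<^sub>R v) - ?F y - k *\<^sub>R dir_deriv ?F v y) \<le> \<bar>h\<bar> * e" .
      have "?F y = F x" using True chart_inv[OF c] by (simp add: y_def)
      moreover have "?F (y + k *\<^sub>R v) = F (?g h x)"
        using True by (simp add: chart_lift_def y_def k_def)
      moreover have "k *\<^sub>R dir_deriv ?F v y = h *\<^sub>R ?\<Lambda> F x"
        using True by (simp add: chart_deriv_def y_def k_def)
      ultimately show ?thesis using bound by simp
    next
      case False
      then have z: "x \<notin> U \<or> x \<in> U \<and> a (\<phi> x) = 0" using a(2) chart_range[OF c] by blast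
      then have "?\<Lambda> F x = 0" "?g h x = x" using chart_inv[OF c] by (auto simp: chart_lift_def)
      then show ?thesis using e by simp
    qed
    from evB eventually_abs_less[OF r]
    show "\<forall>\<^sub>F h in nhds 0. \<forall>x\<in>points M. norm (F (?g h x) - F x - h *\<^sub>R ?\<Lambda> F x) \<le> \<bar>h\<bar> * e"
      by eventually_elim (use bound in blast)
  qed
qed

end

locale compact_mfd = smooth_mfd +
  assumes compact: "compact_space X"
begin

lemma smooth_fun_bounded:
  fixes f :: "'a \<Rightarrow> 'c::real_normed_vector"
  assumes "smooth_fun M f"
  obtains B where "B > 0" "\<And>x. x \<in> points M \<Longrightarrow> norm (f x) \<le> B"
proof -
  have "compactin euclidean (f ` points M)"
    using image_compactin smooth_fun_continuous[OF assms] compact unfolding compact_space_def by blast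
  then have "compact (f ` points M)" by simp
  then show thesis using that compact_imp_bounded bounded_pos by (metis imageI)
qed

lemma generates_uniform:
  fixes F :: "'a \<Rightarrow> 'c::real_normed_vector" and \<Lambda> :: "('a \<Rightarrow> 'c) \<Rightarrow> 'a \<Rightarrow> 'c"
  assumes g: "generates g \<Lambda>" and F: "smooth_fun M F" and e: "e > 0"
  shows "\<forall>\<^sub>F h in nhds 0. \<forall>x\<in>points M. norm (F (g h x) - F x) \<le> e"
proof -
  have "smooth_fun M (\<Lambda> F)" using g F by (auto simp: generates_def)
  then obtain B where B: "B > 0" "\<And>x. x \<in> points M \<Longrightarrow> norm (\<Lambda> F x) \<le> B"
    using smooth_fun_bounded by metis
  have "\<forall>\<^sub>F h in nhds 0. \<forall>x\<in>points M. norm (F (g h x) - F x - h *\<^sub>R \<Lambda> F x) \<le> \<bar>h\<bar> * 1"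
    using g F unfolding generates_def by (meson zero_less_one)
  moreover have "\<forall>\<^sub>F h::real in nhds 0. \<bar>h\<bar> < e / (B + 1)"
    using e B by (intro eventually_abs_less) simp
  ultimately show ?thesis
  proof eventually_elim
    case (elim h)
    show ?case
    proof
      fix x assume x: "x \<in> points M"
      have "norm (F (g h x) - F x) \<le> norm (F (g h x) - F x - h *\<^sub>R \<Lambda> F x) + norm (h *\<^sub>R \<Lambda> F x)"
        using norm_triangle_ineq[of "F (g h x) - F x - h *\<^sub>R \<Lambda> F x" "h *\<^sub>R \<Lambda> F x"] by simp
      also have "\<dots> \<le> \<bar>h\<bar> * 1 + \<bar>h\<bar> * B"
        using elim(1) x B(2)[OF x] by (intro add_mono) (auto intro: mult_left_mono)
      also have "\<dots> = \<bar>h\<bar> * (B + 1)" by (simp add: algebra_simps)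
      also have "\<dots> \<le> e" using elim(2) B(1) by (simp add: pos_less_divide_eq less_imp_le)
      finally show "norm (F (g h x) - F x) \<le> e" .
    qed
  qed
qed

lemma generates_id: "generates (\<lambda>h x. x) (\<lambda>F x. 0)"
  unfolding generates_def using Diff_id smooth_fun_const by auto

text \<open>The operators add up to first order, since \<open>\<Lambda> F\<close> itself changes little under the second
  family.\<close>

lemma generates_compose:
  fixes \<Lambda> :: "('a \<Rightarrow> 'c::real_normed_vector) \<Rightarrow> 'a \<Rightarrow> 'c"
  assumes g: "generates g \<Lambda>" and k: "generates k \<Lambda>'"
  shows "generates (\<lambda>h. g h \<circ> k h) (\<lambda>F x. \<Lambda> F x + \<Lambda>' F x)"
  unfolding generates_def
proof (intro conjI allI impI)
  have "\<forall>\<^sub>F h in nhds 0. g h \<in> Diff M" "\<forall>\<^sub>F h in nhds 0. k h \<in> Diff M"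
    using g k by (auto simp: generates_def)
  then show "\<forall>\<^sub>F h in nhds 0. g h \<circ> k h \<in> Diff M"
    by eventually_elim (rule Diff_compose)
next
  fix F :: "'a \<Rightarrow> 'c" assume F: "smooth_fun M F"
  then show "smooth_fun M (\<lambda>x. \<Lambda> F x + \<Lambda>' F x)"
    using g k by (intro smooth_fun_add) (auto simp: generates_def)
next
  fix F :: "'a \<Rightarrow> 'c" and e :: real assume F: "smooth_fun M F" and e: "e > 0"
  have e3: "e / 3 > 0" using e by simp
  have LF: "smooth_fun M (\<Lambda> F)" using g F by (auto simp: generates_def)
  have "\<forall>\<^sub>F h in nhds 0. \<forall>x\<in>points M. norm (F (g h x) - F x - h *\<^sub>R \<Lambda> F x) \<le> \<bar>h\<bar> * (e / 3)"
    "\<forall>\<^sub>F h in nhds 0. \<forall>x\<in>points M. norm (F (k h x) - F x - h *\<^sub>R \<Lambda>' F x) \<le> \<bar>h\<bar> * (e / 3)"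
    "\<forall>\<^sub>F h in nhds 0. k h \<in> Diff M"
    using g k F e3 unfolding generates_def by blast+
  with generates_uniform[OF k LF e3]
  show "\<forall>\<^sub>F h in nhds 0. \<forall>x\<in>points M.
      norm (F ((g h \<circ> k h) x) - F x - h *\<^sub>R (\<Lambda> F x + \<Lambda>' F x)) \<le> \<bar>h\<bar> * e"
  proof eventually_elim
    case (elim h)
    show ?case
    proof
      fix x assume x: "x \<in> points M"
      let ?y = "k h x"
      have y: "?y \<in> points M" by (rule Diff_points[OF elim(4) x])
      have "F ((g h \<circ> k h) x) - F x - h *\<^sub>R (\<Lambda> F x + \<Lambda>' F x) =
          (F (g h ?y) - F ?y - h *\<^sub>R \<Lambda> F ?y) + (F ?y - F x - h *\<^sub>R \<Lambda>' F x) + h *\<^sub>R (\<Lambda> F ?y - \<Lambda> F x)"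
        by (simp add: algebra_simps)
      also have "norm \<dots> \<le> \<bar>h\<bar> * (e / 3) + \<bar>h\<bar> * (e / 3) + \<bar>h\<bar> * (e / 3)"
      proof (intro norm_triangle_mono)
        show "norm (h *\<^sub>R (\<Lambda> F ?y - \<Lambda> F x)) \<le> \<bar>h\<bar> * (e / 3)"
          unfolding norm_scaleR using elim(1) x by (intro mult_left_mono) auto
      qed (use elim x y in blast)+
      also have "\<dots> = \<bar>h\<bar> * e" by simp
      finally show "norm (F ((g h \<circ> k h) x) - F x - h *\<^sub>R (\<Lambda> F x + \<Lambda>' F x)) \<le> \<bar>h\<bar> * e" .
    qed
  qed
qed

lemma generates_sum:
  fixes \<Lambda> :: "'i \<Rightarrow> ('a \<Rightarrow> 'c::real_normed_vector) \<Rightarrow> 'a \<Rightarrow> 'c"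
  assumes "finite I" "\<And>i. i \<in> I \<Longrightarrow> generates (g i) (\<Lambda> i)"
  shows "\<exists>k. generates k (\<lambda>F x. \<Sum>i\<in>I. \<Lambda> i F x)"
  using assms
proof (induction I rule: finite_induct)
  case empty
  then show ?case using generates_id by auto
next
  case (insert i I)
  then obtain k where "generates k (\<lambda>F x. \<Sum>i\<in>I. \<Lambda> i F x)" by blast
  from generates_compose[OF insert.prems this] insert.hyps
  show ?case by auto
qed

end

context compact_mfd
begin

lemma finite_cover:
  assumes "\<And>x. x \<in> points M \<Longrightarrow> openin X (B x) \<and> x \<in> B x"
  obtains I where "finite I" "I \<subseteq> points M" "points M \<subseteq> (\<Union>x\<in>I. B x)"
proof -
  have "\<exists>\<F>. finite \<F> \<and> \<F> \<subseteq> B ` points M \<and> points M \<subseteq> \<Union>\<F>"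
  proof -
    have *: "\<forall>\<U>. (\<forall>U\<in>\<U>. openin X U) \<and> points M \<subseteq> \<Union>\<U> \<longrightarrow>
        (\<exists>\<F>. finite \<F> \<and> \<F> \<subseteq> \<U> \<and> points M \<subseteq> \<Union>\<F>)"
      using compact unfolding compact_space_def compactin_def by (elim conjE)
    show ?thesis by (rule *[rule_format]) (use assms in auto)
  qed
  then obtain \<F> where F: "finite \<F>" "\<F> \<subseteq> B ` points M" "points M \<subseteq> \<Union>\<F>" by blast
  from finite_subset_image[OF F(1,2)] obtain I where "I \<subseteq> points M" "finite I" "\<F> = B ` I" by blast
  then show thesis using that F(3) by simp
qed

text \<open>Finitely many compact coordinate balls cover \<open>M\<close>.\<close>

lemma Cinf_limit_uniform:
  fixes h :: "'s \<Rightarrow> 'a \<Rightarrow> real ^ 'n"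
  assumes "Cinf_limit M h l \<F>"
  shows "uniform_limit (points M) h l \<F>"
proof -
  have "\<exists>B. openin X B \<and> x \<in> B \<and> uniform_limit B h l \<F>" if x: "x \<in> points M" for x
  proof -
    obtain U \<phi> where c: "(U, \<phi>) \<in> atlas M" "x \<in> U" using chart_at[OF x] by blast
    obtain r where r: "r > 0" "cball (\<phi> x) r \<inter> V \<subseteq> \<phi> ` U" "compact (cball (\<phi> x) r \<inter> V)"
      using chart_cball[OF c(1) chart_image_open[OF c(1)] subset_refl, of "\<phi> x"] c(2) by blast
    have "uniform_limit (cball (\<phi> x) r \<inter> V) (\<lambda>s. iter_deriv (h s \<circ> inv_into U \<phi>) [])
        (iter_deriv (l \<circ> inv_into U \<phi>) []) \<F>"
      by (rule Cinf_limitD[OF assms c(1) r(3,2)]) simp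
    then have u: "uniform_limit (cball (\<phi> x) r \<inter> V) (\<lambda>s. h s \<circ> inv_into U \<phi>) (l \<circ> inv_into U \<phi>) \<F>"
      by simp
    define B where "B = {z \<in> U. \<phi> z \<in> V \<inter> ball (\<phi> x) r}"
    have "openin X B"
      unfolding B_def by (rule chart_open_vimage[OF c(1)]) (simp add: openin_open_Int)
    moreover have "x \<in> B" using c chart_range[OF c(1)] r(1) by (auto simp: B_def)
    moreover have "uniform_limit B h l \<F>"
      unfolding uniform_limit_iff
    proof (intro allI impI)
      fix e :: real assume "e > 0"
      with u have "\<forall>\<^sub>F s in \<F>. \<forall>y\<in>cball (\<phi> x) r \<inter> V. dist ((h s \<circ> inv_into U \<phi>) y) ((l \<circ> inv_into U \<phi>) y) < e"
        unfolding uniform_limit_iff by blast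
      then show "\<forall>\<^sub>F s in \<F>. \<forall>z\<in>B. dist (h s z) (l z) < e"
      proof eventually_elim
        case (elim s)
        show ?case
        proof
          fix z assume z: "z \<in> B"
          then have "\<phi> z \<in> cball (\<phi> x) r \<inter> V" "z \<in> U" by (auto simp: B_def)
          then show "dist (h s z) (l z) < e"
            using bspec[OF elim, of "\<phi> z"] chart_inv[OF c(1), of z] by simp
        qed
      qed
    qed
    ultimately show ?thesis by blast
  qed
  then obtain B where B: "\<And>x. x \<in> points M \<Longrightarrow> openin X (B x) \<and> x \<in> B x"
    "\<And>x. x \<in> points M \<Longrightarrow> uniform_limit (B x) h l \<F>" by metis
  obtain I where I: "finite I" "I \<subseteq> points M" "points M \<subseteq> (\<Union>x\<in>I. B x)"
    using finite_cover[OF B(1)] by blast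
  show ?thesis
    unfolding uniform_limit_iff
  proof (intro allI impI)
    fix e :: real assume "e > 0"
    then have "\<forall>x\<in>I. \<forall>\<^sub>F s in \<F>. \<forall>z\<in>B x. dist (h s z) (l z) < e"
      using B(2) I(2) unfolding uniform_limit_iff by blast
    then have "\<forall>\<^sub>F s in \<F>. \<forall>x\<in>I. \<forall>z\<in>B x. dist (h s z) (l z) < e"
      using I(1) by (simp add: eventually_ball_finite_distrib)
    then show "\<forall>\<^sub>F s in \<F>. \<forall>z\<in>points M. dist (h s z) (l z) < e"
      by eventually_elim (use I(3) in blast)
  qed
qed

text \<open>Near each point the operator is the derivative in one fixed direction \<open>v\<close> of one chart; the bound persists
  in a neighbourhood up to \<open>e\<close>. With the weights \<open>\<rho>\<^sub>x / \<sigma>\<close> of a partition of unity, the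
  difference between \<open>H\<close> and the averaged operator is a convex combination of the local differences
  and obeys the same bound.\<close>

lemma approximating_generator:
  fixes F H :: "'a \<Rightarrow> 'c::real_normed_vector"
  assumes F: "smooth_fun M F" and H: "smooth_fun M H" and e: "e > 0"
    and pointwise: "\<And>x. x \<in> points M \<Longrightarrow> \<exists>U \<phi> v. (U, \<phi>) \<in> atlas M \<and> x \<in> U \<and> v \<in> V \<and>
      norm (H x - chart_deriv U \<phi> F v x) \<le> c"
  shows "\<exists>g \<Lambda>. generates g \<Lambda> \<and> (\<forall>x\<in>points M. norm (H x - \<Lambda> F x) \<le> c + e)"
proof -
  define good where "good x = (\<lambda>(U, \<phi>, v, r). (U, \<phi>) \<in> atlas M \<and> x \<in> U \<and> v \<in> V \<and> r > 0 \<and>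
      cball (\<phi> x) r \<inter> V \<subseteq> \<phi> ` U \<and> compact (cball (\<phi> x) r \<inter> V) \<and>
      (\<forall>z\<in>U. \<phi> z \<in> cball (\<phi> x) r \<longrightarrow> norm (H z - chart_deriv U \<phi> F v z) \<le> c + e))" for x
  have "\<exists>q. good x q"
    if x: "x \<in> points M" for x
  proof -
    obtain U \<phi> v where c: "(U, \<phi>) \<in> atlas M" "x \<in> U" "v \<in> V" "norm (H x - chart_deriv U \<phi> F v x) \<le> c"
      using pointwise[OF x] by blast
    define E where "E y = norm ((H \<circ> inv_into U \<phi>) y - dir_deriv (F \<circ> inv_into U \<phi>) v y)" for y
    have "continuous_on (\<phi> ` U) E"
      unfolding E_def
      by (intro continuous_on_norm continuous_on_diff
          smooth_on_imp_continuous_on[OF smooth_funD[OF H c(1)]]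
          smooth_on_imp_continuous_on[OF smooth_on_dir_deriv[OF smooth_funD[OF F c(1)] c(3)]])
    then have "openin (top_of_set (\<phi> ` U)) (\<phi> ` U \<inter> E -` {..<c + e})"
      by (rule continuous_openin_preimage_gen) simp
    then have S: "openin (top_of_set V) (\<phi> ` U \<inter> E -` {..<c + e})"
      by (rule openin_trans[OF _ chart_image_open[OF c(1)]])
    have "E (\<phi> x) \<le> c" using c(2,4) chart_inv[OF c(1)] by (simp add: E_def chart_deriv_def)
    then have "\<phi> x \<in> \<phi> ` U \<inter> E -` {..<c + e}" using c(2) e by simp
    then obtain r where r: "r > 0" "cball (\<phi> x) r \<inter> V \<subseteq> \<phi> ` U \<inter> E -` {..<c + e}"
        "compact (cball (\<phi> x) r \<inter> V)"
      using chart_cball[OF c(1) S] by blast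
    have "norm (H z - chart_deriv U \<phi> F v z) \<le> c + e" if "z \<in> U" "\<phi> z \<in> cball (\<phi> x) r" for z
    proof -
      have "\<phi> z \<in> cball (\<phi> x) r \<inter> V" using that chart_range[OF c(1)] by blast
      then have "E (\<phi> z) < c + e" using r(2) by auto
      then show ?thesis using chart_inv[OF c(1) that(1)] by (simp add: E_def chart_deriv_def)
    qed
    then have "good x (U, \<phi>, v, r)" unfolding good_def using c r by simp
    then show ?thesis by blast
  qed
  then obtain q where q: "\<And>x. x \<in> points M \<Longrightarrow> good x (q x)" by metis
  define U \<phi> v r where "U x = fst (q x)" and "\<phi> x = fst (snd (q x))"
    and "v x = fst (snd (snd (q x)))" and "r x = snd (snd (snd (q x)))" for x
  have loc: "good x (U x, \<phi> x, v x, r x)" if "x \<in> points M" for x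
    using q[OF that] by (simp add: U_def \<phi>_def v_def r_def)
  have
    c: "\<And>x. x \<in> points M \<Longrightarrow> (U x, \<phi> x) \<in> atlas M" "\<And>x. x \<in> points M \<Longrightarrow> x \<in> U x"
      "\<And>x. x \<in> points M \<Longrightarrow> v x \<in> V" and
    r: "\<And>x. x \<in> points M \<Longrightarrow> r x > 0" and
    K: "\<And>x. x \<in> points M \<Longrightarrow> compact (cball (\<phi> x x) (r x) \<inter> V)"
      "\<And>x. x \<in> points M \<Longrightarrow> cball (\<phi> x x) (r x) \<inter> V \<subseteq> \<phi> x ` U x" and
    bound: "\<And>x z. \<lbrakk>x \<in> points M; z \<in> U x; \<phi> x z \<in> cball (\<phi> x x) (r x)\<rbrakk> \<Longrightarrow>
      norm (H z - chart_deriv (U x) (\<phi> x) F (v x) z) \<le> c + e"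
    using loc unfolding good_def by simp_all
  define \<rho> where "\<rho> x z = (if z \<in> U x then bump (\<phi> x x) (r x) (\<phi> x z) else 0)" for x z
  have \<rho>_smooth: "smooth_fun M (\<rho> x)" if x: "x \<in> points M" for x
    unfolding \<rho>_def[abs_def]
  proof (rule chart_supported_smooth_fun[OF c(1)[OF x] K[OF x]])
    show "smooth_on V (\<phi> x ` U x) (bump (\<phi> x x) (r x))"
      by (rule smooth_on_bump[OF V chart_image_open[OF c(1)[OF x]]])
    show "bump (\<phi> x x) (r x) y = 0" if "y \<in> \<phi> x ` U x - cball (\<phi> x x) (r x) \<inter> V" for y
      using that chart_range[OF c(1)[OF x]] by (intro bump_zero[OF r[OF x]]) auto
  qed
  have \<rho>_nonneg: "\<rho> x z \<ge> 0" for x z by (simp add: \<rho>_def bump_nonneg)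
  define B where "B x = {z \<in> U x. \<phi> x z \<in> V \<inter> ball (\<phi> x x) (r x)}" for x
  have B_open: "openin X (B x) \<and> x \<in> B x" if x: "x \<in> points M" for x
  proof
    show "openin X (B x)"
      unfolding B_def by (rule chart_open_vimage[OF c(1)[OF x]]) (simp add: openin_open_Int)
    have "\<phi> x x \<in> V" using c(2)[OF x] chart_range[OF c(1)[OF x]] by blast
    then show "x \<in> B x" using c(2)[OF x] r[OF x] by (simp add: B_def)
  qed
  obtain I where I: "finite I" "I \<subseteq> points M" "points M \<subseteq> (\<Union>x\<in>I. B x)"
    by (rule finite_cover[OF B_open])
  define \<sigma> where "\<sigma> z = (\<Sum>x\<in>I. \<rho> x z)" for z
  have \<sigma>_smooth: "smooth_fun M \<sigma>"
    unfolding \<sigma>_def by (rule smooth_fun_sum) (use \<rho>_smooth I(2) in blast)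
  have \<sigma>_pos: "\<sigma> z > 0" if z: "z \<in> points M" for z
  proof -
    obtain x where "x \<in> I" "z \<in> B x" using I(3) z by blast
    then have x: "x \<in> I" "z \<in> U x" "\<phi> x z \<in> ball (\<phi> x x) (r x)" by (simp_all add: B_def)
    have "r x > 0" using x(1) I(2) r by blast
    then have "\<rho> x z > 0" using x(2,3) by (simp only: \<rho>_def bump_pos_iff if_True)
    then show ?thesis unfolding \<sigma>_def using I(1) x(1) \<rho>_nonneg by (intro sum_pos2) auto
  qed
  \<comment> \<open>The weight \<open>\<rho>\<^sub>x / \<sigma>\<close> in coordinates, as required for a shear.\<close>
  define a where "a x y = (if y \<in> \<phi> x ` U x
    then bump (\<phi> x x) (r x) y * inverse (\<sigma> (inv_into (U x) (\<phi> x) y)) else 0)" for x y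
  have a_zero: "a x y = 0" if x: "x \<in> points M" and y: "y \<in> V - cball (\<phi> x x) (r x) \<inter> V" for x y
    using bump_zero[OF r[OF x], of y "\<phi> x x"] y by (auto simp: a_def)
  have a_smooth: "smooth_on V V (a x)" if x: "x \<in> points M" for x
  proof (rule smooth_on_local)
    note cx = c(1)[OF x] and op = chart_image_open[OF c(1)[OF x]]
    fix y assume y: "y \<in> V"
    show "\<exists>T. y \<in> T \<and> openin (top_of_set V) T \<and> smooth_on V T (a x)"
    proof (cases "y \<in> \<phi> x ` U x")
      case True
      have inv: "smooth_on V (\<phi> x ` U x) (\<lambda>y. inverse ((\<sigma> \<circ> inv_into (U x) (\<phi> x)) y))"
      proof (rule smooth_on_inverse[OF V op smooth_funD[OF \<sigma>_smooth cx]])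
        show "(\<sigma> \<circ> inv_into (U x) (\<phi> x)) y \<noteq> 0" if "y \<in> \<phi> x ` U x" for y
          using \<sigma>_pos[of "inv_into (U x) (\<phi> x) y"] inv_into_into[OF that] chart_subset[OF cx] by auto
      qed
      have "smooth_on V (\<phi> x ` U x) (\<lambda>y. bump (\<phi> x x) (r x) y *\<^sub>R inverse ((\<sigma> \<circ> inv_into (U x) (\<phi> x)) y))"
        by (rule smooth_on_scaleR[OF V op smooth_on_bump[OF V op] inv])
      then have "smooth_on V (\<phi> x ` U x) (a x)"
        by (rule smooth_on_cong[OF V op]) (simp add: a_def)
      then show ?thesis using True op by (intro exI[of _ "\<phi> x ` U x"] conjI)
    next
      case False
      let ?T = "V - cball (\<phi> x x) (r x) \<inter> V"
      have "?T = V \<inter> - cball (\<phi> x x) (r x)" by blast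
      then have T: "openin (top_of_set V) ?T" by (simp add: openin_open_Int open_Compl)
      have "smooth_on V ?T (a x)"
        by (rule smooth_on_cong[OF V T smooth_on_const[of V _ 0]]) (use a_zero[OF x] in simp)
      moreover have "y \<in> ?T" using False y K(2)[OF x] by blast
      ultimately show ?thesis using T by (intro exI[of _ ?T] conjI)
    qed
  qed
  define \<Lambda> where "\<Lambda> x F z = (if z \<in> U x then a x (\<phi> x z) *\<^sub>R chart_deriv (U x) (\<phi> x) F (v x) z else 0)"
    for x z and F :: "'a \<Rightarrow> 'c"
  have gen: "generates (\<lambda>h. chart_lift (U x) (\<phi> x) (\<lambda>y. y + (h * a x y) *\<^sub>R v x)) (\<Lambda> x)" if "x \<in> I" for x
    unfolding \<Lambda>_def[abs_def]
    by (rule chart_lift_generates[OF c(1) K a_smooth a_zero c(3)]) (use that I(2) in auto)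
  have "\<exists>g. generates g (\<lambda>F z. \<Sum>x\<in>I. \<Lambda> x F z)"
    by (rule generates_sum[OF I(1)]) (rule gen)
  then obtain g where g: "generates g (\<lambda>F z. \<Sum>x\<in>I. \<Lambda> x F z)" ..
  have "norm (H z - (\<Sum>x\<in>I. \<Lambda> x F z)) \<le> c + e" if z: "z \<in> points M" for z
  proof -
    define w where "w x = \<rho> x z / \<sigma> z" for x
    have w1: "(\<Sum>x\<in>I. w x) = 1"
      using \<sigma>_pos[OF z] by (simp add: w_def sum_divide_distrib[symmetric] \<sigma>_def[symmetric])
    have w0: "w x \<ge> 0" for x using \<rho>_nonneg \<sigma>_pos[OF z] by (simp add: w_def)
    have summand: "norm (w x *\<^sub>R H z - \<Lambda> x F z) \<le> w x * (c + e)" if "x \<in> I" for x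
    proof (cases "z \<in> U x \<and> \<phi> x z \<in> cball (\<phi> x x) (r x)")
      case True
      have x: "x \<in> points M" using that I(2) by blast
      have "a x (\<phi> x z) = w x"
        using True chart_inv[OF c(1)[OF x]] by (simp add: a_def w_def \<rho>_def divide_inverse)
      then have "w x *\<^sub>R H z - \<Lambda> x F z = w x *\<^sub>R (H z - chart_deriv (U x) (\<phi> x) F (v x) z)"
        using True by (simp add: \<Lambda>_def scaleR_diff_right)
      then show ?thesis using bound[OF x] True w0 by (simp add: mult_left_mono)
    next
      case False
      have x: "x \<in> points M" using that I(2) by blast
      have "\<rho> x z = 0" using False bump_zero[OF r[OF x], of "\<phi> x z" "\<phi> x x"] by (auto simp: \<rho>_def)
      then have "w x = 0" by (simp add: w_def)
      moreover have "\<Lambda> x F z = 0"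
        using False a_zero[OF x, of "\<phi> x z"] chart_range[OF c(1)[OF x]] by (auto simp: \<Lambda>_def)
      ultimately show ?thesis by simp
    qed
    have "H z - (\<Sum>x\<in>I. \<Lambda> x F z) = (\<Sum>x\<in>I. w x *\<^sub>R H z - \<Lambda> x F z)"
      by (simp add: sum_subtractf scaleR_left.sum[symmetric] w1)
    also have "norm \<dots> \<le> (\<Sum>x\<in>I. w x * (c + e))" by (rule sum_norm_le) (rule summand)
    also have "\<dots> = c + e" by (simp add: sum_distrib_right[symmetric] w1)
    finally show ?thesis .
  qed
  then show ?thesis using g by blast
qed

section \<open>A curve of immersions moves its shape at normal speed\<close>

text \<open>With \<open>h = -(s - t)\<close> the reparametrisation \<open>g h\<close> cancels the tangential part of the displacement:
  \<open>f\<^sub>s \<circ> g h - f\<^sub>t = (s - t) (H - \<Lambda> f\<^sub>t) + o(s - t)\<close>, where \<open>\<Lambda> f\<^sub>t\<close> approximates the tangential part of \<open>H\<close>.\<close>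

lemma near_along_curve:
  fixes f :: "real \<Rightarrow> 'a \<Rightarrow> real ^ 'n"
  assumes F: "smooth_fun M (f t)" and H: "smooth_fun M H" and e: "e > 0"
    and lim: "Cinf_limit M (\<lambda>s x. (f s x - f t x) /\<^sub>R (s - t)) H (at t within S)"
    and pointwise: "\<And>x. x \<in> points M \<Longrightarrow> \<exists>U \<phi> v. (U, \<phi>) \<in> atlas M \<and> x \<in> U \<and> v \<in> V \<and>
      norm (H x - chart_deriv U \<phi> (f t) v x) \<le> c"
  shows "\<forall>\<^sub>F s in at t within S. near (f s) (f t) (ennreal (\<bar>s - t\<bar> * (c + e)))"
proof -
  have e4: "e / 4 > 0" using e by simp
  obtain g \<Lambda> where g: "generates g \<Lambda>" "\<And>x. x \<in> points M \<Longrightarrow> norm (H x - \<Lambda> (f t) x) \<le> c + e / 4"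
    using approximating_generator[OF F H e4 pointwise] by blast
  have tends: "filterlim (\<lambda>s. - (s - t)) (nhds 0) (at t within S)"
  proof -
    have "((\<lambda>s. - (s - t)) \<longlongrightarrow> - (t - t)) (at t within S)" by (intro tendsto_intros)
    then show ?thesis by simp
  qed
  have "\<forall>\<^sub>F h in nhds 0. g h \<in> Diff M"
    using g(1) unfolding generates_def by simp
  moreover have "\<forall>\<^sub>F h in nhds 0. \<forall>x\<in>points M. norm (f t (g h x) - f t x - h *\<^sub>R \<Lambda> (f t) x) \<le> \<bar>h\<bar> * (e / 4)"
    using g(1)[unfolded generates_def, THEN conjunct2, rule_format, OF F] e4 by blast
  moreover note generates_uniform[OF g(1) H e4]
  ultimately
  have ev: "\<forall>\<^sub>F h in nhds 0. g h \<in> Diff M \<and> (\<forall>x\<in>points M.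
      norm (f t (g h x) - f t x - h *\<^sub>R \<Lambda> (f t) x) \<le> \<bar>h\<bar> * (e / 4) \<and> norm (H (g h x) - H x) \<le> e / 4)"
    by eventually_elim simp
  have "\<forall>\<^sub>F s in at t within S. \<forall>x\<in>points M. dist ((f s x - f t x) /\<^sub>R (s - t)) (H x) < e / 4"
    using Cinf_limit_uniform[OF lim] e4 unfolding uniform_limit_iff by blast
  moreover have "\<forall>\<^sub>F s in at t within S. s \<noteq> t" by (simp add: eventually_at_filter)
  ultimately show ?thesis
    using filterlim_iff[THEN iffD1, OF tends, rule_format, OF ev]
  proof eventually_elim
    case (elim s)
    let ?g = "g (- (s - t))"
    have "norm (f s (?g x) - f t x) \<le> \<bar>s - t\<bar> * (c + e)" if x: "x \<in> points M" for x
    proof -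
      let ?y = "?g x"
      have y: "?y \<in> points M" using elim(3) x Diff_points by blast
      have 1: "norm (f s ?y - f t ?y - (s - t) *\<^sub>R H ?y) \<le> \<bar>s - t\<bar> * (e / 4)"
      proof -
        have "f s ?y - f t ?y - (s - t) *\<^sub>R H ?y = (s - t) *\<^sub>R ((f s ?y - f t ?y) /\<^sub>R (s - t) - H ?y)"
          using elim(2) by (simp add: scaleR_diff_right)
        moreover have "norm ((f s ?y - f t ?y) /\<^sub>R (s - t) - H ?y) \<le> e / 4"
          using bspec[OF elim(1) y] unfolding dist_norm by linarith
        ultimately show ?thesis by (simp only: norm_scaleR real_norm_def mult_left_mono abs_ge_zero)
      qed
      have 2: "norm ((s - t) *\<^sub>R (H ?y - H x)) \<le> \<bar>s - t\<bar> * (e / 4)"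
        unfolding norm_scaleR real_norm_def using elim(3) x by (intro mult_left_mono) auto
      have 3: "norm (f t ?y - f t x - (- (s - t)) *\<^sub>R \<Lambda> (f t) x) \<le> \<bar>s - t\<bar> * (e / 4)"
      proof -
        have "\<bar>- (s - t)\<bar> = \<bar>s - t\<bar>" by simp
        moreover have "norm (f t ?y - f t x - (- (s - t)) *\<^sub>R \<Lambda> (f t) x) \<le> \<bar>- (s - t)\<bar> * (e / 4)"
          using elim(3) x by blast
        ultimately show ?thesis by (simp only:)
      qed
      have 4: "norm ((s - t) *\<^sub>R (H x - \<Lambda> (f t) x)) \<le> \<bar>s - t\<bar> * (c + e / 4)"
        unfolding norm_scaleR real_norm_def using g(2)[OF x] by (intro mult_left_mono) auto
      have "f s ?y - f t x = (f s ?y - f t ?y - (s - t) *\<^sub>R H ?y) + (s - t) *\<^sub>R (H ?y - H x) +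
          (f t ?y - f t x - (- (s - t)) *\<^sub>R \<Lambda> (f t) x) + (s - t) *\<^sub>R (H x - \<Lambda> (f t) x)"
        by (simp add: algebra_simps)
      also have "norm \<dots> \<le> \<bar>s - t\<bar> * (e / 4) + \<bar>s - t\<bar> * (e / 4) + \<bar>s - t\<bar> * (e / 4) + \<bar>s - t\<bar> * (c + e / 4)"
        by (intro norm_triangle_mono 1 2 3 4)
      also have "\<dots> = \<bar>s - t\<bar> * (c + e)" by (simp add: algebra_simps)
      finally show ?thesis .
    qed
    then show ?case
      unfolding near_def using elim(3) by (intro bexI[of _ ?g]) (auto intro: ennreal_leI)
  qed
qed

end

section \<open>Normal components and their lower semicontinuity\<close>

context smooth_mfd
begin

text \<open>A change of charts only changes the direction in which \<open>F\<close> is differentiated.\<close>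

lemma tangent_image_chart:
  fixes F :: "'m \<Rightarrow> real ^ 'n"
  assumes F: "smooth_fun M F" and c: "(U, \<phi>) \<in> atlas M" "x \<in> U"
  shows "tangent_image M F x = (\<lambda>v. chart_deriv U \<phi> F v x) ` V"
proof
  show "(\<lambda>v. chart_deriv U \<phi> F v x) ` V \<subseteq> tangent_image M F x"
    unfolding tangent_image_def chart_deriv_def using c by force
  show "tangent_image M F x \<subseteq> (\<lambda>v. chart_deriv U \<phi> F v x) ` V"
  proof
    fix u assume "u \<in> tangent_image M F x"
    then obtain W \<psi> v where d: "(W, \<psi>) \<in> atlas M" "x \<in> W" "v \<in> V"
      and u: "u = dir_deriv (F \<circ> inv_into W \<psi>) v (\<psi> x)"
      unfolding tangent_image_def by auto
    note ch = chain_in_charts(2)[OF smooth_self_map_id d(1) c(1) chart_open[OF c(1)] subset_refl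
        smooth_funD[OF F c(1)] d(2) c(2) d(3)]
    have "u = chart_deriv U \<phi> F (dir_deriv (\<phi> \<circ> (\<lambda>x. x) \<circ> inv_into W \<psi>) v (\<psi> x)) x"
      unfolding u chart_deriv_def using ch by (intro dir_deriv_eq) (simp add: o_def)
    then show "u \<in> (\<lambda>v. chart_deriv U \<phi> F v x) ` V" using ch by blast
  qed
qed

lemma chart_deriv_linear:
  assumes F: "smooth_fun M F" and c: "(U, \<phi>) \<in> atlas M" "x \<in> U"
  obtains L where "bounded_linear L" "\<And>v. v \<in> V \<Longrightarrow> chart_deriv U \<phi> F v x = L v"
  using dir_deriv_bounded_linear[OF V chart_image_open[OF c(1)] smooth_funD[OF F c(1)], of "\<phi> x"] c(2)
  unfolding chart_deriv_def by blast

lemma subspace_tangent_image: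
  fixes F :: "'m \<Rightarrow> real ^ 'n"
  assumes F: "smooth_fun M F" and x: "x \<in> points M"
  shows "subspace (tangent_image M F x)"
proof -
  obtain U \<phi> where c: "(U, \<phi>) \<in> atlas M" "x \<in> U" using chart_at[OF x] by blast
  obtain L where L: "bounded_linear L" "\<And>v. v \<in> V \<Longrightarrow> chart_deriv U \<phi> F v x = L v"
    using chart_deriv_linear[OF F c] by blast
  have "tangent_image M F x = L ` V" unfolding tangent_image_chart[OF F c] using L(2) by simp
  then show ?thesis using linear_subspace_image[OF bounded_linear.linear[OF L(1)] V] by simp
qed

lemma normal_part_orthogonal:
  fixes F :: "'m \<Rightarrow> real ^ 'n"
  assumes F: "smooth_fun M F" and x: "x \<in> points M"
  shows "normal_part M F h x \<in> orthogonal_comp (tangent_image M F x)"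
    and "h x - normal_part M F h x \<in> tangent_image M F x"
proof -
  let ?S = "tangent_image M F x"
  have S: "subspace ?S" by (rule subspace_tangent_image[OF F x])
  obtain y z where yz: "y \<in> span ?S" "\<And>w. w \<in> span ?S \<Longrightarrow> orthogonal z w" "h x = y + z"
    using orthogonal_subspace_decomp_exists[of ?S "h x"] by blast
  have "span ?S = ?S" using S by (simp add: span_eq_iff)
  with yz have z: "z \<in> orthogonal_comp ?S \<and> h x - z \<in> ?S"
    by (auto simp: orthogonal_comp_def orthogonal_commute)
  have unique: "w = z" if w: "w \<in> orthogonal_comp ?S \<and> h x - w \<in> ?S" for w
  proof -
    have "w - z = (h x - z) - (h x - w)" by simp
    then have "w - z \<in> ?S" using w z S subspace_diff by metis
    moreover have "w - z \<in> orthogonal_comp ?S"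
      using w z by (auto simp: subspace_diff[OF subspace_orthogonal_comp])
    ultimately show ?thesis by (auto simp: orthogonal_comp_def orthogonal_def)
  qed
  have "normal_part M F h x = z"
    unfolding normal_part_def using z unique by (rule the_equality)
  with z show "normal_part M F h x \<in> orthogonal_comp ?S" "h x - normal_part M F h x \<in> ?S" by simp_all
qed

lemma norm_normal_part_Pythagoras:
  fixes F :: "'m \<Rightarrow> real ^ 'n"
  assumes F: "smooth_fun M F" and x: "x \<in> points M" and u: "u \<in> tangent_image M F x"
  shows "norm (normal_part M F h x + u) ^ 2 = norm (normal_part M F h x) ^ 2 + norm u ^ 2"
  using normal_part_orthogonal(1)[OF F x, of h] u
  by (intro norm_add_Pythagorean) (auto simp: orthogonal_comp_def orthogonal_commute)

lemma norm_normal_part_le: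
  fixes F :: "'m \<Rightarrow> real ^ 'n"
  assumes F: "smooth_fun M F" and x: "x \<in> points M" and u: "u \<in> tangent_image M F x"
  shows "norm (normal_part M F h x) \<le> norm (h x - u)"
proof -
  let ?n = "normal_part M F h x"
  have "h x - ?n - u \<in> tangent_image M F x"
    using subspace_diff[OF subspace_tangent_image[OF F x] normal_part_orthogonal(2)[OF F x] u] .
  from norm_normal_part_Pythagoras[OF F x this, of h]
  have "norm ?n ^ 2 \<le> norm (h x - u) ^ 2" by simp
  then show ?thesis by (rule power2_le_imp_le) simp
qed

lemma normal_part_cong: "h x = h' x \<Longrightarrow> normal_part M F h x = normal_part M F h' x"
  by (simp add: normal_part_def)

text \<open>Convergence in \<open>C\<^sup>\<infinity>\<close> includes that of the first spatial derivatives, so that time and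
  space derivatives commute.\<close>

lemma chart_deriv_time_derivative:
  fixes f :: "real \<Rightarrow> 'm \<Rightarrow> real ^ 'n"
  assumes f: "\<And>s. s \<in> S \<Longrightarrow> smooth_fun M (f s)" and t: "t \<in> S"
    and lim: "Cinf_limit M (\<lambda>s x. (f s x - f t x) /\<^sub>R (s - t)) H (at t within S)"
    and c: "(U, \<phi>) \<in> atlas M" "x \<in> U"
  shows "((\<lambda>s. f s x) has_vector_derivative H x) (at t within S)"
    and "v \<in> V \<Longrightarrow> ((\<lambda>s. chart_deriv U \<phi> (f s) v x) has_vector_derivative chart_deriv U \<phi> H v x) (at t within S)"
proof -
  have K: "compact {\<phi> x}" "{\<phi> x} \<subseteq> \<phi> ` U" using c(2) by auto
  have "uniform_limit {\<phi> x} (\<lambda>s. iter_deriv ((\<lambda>x. (f s x - f t x) /\<^sub>R (s - t)) \<circ> inv_into U \<phi>) [])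
      (iter_deriv (H \<circ> inv_into U \<phi>) []) (at t within S)"
    by (rule Cinf_limitD[OF lim c(1) K]) simp
  from tendsto_uniform_limitI[OF this, of "\<phi> x"]
  show "((\<lambda>s. f s x) has_vector_derivative H x) (at t within S)"
    unfolding has_vector_derivative_iff_Lim using chart_inv[OF c] by simp
  assume v: "v \<in> V"
  let ?q = "\<lambda>s. (\<lambda>x. (f s x - f t x) /\<^sub>R (s - t)) \<circ> inv_into U \<phi>"
  have "uniform_limit {\<phi> x} (\<lambda>s. iter_deriv (?q s) [v]) (iter_deriv (H \<circ> inv_into U \<phi>) [v]) (at t within S)"
    by (rule Cinf_limitD[OF lim c(1) K]) (use v in simp)
  from tendsto_uniform_limitI[OF this, of "\<phi> x"]
  have lim: "((\<lambda>s. dir_deriv (?q s) v (\<phi> x)) \<longlongrightarrow> chart_deriv U \<phi> H v x) (at t within S)"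
    by (simp add: chart_deriv_def)
  have "dir_deriv (?q s) v (\<phi> x) = (chart_deriv U \<phi> (f s) v x - chart_deriv U \<phi> (f t) v x) /\<^sub>R (s - t)"
    if s: "s \<in> S" for s
  proof (rule dir_deriv_eq)
    have d: "has_dir_deriv (f r \<circ> inv_into U \<phi>) v (chart_deriv U \<phi> (f r) v x) (\<phi> x)" if "r \<in> S" for r
      unfolding chart_deriv_def using smooth_on_has_dir_deriv[OF smooth_funD[OF f[OF that] c(1)] v] c(2) by blast
    show "has_dir_deriv (?q s) v ((chart_deriv U \<phi> (f s) v x - chart_deriv U \<phi> (f t) v x) /\<^sub>R (s - t)) (\<phi> x)"
      using bounded_linear.has_vector_derivative[OF bounded_linear_scaleR_right
          has_vector_derivative_diff[OF d[OF s] d[OF t]], of "inverse (s - t)"] by (simp add: o_def)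
  qed
  then have "\<forall>\<^sub>F s in at t within S. dir_deriv (?q s) v (\<phi> x) =
      (chart_deriv U \<phi> (f s) v x - chart_deriv U \<phi> (f t) v x) /\<^sub>R (s - t)"
    unfolding eventually_at_filter by (intro always_eventually) blast
  from Lim_transform_eventually[OF lim this]
  show "((\<lambda>s. chart_deriv U \<phi> (f s) v x) has_vector_derivative chart_deriv U \<phi> H v x) (at t within S)"
    unfolding has_vector_derivative_iff_Lim .
qed

text \<open>The norm of the normal part is the distance of \<open>h\<^sub>s\<close> from the image of the linear map \<open>A\<^sub>s\<close>. A
  preimage \<open>v\<close> of the tangential part at time \<open>s\<close> is a competitor at time \<open>t\<close>; the error it causes is at most
  \<open>\<bar>v\<bar> \<kappa>\<^sub>s\<close>, and \<open>v\<close> stays bounded as \<open>s\<close> tends to \<open>t\<close> because \<open>A\<^sub>t\<close> is injective.\<close>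

lemma norm_normal_part_lower_semicontinuous:
  fixes f h :: "real \<Rightarrow> 'm \<Rightarrow> real ^ 'n"
  assumes f: "\<And>s. s \<in> S \<Longrightarrow> smooth_fun M (f s)" and t: "t \<in> S"
    and c: "(U, \<phi>) \<in> atlas M" "x \<in> U"
    and h: "((\<lambda>s. h s x) \<longlongrightarrow> h t x) (at t within S)"
    and A: "\<And>v. v \<in> V \<Longrightarrow> ((\<lambda>s. chart_deriv U \<phi> (f s) v x) \<longlongrightarrow> chart_deriv U \<phi> (f t) v x) (at t within S)"
    and inj: "inj_on (\<lambda>v. chart_deriv U \<phi> (f t) v x) V"
    and \<eta>: "\<eta> < norm (normal_part M (f t) (h t) x)"
  shows "\<forall>\<^sub>F s in at t within S. \<eta> < norm (normal_part M (f s) (h s) x)"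
proof -
  have x: "x \<in> points M" using chart_subset[OF c(1)] c(2) by blast
  let ?A = "\<lambda>s v. chart_deriv U \<phi> (f s) v x" and ?n = "\<lambda>s. normal_part M (f s) (h s) x"
  obtain B where B: "finite B" "B \<subseteq> V" "pairwise orthogonal B" "\<And>b. b \<in> B \<Longrightarrow> norm b = 1" "span B = V"
    using orthonormal_basis_exists[OF V] by metis
  have expand: "?A s v = (\<Sum>b\<in>B. (v \<bullet> b) *\<^sub>R ?A s b)" if "s \<in> S" "v \<in> V" for s v
    unfolding chart_deriv_def
    by (rule dir_deriv_expansion[OF V chart_image_open[OF c(1)] smooth_funD[OF f[OF that(1)] c(1)] B
          imageI[OF c(2)] that(2)])
  define \<kappa> where "\<kappa> s = (\<Sum>b\<in>B. norm (?A s b - ?A t b))" for s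
  have \<kappa>: "norm (?A s v - ?A t v) \<le> norm v * \<kappa> s" if "s \<in> S" "v \<in> V" for s v
  proof -
    have "?A s v - ?A t v = (\<Sum>b\<in>B. (v \<bullet> b) *\<^sub>R (?A s b - ?A t b))"
      using expand that t by (simp add: sum_subtractf scaleR_diff_right)
    also have "norm \<dots> \<le> (\<Sum>b\<in>B. norm v * norm (?A s b - ?A t b))"
    proof (rule sum_norm_le)
      fix b assume "b \<in> B"
      then have "\<bar>v \<bullet> b\<bar> \<le> norm v" using Cauchy_Schwarz_ineq2[of v b] B(4) by simp
      then show "norm ((v \<bullet> b) *\<^sub>R (?A s b - ?A t b)) \<le> norm v * norm (?A s b - ?A t b)"
        by (simp add: mult_right_mono)
    qed
    finally show ?thesis by (simp add: \<kappa>_def sum_distrib_left)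
  qed
  have \<kappa>_lim: "(\<kappa> \<longlongrightarrow> 0) (at t within S)"
  proof -
    have "(\<kappa> \<longlongrightarrow> (\<Sum>b\<in>B. norm (?A t b - ?A t b))) (at t within S)"
      unfolding \<kappa>_def by (intro tendsto_sum tendsto_norm tendsto_diff tendsto_const A) (use B(2) in blast)
    then show ?thesis by simp
  qed
  obtain L where L: "bounded_linear L" "\<And>v. v \<in> V \<Longrightarrow> ?A t v = L v"
    using chart_deriv_linear[OF f[OF t] c] by blast
  have "\<forall>v\<in>V. L v = 0 \<longrightarrow> v = 0"
  proof (intro ballI impI)
    fix v assume v: "v \<in> V" "L v = 0"
    have "0 \<in> V" using V subspace_0 by blast
    moreover have "?A t v = ?A t 0"
      using L(2)[OF v(1)] L(2)[OF \<open>0 \<in> V\<close>] v(2) linear_0[OF bounded_linear.linear[OF L(1)]] by simp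
    ultimately show "v = 0" using inj v(1) by (meson inj_onD)
  qed
  then obtain k where k: "k > 0" "\<And>v. v \<in> V \<Longrightarrow> norm (L v) \<ge> k * norm v"
    using injective_imp_isometric[OF closed_subspace[OF V] V L(1)] by blast
  have bound: "norm (?n t) \<le> norm (?n s) + (norm (h t x - h s x) + \<kappa> s * (2 * norm (h s x) / k))"
    if s: "s \<in> S" and small: "\<kappa> s < k / 2" for s
  proof -
    have "h s x - ?n s \<in> (\<lambda>v. ?A s v) ` V"
      using normal_part_orthogonal(2)[OF f[OF s] x, of "h s"] tangent_image_chart[OF f[OF s] c] by simp
    then obtain v where v: "v \<in> V" "h s x - ?n s = ?A s v" by blast
    have "norm (?n s + ?A s v) ^ 2 = norm (?n s) ^ 2 + norm (?A s v) ^ 2"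
      by (rule norm_normal_part_Pythagoras[OF f[OF s] x]) (use v tangent_image_chart[OF f[OF s] c] in auto)
    moreover have "?n s + ?A s v = h s x" using v(2) by (simp add: algebra_simps)
    ultimately have "norm (?A s v) ^ 2 \<le> norm (h s x) ^ 2" by simp
    then have As: "norm (?A s v) \<le> norm (h s x)" by (rule power2_le_imp_le) simp
    have \<kappa>0: "\<kappa> s \<ge> 0" by (simp add: \<kappa>_def sum_nonneg)
    have "k * norm v \<le> norm (?A t v)" using k(2)[OF v(1)] L(2)[OF v(1)] by simp
    also have "\<dots> \<le> norm (?A s v) + norm (?A s v - ?A t v)"
      using norm_triangle_ineq4[of "?A s v" "?A s v - ?A t v"] by simp
    also have "\<dots> \<le> norm (h s x) + norm v * (k / 2)"
    proof -
      have "norm v * \<kappa> s \<le> norm v * (k / 2)" using small by (intro mult_left_mono) auto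
      then show ?thesis using As \<kappa>[OF s v(1)] by linarith
    qed
    finally have nv: "norm v \<le> 2 * norm (h s x) / k" using k(1) by (simp add: field_simps)
    have "norm (?n t) \<le> norm (h t x - ?A t v)"
      by (rule norm_normal_part_le[OF f[OF t] x]) (use v tangent_image_chart[OF f[OF t] c] in auto)
    also have "h t x - ?A t v = ?n s + (h t x - h s x) + (?A s v - ?A t v)"
      using v(2) by (simp add: algebra_simps)
    also have "norm \<dots> \<le> norm (?n s) + norm (h t x - h s x) + norm (?A s v - ?A t v)"
      by (intro norm_triangle_mono order_refl)
    also have "norm (?A s v - ?A t v) \<le> \<kappa> s * (2 * norm (h s x) / k)"
    proof -
      have "norm v * \<kappa> s \<le> (2 * norm (h s x) / k) * \<kappa> s" using nv \<kappa>0 by (rule mult_right_mono)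
      then show ?thesis using \<kappa>[OF s v(1)] by (simp add: mult.commute)
    qed
    finally show ?thesis by simp
  qed
  have "((\<lambda>s. norm (h t x - h s x) + \<kappa> s * (2 * norm (h s x) / k)) \<longlongrightarrow>
      norm (h t x - h t x) + 0 * (2 * norm (h t x) / k)) (at t within S)"
    by (intro tendsto_intros h \<kappa>_lim) (use k(1) in simp)
  then have "((\<lambda>s. norm (h t x - h s x) + \<kappa> s * (2 * norm (h s x) / k)) \<longlongrightarrow> 0) (at t within S)" by simp
  from order_tendstoD(2)[OF this, of "norm (?n t) - \<eta>"] \<eta>
  have "\<forall>\<^sub>F s in at t within S. norm (h t x - h s x) + \<kappa> s * (2 * norm (h s x) / k) < norm (?n t) - \<eta>" by simp
  moreover have "\<forall>\<^sub>F s in at t within S. \<kappa> s < k / 2"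
    using order_tendstoD(2)[OF \<kappa>_lim, of "k / 2"] k(1) by simp
  moreover have "\<forall>\<^sub>F s in at t within S. s \<in> S" by (auto simp: eventually_at_filter)
  ultimately show ?thesis
  proof eventually_elim
    case (elim s)
    then show ?case using bound[of s] by linarith
  qed
qed

end

section \<open>Integrating a local bound\<close>

text \<open>Here \<open>N s t c\<close> stands for the assertion that the distance between the parameters \<open>s\<close> and \<open>t\<close> is
  at most \<open>c\<close>. Lower semicontinuity gives \<open>G \<ge> G(t) - e/2\<close> near \<open>t\<close>, so that the local bound
  \<open>(b - a) (G(t) + e/2)\<close> is at most the integral of \<open>G\<close> over \<open>(a, b]\<close> plus \<open>e (b - a)\<close>. This form is additive in
  the interval and passes to \<open>[0, 1]\<close> by bisection.\<close>

lemma integrate_local_bound: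
  fixes G :: "real \<Rightarrow> ennreal" and N :: "real \<Rightarrow> real \<Rightarrow> ennreal \<Rightarrow> bool"
  assumes refl: "\<And>s. N s s 0"
    and sym: "\<And>r s c. N r s c \<Longrightarrow> N s r c"
    and mono: "\<And>r s c c'. \<lbrakk>N r s c; c \<le> c'\<rbrakk> \<Longrightarrow> N r s c'"
    and trans: "\<And>q r s c c'. \<lbrakk>N q r c; N r s c'\<rbrakk> \<Longrightarrow> N q s (c + c')"
    and finite: "\<And>t. t \<in> {0..1} \<Longrightarrow> G t < top"
    and lsc: "\<And>t a. \<lbrakk>t \<in> {0..1}; a < G t\<rbrakk> \<Longrightarrow> \<forall>\<^sub>F s in at t within {0..1}. a < G s"
    and local: "\<And>t c e. \<lbrakk>t \<in> {0..1}; G t \<le> ennreal c; c \<ge> 0; e > 0\<rbrakk> \<Longrightarrow>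
      \<forall>\<^sub>F s in at t within {0..1}. N s t (ennreal (\<bar>s - t\<bar> * (c + e)))"
    and e: "e > 0"
  shows "N 1 0 ((\<integral>\<^sup>+ t\<in>{0..1}. G t \<partial>lborel) + ennreal e)"
proof -
  define G' where "G' s = G s * indicator {0..1} s" for s
  have near: "\<exists>d>0. \<forall>s\<in>{0..1}. \<bar>s - t\<bar> < d \<longrightarrow> P s" if "\<forall>\<^sub>F s in at t within {0..1}. P s" "P t" for P and t :: real
  proof -
    from that(1)[unfolded eventually_at] obtain d
      where d: "0 < d" "\<forall>s\<in>{0..1}. s \<noteq> t \<and> dist s t < d \<longrightarrow> P s" by (elim exE conjE)
    have "P s" if "s \<in> {0..1}" "\<bar>s - t\<bar> < d" for s
      using d(2) that \<open>P t\<close> by (cases "s = t") (simp_all add: dist_real_def)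
    then show ?thesis using d(1) by (intro exI[of _ d]) simp
  qed
  have meas: "G' \<in> borel_measurable lborel"
  proof (rule borel_measurableI_greater)
    fix y :: ennreal
    have "{s \<in> space lborel. y < G' s} = {s \<in> {0..1}. y < G s}"
      by (auto simp: G'_def indicator_def)
    moreover have "openin (top_of_set {0..1}) {s \<in> {0..1}. y < G s}"
      unfolding openin_euclidean_subtopology_iff
    proof (intro conjI ballI)
      fix t assume "t \<in> {s \<in> {0..1}. y < G s}"
      then have "t \<in> {0..1}" "y < G t" by simp_all
      from near[OF lsc[OF this] this(2)]
      show "\<exists>d>0. \<forall>s\<in>{0..1}. dist s t < d \<longrightarrow> s \<in> {s \<in> {0..1}. y < G s}"
        by (simp add: dist_real_def)
    qed auto
    then obtain T where T: "open T" "{s \<in> {0..1}. y < G s} = {0..1} \<inter> T"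
      unfolding openin_open by blast
    ultimately show "{s \<in> space lborel. y < G' s} \<in> sets lborel" by (simp only: T(2)) (simp add: T(1))
  qed
  \<comment> \<open>Half-open intervals make the integral additive without discussing end points.\<close>
  define I where "I a b = (\<integral>\<^sup>+ s. G' s * indicator {a<..b} s \<partial>lborel)" for a b
  have I_add: "I a b + I b c = I a c" if "a \<le> b" "b \<le> c" for a b c
  proof -
    have "I a b + I b c = (\<integral>\<^sup>+ s. G' s * indicator {a<..b} s + G' s * indicator {b<..c} s \<partial>lborel)"
      unfolding I_def using meas by (intro nn_integral_add[symmetric]) auto
    also have "\<dots> = I a c"
      unfolding I_def using that by (intro nn_integral_cong) (auto simp: indicator_def)
    finally show ?thesis .
  qed
  define P where "P a b \<longleftrightarrow> (0 \<le> a \<and> b \<le> 1 \<longrightarrow> N b a (I a b + ennreal (e * (b - a))))" for a b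
  have "P 0 1"
  proof (rule Bolzano)
    show "(0::real) \<le> 1" by simp
  next
    fix a b c :: real assume *: "P a b" "P b c" "a \<le> b" "b \<le> c"
    show "P a c"
      unfolding P_def
    proof
      assume ac: "0 \<le> a \<and> c \<le> 1"
      have "N b a (I a b + ennreal (e * (b - a)))" "N c b (I b c + ennreal (e * (c - b)))"
        using * ac by (simp_all add: P_def)
      from trans[OF this(2,1)]
      have "N c a ((I b c + ennreal (e * (c - b))) + (I a b + ennreal (e * (b - a))))" .
      moreover have "(I b c + ennreal (e * (c - b))) + (I a b + ennreal (e * (b - a))) =
          (I a b + I b c) + (ennreal (e * (c - b)) + ennreal (e * (b - a)))"
        by (simp add: add_ac)
      moreover have "ennreal (e * (c - b)) + ennreal (e * (b - a)) = ennreal (e * (c - a))"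
        using * e by (subst ennreal_plus[symmetric]) (auto simp: algebra_simps)
      ultimately show "N c a (I a c + ennreal (e * (c - a)))" using I_add[OF *(3,4)] by simp
    qed
  next
    fix t :: real assume "0 \<le> t" "t \<le> 1"
    then have t: "t \<in> {0..1}" by simp
    define c where "c = enn2real (G t)"
    have c: "G t = ennreal c" "c \<ge> 0" using finite[OF t] by (auto simp: c_def)
    have e2: "e / 2 > 0" using e by simp
    have "N t t (ennreal (\<bar>t - t\<bar> * (c + e / 2)))" using refl by simp
    from near[OF local[OF t eq_refl[OF c(1)] c(2) e2] this]
    obtain d1 where d1: "d1 > 0"
      "\<And>s. \<lbrakk>s \<in> {0..1}; \<bar>s - t\<bar> < d1\<rbrakk> \<Longrightarrow> N s t (ennreal (\<bar>s - t\<bar> * (c + e / 2)))" by blast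
    \<comment> \<open>The maximum is needed because \<^const>\<open>ennreal\<close> maps negative numbers to \<open>0\<close>.\<close>
    define m where "m = max 0 (c - e / 2)"
    have "\<exists>d>0. \<forall>s\<in>{0..1}. \<bar>s - t\<bar> < d \<longrightarrow> ennreal m \<le> G s"
    proof (cases "c > 0")
      case True
      then have "ennreal m < G t" using e by (simp add: c m_def ennreal_less_iff)
      from near[OF lsc[OF t this] this] show ?thesis using less_imp_le by blast
    next
      case False
      then have "m = 0" using e c(2) by (simp add: m_def)
      then show ?thesis by (auto intro: exI[of _ 1])
    qed
    then obtain d2 where d2: "d2 > 0" "\<And>s. \<lbrakk>s \<in> {0..1}; \<bar>s - t\<bar> < d2\<rbrakk> \<Longrightarrow> ennreal m \<le> G s" by blast
    have "P a b" if ab: "a \<le> t" "t \<le> b" "b - a < min d1 d2" for a b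
      unfolding P_def
    proof
      assume in01: "0 \<le> a \<and> b \<le> 1"
      have "N b t (ennreal (\<bar>b - t\<bar> * (c + e / 2)))" "N a t (ennreal (\<bar>a - t\<bar> * (c + e / 2)))"
        by (rule d1(2); use ab in01 in simp)+
      from trans[OF this(1) sym[OF this(2)]]
      have "N b a (ennreal (\<bar>b - t\<bar> * (c + e / 2)) + ennreal (\<bar>a - t\<bar> * (c + e / 2)))" .
      moreover have "ennreal (\<bar>b - t\<bar> * (c + e / 2)) + ennreal (\<bar>a - t\<bar> * (c + e / 2)) =
          ennreal ((b - a) * (c + e / 2))"
      proof -
        have "\<bar>b - t\<bar> * (c + e / 2) + \<bar>a - t\<bar> * (c + e / 2) = (\<bar>b - t\<bar> + \<bar>a - t\<bar>) * (c + e / 2)"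
          by (rule distrib_right[symmetric])
        also have "\<bar>b - t\<bar> + \<bar>a - t\<bar> = b - a" using ab by simp
        finally show ?thesis using c(2) e by (simp flip: ennreal_plus)
      qed
      moreover have "ennreal ((b - a) * (c + e / 2)) \<le> I a b + ennreal (e * (b - a))"
      proof -
        have "(b - a) * (c - e / 2) \<le> (b - a) * m" using ab by (intro mult_left_mono) (auto simp: m_def)
        moreover have "(b - a) * (c + e / 2) = (b - a) * (c - e / 2) + e * (b - a)"
          by (simp add: field_simps)
        moreover have "(b - a) * m = m * (b - a)" by (rule mult.commute)
        ultimately have "(b - a) * (c + e / 2) \<le> m * (b - a) + e * (b - a)" by linarith
        then have "ennreal ((b - a) * (c + e / 2)) \<le> ennreal (m * (b - a) + e * (b - a))"
          by (rule ennreal_leI)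
        also have "\<dots> = ennreal m * ennreal (b - a) + ennreal (e * (b - a))"
          using ab e by (simp add: m_def ennreal_plus ennreal_mult)
        also have "ennreal m * ennreal (b - a) = (\<integral>\<^sup>+ s. ennreal m * indicator {a<..b} s \<partial>lborel)"
          using ab by (simp add: nn_integral_cmult_indicator)
        also have "\<dots> \<le> I a b"
          unfolding I_def
        proof (rule nn_integral_mono)
          fix s
          show "ennreal m * indicator {a<..b} s \<le> G' s * indicator {a<..b} s"
            using d2(2)[of s] ab in01 by (auto simp: indicator_def G'_def)
        qed
        finally show ?thesis by (simp add: add_right_mono)
      qed
      ultimately show "N b a (I a b + ennreal (e * (b - a)))" using mono by (simp only:)
    qed
    then show "\<exists>d>0. \<forall>a b. a \<le> t \<and> t \<le> b \<and> b - a < d \<longrightarrow> P a b"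
      using d1(1) d2(1) by (intro exI[of _ "min d1 d2"]) auto
  qed
  then have "N 1 0 (I 0 1 + ennreal e)" by (simp add: P_def)
  moreover have "I 0 1 \<le> (\<integral>\<^sup>+ t\<in>{0..1}. G t \<partial>lborel)"
    unfolding I_def G'_def by (intro nn_integral_mono) (auto simp: indicator_def)
  ultimately show ?thesis by (rule mono[OF _ add_right_mono])
qed

section \<open>The comparison of the two distances\<close>

lemma (in compact_mfd) near_le_G_length:
  fixes f :: "real \<Rightarrow> 'a \<Rightarrow> real ^ 'n"
  assumes f: "Imm_path M f" and e: "e > 0"
  shows "near (f 1) (f 0) (G_length M f + ennreal e)"
proof -
  obtain D :: "nat \<Rightarrow> real \<Rightarrow> 'a \<Rightarrow> real ^ 'n" where D0: "D 0 = f" and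
    D: "\<And>k t. t \<in> {0..1} \<Longrightarrow> D k t \<in> smooth_functions M \<and>
      Cinf_limit M (\<lambda>s x. (D k s x - D k t x) /\<^sub>R (s - t)) (D (Suc k) t) (at t within {0..1})"
    using f unfolding Imm_path_def smooth_curve_def by blast
  have sm: "smooth_fun M (D k t)" if "t \<in> {0..1}" for k t
    using D[OF that] by (simp add: smooth_functions_eq)
  have smf: "smooth_fun M (f t)" if "t \<in> {0..1}" for t using sm[OF that, of 0] D0 by simp
  have lim: "Cinf_limit M (\<lambda>s x. (f s x - f t x) /\<^sub>R (s - t)) (D 1 t) (at t within {0..1})"
    if "t \<in> {0..1}" for t using D[OF that, of 0] D0 by simp
  have imm: "f t \<in> Imm M" if "t \<in> {0..1}" for t using f that by (simp add: Imm_path_def)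
  have vel: "velocity f t x = D 1 t x" if t: "t \<in> {0..1}" and x: "x \<in> points M" for t x
  proof -
    obtain U \<phi> where c: "(U, \<phi>) \<in> atlas M" "x \<in> U" using chart_at[OF x] by blast
    have "((\<lambda>s. f s x) has_vector_derivative D 1 t x) (at t within {0..1})"
      by (rule chart_deriv_time_derivative(1)[OF smf t lim[OF t] c])
    then show ?thesis
      unfolding velocity_def using t by (intro vector_derivative_within_closed_interval) auto
  qed
  define G where "G t = G_inf M (f t) (velocity f t)" for t
  have G: "G t = (SUP x\<in>points M. ennreal (norm (normal_part M (f t) (D 1 t) x)))"
    if t: "t \<in> {0..1}" for t
    unfolding G_def G_inf_def Linf_norm_def
  proof (rule SUP_cong)
    fix x assume x: "x \<in> points M"
    show "ennreal (norm (normal_part M (f t) (velocity f t) x)) = ennreal (norm (normal_part M (f t) (D 1 t) x))"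
      by (simp only: normal_part_cong[where h = "velocity f t" and h' = "D 1 t", OF vel[OF t x]])
  qed simp
  have "near (f 1) (f 0) ((\<integral>\<^sup>+ t\<in>{0..1}. G t \<partial>lborel) + ennreal e)"
  proof (rule integrate_local_bound[where N = "\<lambda>s t. near (f s) (f t)"])
    show "near (f s) (f s) 0" for s by (rule near_refl)
    show "near (f s) (f r) c" if "near (f r) (f s) c" for r s c by (rule near_sym[OF that])
    show "near (f r) (f s) c'" if "near (f r) (f s) c" "c \<le> c'" for r s c c' by (rule near_mono[OF that])
    show "near (f q) (f s) (c + c')" if "near (f q) (f r) c" "near (f r) (f s) c'" for q r s c c'
      by (rule near_trans[OF that])
    show "e > 0" by (rule e)
  next
    fix t :: real assume t: "t \<in> {0..1}"
    obtain B where B: "\<And>x. x \<in> points M \<Longrightarrow> norm (D 1 t x) \<le> B"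
      using smooth_fun_bounded[OF sm[OF t]] by metis
    have "norm (normal_part M (f t) (D 1 t) x) \<le> B" if x: "x \<in> points M" for x
      using norm_normal_part_le[OF smf[OF t] x subspace_0[OF subspace_tangent_image[OF smf[OF t] x]], of "D 1 t"]
        B[OF x] by simp
    then have "G t \<le> ennreal B" unfolding G[OF t] by (intro SUP_least ennreal_leI)
    then show "G t < top" using order_le_less_trans ennreal_less_top by blast
  next
    fix t :: real and a assume t: "t \<in> {0..1}" and a: "a < G t"
    then obtain x where x: "x \<in> points M" "a < ennreal (norm (normal_part M (f t) (D 1 t) x))"
      unfolding G[OF t] less_SUP_iff by blast
    obtain \<eta> where \<eta>: "a = ennreal \<eta>" "\<eta> \<ge> 0" using x(2) by (cases a) auto
    obtain U \<phi> where c: "(U, \<phi>) \<in> atlas M" "x \<in> U" using chart_at[OF x(1)] by blast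
    have "\<forall>\<^sub>F s in at t within {0..1}. \<eta> < norm (normal_part M (f s) (D 1 s) x)"
    proof (rule norm_normal_part_lower_semicontinuous[OF smf t c])
      have "((\<lambda>s. D 1 s x) has_vector_derivative D (Suc 1) t x) (at t within {0..1})"
        by (rule chart_deriv_time_derivative(1)[OF sm t conjunct2[OF D[OF t]] c])
      from has_vector_derivative_continuous[OF this]
      show "((\<lambda>s. D 1 s x) \<longlongrightarrow> D 1 t x) (at t within {0..1})" by (simp add: continuous_within)
      show "((\<lambda>s. chart_deriv U \<phi> (f s) v x) \<longlongrightarrow> chart_deriv U \<phi> (f t) v x) (at t within {0..1})"
        if "v \<in> V" for v
        using has_vector_derivative_continuous[OF chart_deriv_time_derivative(2)[OF smf t lim[OF t] c that]]
        by (simp add: continuous_within)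
      show "inj_on (\<lambda>v. chart_deriv U \<phi> (f t) v x) V"
        using imm[OF t] c unfolding Imm_def chart_deriv_def by auto
      show "\<eta> < norm (normal_part M (f t) (D 1 t) x)" using x(2) \<eta> by (simp add: ennreal_less_iff)
    qed
    moreover have "\<forall>\<^sub>F s in at t within {0..1}. s \<in> {0..1}" by (auto simp: eventually_at_filter)
    ultimately show "\<forall>\<^sub>F s in at t within {0..1}. a < G s"
    proof eventually_elim
      case (elim s)
      have "a < ennreal (norm (normal_part M (f s) (D 1 s) x))" using elim(1) \<eta> by (simp add: ennreal_less_iff)
      also have "\<dots> \<le> G s" unfolding G[OF elim(2)] using x(1) by (rule SUP_upper)
      finally show ?case .
    qed
  next
    fix t c e :: real assume t: "t \<in> {0..1}" and c: "G t \<le> ennreal c" "c \<ge> 0" and e: "e > 0"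
    show "\<forall>\<^sub>F s in at t within {0..1}. near (f s) (f t) (ennreal (\<bar>s - t\<bar> * (c + e)))"
    proof (rule near_along_curve[OF smf[OF t] sm[OF t] e lim[OF t]])
      fix x assume x: "x \<in> points M"
      obtain U \<phi> where ch: "(U, \<phi>) \<in> atlas M" "x \<in> U" using chart_at[OF x] by blast
      have "D 1 t x - normal_part M (f t) (D 1 t) x \<in> (\<lambda>v. chart_deriv U \<phi> (f t) v x) ` V"
        using normal_part_orthogonal(2)[OF smf[OF t] x, of "D 1 t"] tangent_image_chart[OF smf[OF t] ch] by simp
      then obtain v where v: "v \<in> V" "D 1 t x - normal_part M (f t) (D 1 t) x = chart_deriv U \<phi> (f t) v x"
        by blast
      have "ennreal (norm (normal_part M (f t) (D 1 t) x)) \<le> ennreal c"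
        using c(1) SUP_upper[OF x, of "\<lambda>x. ennreal (norm (normal_part M (f t) (D 1 t) x))"]
        unfolding G[OF t] by (rule order_trans[rotated])
      then have "norm (normal_part M (f t) (D 1 t) x) \<le> c" using c(2) by (simp add: ennreal_le_iff)
      moreover have "D 1 t x - chart_deriv U \<phi> (f t) v x = normal_part M (f t) (D 1 t) x"
        using v(2) by (simp add: algebra_simps)
      ultimately show "\<exists>U \<phi> v. (U, \<phi>) \<in> atlas M \<and> x \<in> U \<and> v \<in> V \<and>
          norm (D 1 t x - chart_deriv U \<phi> (f t) v x) \<le> c"
        using ch v(1) by (intro exI[of _ U] exI[of _ \<phi>] exI[of _ v]) simp
    qed
  qed
  then show ?thesis by (simp add: G_length_def G_def)
qed

lemma dist_G_eq_INF_paths: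
  "dist_G M F0 F1 =
    (INF f\<in>{f. Imm_path M f \<and> shape M (f 0) = F0 \<and> shape M (f 1) = F1}. G_length M f)"
  (is "_ = ?R")
proof (rule antisym)
  show "dist_G M F0 F1 \<le> ?R"
  proof (rule INF_greatest)
    fix f assume f: "f \<in> {f. Imm_path M f \<and> shape M (f 0) = F0 \<and> shape M (f 1) = F1}"
    then have "f 0 \<in> Imm M" "f 1 \<in> Imm M" by (auto simp: Imm_path_def)
    then have "dist_G M F0 F1 \<le> dist_G_Imm M (f 0) (f 1)"
      unfolding dist_G_def using f by (intro Inf_lower) blast
    also have "\<dots> \<le> G_length M f"
      unfolding dist_G_Imm_def using f by (intro INF_lower) simp
    finally show "dist_G M F0 F1 \<le> G_length M f" .
  qed
  show "?R \<le> dist_G M F0 F1"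
    unfolding dist_G_def dist_G_Imm_def
    by (rule Inf_greatest) (auto intro!: INF_greatest INF_lower)
qed

theorem mainTheorem12:
  fixes M :: "('m, 'e::euclidean_space) manifold"
    and F0 F1 :: "('m \<Rightarrow> real ^ 'n) set"
  assumes "smooth_manifold M"
    and "compact_space (top_of M)"
    and "connected_space (top_of M)"
    and "dim (model M) \<le> CARD('n)"
    and "F0 \<in> B_i M" and "F1 \<in> B_i M"
  shows "dist_Frechet M F0 F1 \<le> dist_G M F0 F1 \<and>
    dist_G M F0 F1 =
      (INF f\<in>{f. Imm_path M f \<and> shape M (f 0) = F0 \<and> shape M (f 1) = F1}.
        \<integral>\<^sup>+ t\<in>{0..1}. G_inf M (f t) (velocity f t) \<partial>lborel)"
proof
  interpret compact_mfd M by unfold_locales fact+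
  show "dist_Frechet M F0 F1 \<le> dist_G M F0 F1"
    unfolding dist_G_eq_INF_paths
  proof (rule INF_greatest)
    fix f assume f: "f \<in> {f. Imm_path M f \<and> shape M (f 0) = F0 \<and> shape M (f 1) = F1}"
    then have imm: "f 0 \<in> Imm M" "f 1 \<in> Imm M" by (auto simp: Imm_path_def)
    show "dist_Frechet M F0 F1 \<le> G_length M f"
    proof (rule ennreal_le_epsilon)
      fix e :: real assume "e > 0"
      then have "near (f 1) (f 0) (G_length M f + ennreal e)"
        using near_le_G_length f by blast
      from near_imp_dist_Frechet_le[OF this imm]
      show "dist_Frechet M F0 F1 \<le> G_length M f + ennreal e" using f by simp
    qed
  qed
  show "dist_G M F0 F1 =
      (INF f\<in>{f. Imm_path M f \<and> shape M (f 0) = F0 \<and> shape M (f 1) = F1}.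
        \<integral>\<^sup>+ t\<in>{0..1}. G_inf M (f t) (velocity f t) \<partial>lborel)"
    unfolding dist_G_eq_INF_paths G_length_def ..
qed

end
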